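(* Fix $\alpha_0>0$. Suppose that $\beta_m$ satisfies either $m\beta_m\to\infty$ or $m\beta_m\to 0$ as $m\to\infty$. For all $m\in\mathbb N$, the scaled recallable reward process $\{\overline Q^m(t)\}_{t\ge0}$, $\overline Q^m(t)=\frac1m Q^m(mt)$, admits a unique steady-state distribution, and the limits $$q_k=\lim_{m\to\infty}\mathbb E\big(\overline Q^m_k(\infty)\big),\qquad k\in\mathcal K,$$ exist. Furthermore: 1. (Memory-abundant regime) Suppose that $m\beta_m\to\infty$ as $m\to\infty$. If $\alpha_0\le\lambda_1/K$, then $$q_1=\lambda_1-(K-1)\alpha_0,\qquad q_k=\frac{\lambda_k}{\lambda_1}\alpha_0,\quad k=2,\dots,K.$$ If $\alpha_0>\lambda_1/K$, then $q_k=\lambda_k/K$ for $k=1,\dots,K$. 2. (Memory-deficient regime) Suppose that $m\beta_m\to0$ as $m\to\infty$. Then $$q_k=\lambda_k\,\frac{\lambda_k\vee\alpha_0+(K-1)\alpha_0}{\sum_{i\in\mathcal K}\left[\lambda_i\vee\alpha_0+(K-1)\alpha_0\right]},\qquad k=1,\dots,K.$$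
   Context: Write $x\vee y=\max\{x,y\}$. Let $K$ be a positive integer, $\mathcal K=\{1,\dots,K\}$ (the set of actions), and let the reward rates satisfy $\lambda_1>\lambda_2\ge\dots\ge\lambda_K>0$. For each $m\in\mathbb N$ let $\beta_m>0$ (update rate) and $\alpha_m=\alpha_0 m$, where $\alpha_0>0$ is fixed. The $m$-th system is the right-continuous continuous-time Markov jump process $W^m(t)=(Q^m(t),C^m(t))$ on $\mathbb Z_+^K\times\mathcal K$ with the following dynamics. (i) Arrivals: $Q^m_k$ increases by $1$ at rate $\lambda_k$ if $C^m(t)=k$, and at rate $0$ otherwise. (ii) Departures: $Q^m_k$ decreases by $1$ at rate $Q^m_k(t)/m$. (iii) Updates: update points form an independent Poisson process of rate $\beta_m$; at an update point at time $t$, $C^m$ is replaced by a new choice (possibly equal to the old one), equal to $k$ with conditional probability $\frac{Q^m_k(t)\vee\alpha_m}{\sum_{i\in\mathcal K}(Q^m_i(t)\vee\alpha_m)}$ given the past, and $C^m$ is constant between update points. The steady-state distribution of $\overline Q^m$ is the law of $\overline Q^m$ when the Markov process $W^m$ is in its stationary distribution; $\overline Q^m(\infty)$ denotes a random vector with this law. *)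

theory Defs
  imports "HOL-Probability.Probability"
begin

text \<open>
  A right-continuous Markov jump process on the countable set \<open>S\<close> is given, as usual, by one
  family \<open>X t\<close> of \<open>S\<close>-valued variables together with a probability measure \<open>P w\<close> for each initial
  state \<open>w\<close>.  Right-continuity is with respect to the discrete topology on \<open>S\<close>.  The Markov property
  is stated through finitely many observation times \<open>I\<close>, the latest of which is \<open>s\<close>.  The number
  \<open>r w v\<close> is the rate of the jump from \<open>w\<close> to \<open>v \<noteq> w\<close>; the values \<open>r w w\<close> are irrelevant.  The last
  clause says that the total rate of leaving \<open>w\<close> is the sum of the individual rates.
\<close>

definition markov_jump_process ::
  "'s set \<Rightarrow> ('s \<Rightarrow> 's \<Rightarrow> real) \<Rightarrow> ('s \<Rightarrow> 'w measure) \<Rightarrow> (real \<Rightarrow> 'w \<Rightarrow> 's) \<Rightarrow> bool" where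
  "markov_jump_process S r P X \<longleftrightarrow>
    (\<forall>w\<in>S.
      prob_space (P w) \<and>
      (\<forall>t\<ge>0. X t \<in> measurable (P w) (count_space S)) \<and>
      \<P>(\<omega> in P w. X 0 \<omega> = w) = 1 \<and>
      (\<forall>\<omega>\<in>space (P w). \<forall>t\<ge>0. \<forall>\<^sub>F s in at_right t. X s \<omega> = X t \<omega>) \<and>
      (\<forall>s\<ge>0. \<forall>I x. finite I \<and> I \<subseteq> {0..s} \<and> s \<in> I \<and> (\<forall>u\<in>I. x u \<in> S) \<longrightarrow>
        (\<forall>t\<ge>0. \<forall>y\<in>S.
          \<P>(\<omega> in P w. (\<forall>u\<in>I. X u \<omega> = x u) \<and> X (s + t) \<omega> = y) =
          \<P>(\<omega> in P w. \<forall>u\<in>I. X u \<omega> = x u) * \<P>(\<omega> in P (x s). X t \<omega> = y))) \<and>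
      (\<forall>v\<in>S - {w}. ((\<lambda>h. \<P>(\<omega> in P w. X h \<omega> = v) / h) \<longlongrightarrow> r w v) (at_right 0)) \<and>
      ((\<lambda>h. (1 - \<P>(\<omega> in P w. X h \<omega> = w)) / h) \<longlongrightarrow> (\<Sum>\<^sub>\<infinity>v\<in>S - {w}. r w v)) (at_right 0))"

text \<open>The probability that \<open>Y = y\<close> when the initial state is drawn from \<open>\<pi>\<close>.\<close>

definition prob_from :: "'s pmf \<Rightarrow> ('s \<Rightarrow> 'w measure) \<Rightarrow> ('w \<Rightarrow> 'b) \<Rightarrow> 'b \<Rightarrow> real" where
  "prob_from \<pi> P Y y = measure_pmf.expectation \<pi> (\<lambda>w. \<P>(\<omega> in P w. Y \<omega> = y))"

definition stationary_distribution ::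
  "'s set \<Rightarrow> ('s \<Rightarrow> 'w measure) \<Rightarrow> (real \<Rightarrow> 'w \<Rightarrow> 's) \<Rightarrow> 's pmf \<Rightarrow> bool" where
  "stationary_distribution S P X \<pi> \<longleftrightarrow>
    set_pmf \<pi> \<subseteq> S \<and> (\<forall>t\<ge>0. \<forall>y. prob_from \<pi> P (X t) y = pmf \<pi> y)"

text \<open>
  States are pairs \<open>(q, c)\<close>.  A vector indexed by the actions \<open>{1..K}\<close> is a function on \<open>nat\<close> that
  vanishes outside \<open>{1..K}\<close>.
\<close>

type_synonym state = "(nat \<Rightarrow> nat) \<times> nat"

definition states :: "nat \<Rightarrow> state set" where
  "states K = {q. \<forall>k. k \<notin> {1..K} \<longrightarrow> q k = 0} \<times> {1..K}"

definition choice_prob :: "nat \<Rightarrow> real \<Rightarrow> (nat \<Rightarrow> nat) \<Rightarrow> nat \<Rightarrow> real" where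
  "choice_prob K \<alpha> q k = max (real (q k)) \<alpha> / (\<Sum>i\<in>{1..K}. max (real (q i)) \<alpha>)"

text \<open>
  The three summands are arrivals, departures and updates in the \<open>m\<close>-th system, with update rate \<open>\<beta>\<close>
  and threshold \<open>\<alpha>\<close>.  The truncated \<open>q k - 1\<close> is harmless: for \<open>q k = 0\<close> the departure rate is \<open>0\<close>.
  Updates that keep the current choice do not change the state and so only affect the irrelevant
  diagonal.
\<close>

definition reward_rate ::
  "nat \<Rightarrow> (nat \<Rightarrow> real) \<Rightarrow> real \<Rightarrow> real \<Rightarrow> nat \<Rightarrow> state \<Rightarrow> state \<Rightarrow> real" where
  "reward_rate K lam \<beta> \<alpha> m = (\<lambda>(q, c) (q', c').
     (if c' = c \<and> q' = q(c := q c + 1) then lam c else 0) +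
     (\<Sum>k\<in>{1..K}. if c' = c \<and> q' = q(k := q k - 1) then real (q k) / real m else 0) +
     (if q' = q then \<beta> * choice_prob K \<alpha> q c' else 0))"

definition scaled_reward ::
  "nat \<Rightarrow> (real \<Rightarrow> 'w \<Rightarrow> state) \<Rightarrow> real \<Rightarrow> 'w \<Rightarrow> nat \<Rightarrow> real" where
  "scaled_reward m W t \<omega> = (\<lambda>k. real (fst (W (real m * t) \<omega>) k) / real m)"

definition steady_state_distribution ::
  "nat \<Rightarrow> nat \<Rightarrow> (state \<Rightarrow> 'w measure) \<Rightarrow> (real \<Rightarrow> 'w \<Rightarrow> state) \<Rightarrow> (nat \<Rightarrow> real) pmf \<Rightarrow> bool" where
  "steady_state_distribution K m P W \<mu> \<longleftrightarrow>
    (\<exists>\<pi>. stationary_distribution (states K) P W \<pi> \<and>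
         (\<forall>t\<ge>0. \<forall>x. prob_from \<pi> P (scaled_reward m W t) x = pmf \<mu> x))"

text \<open>The law of \<open>Q\<close>-bar at infinity; meaningful when the steady-state distribution is unique.\<close>

definition steady_state_law ::
  "nat \<Rightarrow> nat \<Rightarrow> (state \<Rightarrow> 'w measure) \<Rightarrow> (real \<Rightarrow> 'w \<Rightarrow> state) \<Rightarrow> (nat \<Rightarrow> real) pmf" where
  "steady_state_law K m P W = (THE \<mu>. steady_state_distribution K m P W \<mu>)"

end

theory Submission
  imports Defs "HOL-Complex_Analysis.Great_Picard"
begin

text \<open>
  Write \<open>x\<^sub>k = Q\<^sub>k / m\<close>, \<open>u\<^sub>k = max x\<^sub>k \<alpha>\<^sub>0\<close>, \<open>D = \<Sum>\<^sub>k u\<^sub>k\<close>, and \<open>b = m \<beta>\<^sub>m\<close>, the update rate in the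
  time scale of the scaled process.  The state space is infinite, but the function \<open>2 ^ (\<Sum>\<^sub>k Q\<^sub>k)\<close> has
  negative drift outside a finite set.  Together with irreducibility this gives a unique stationary
  distribution (\<open>unique_invariant\<close>), all moments that are used, and the balance equation \<open>E (G f) = 0\<close>
  for the generator \<open>G\<close> and every \<open>f\<close> of quadratic growth (\<open>expectation_gen\<close>).  From the given
  rates, which are derivatives at time \<open>0\<close> only, such statements follow through Kolmogorov's backward
  equation and a minimum principle.

  Everything else consists in choosing \<open>f\<close>.  The test functions \<open>x\<^sub>k\<close> and \<open>1{C = k}\<close> give
  \<open>E x\<^sub>k = \<lambda>\<^sub>k P(C = k)\<close> and \<open>P(C = k) = E (u\<^sub>k / D)\<close>, so only the limit of \<open>P(C = k)\<close> is to be found.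

  If \<open>b\<close> tends to \<open>0\<close>, the choice changes so rarely that the rewards relax between updates: quadratic
  test functions bound \<open>E (x\<^sub>k - \<lambda>\<^sub>k 1{C = k})\<^sup>2\<close> by a multiple of \<open>b + 1 / m\<close>.  Replacing \<open>x\<close> by
  \<open>\<lambda>\<^sub>C e\<^sub>C\<close> in \<open>u\<^sub>k / D\<close> turns \<open>P(C = k) = E (u\<^sub>k / D)\<close> into the equation of a finite Markov chain, whose
  solution is proportional to \<open>max \<lambda>\<^sub>k \<alpha>\<^sub>0 + (K - 1) \<alpha>\<^sub>0\<close> (\<open>inert_balance\<close>).

  If \<open>b\<close> tends to infinity, \<open>1{C = k}\<close> may be replaced by \<open>u\<^sub>k / D\<close> under expectations (\<open>averaging\<close>), and
  \<open>x\<close> follows the differential equation \<open>x\<^sub>k' = \<lambda>\<^sub>k u\<^sub>k / D - x\<^sub>k\<close> up to small errors; in integrated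
  form, \<open>E ((\<lambda>\<^sub>k u\<^sub>k / D - x\<^sub>k) \<psi>(x\<^sub>k))\<close> tends to \<open>0\<close> for every bounded Lipschitz \<open>\<psi>\<close> (\<open>drift_test\<close>).  Note
  that \<open>\<lambda>\<^sub>k u\<^sub>k / D - x\<^sub>k = x\<^sub>k (\<lambda>\<^sub>k / D - 1)\<close> as soon as \<open>x\<^sub>k > \<alpha>\<^sub>0\<close>.

  \<^item> If \<open>K \<alpha>\<^sub>0 > \<lambda>\<^sub>1\<close>, then \<open>D \<ge> K \<alpha>\<^sub>0\<close> exceeds every \<open>\<lambda>\<^sub>k\<close>, so no \<open>x\<^sub>k\<close> can stay above \<open>\<alpha>\<^sub>0\<close>, all \<open>u\<^sub>k\<close> are
    asymptotically \<open>\<alpha>\<^sub>0\<close>, and the choice becomes uniform.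
  \<^item> If \<open>K \<alpha>\<^sub>0 \<le> \<lambda>\<^sub>1\<close>, a Lyapunov function of \<open>D\<close> shows that \<open>D\<close> exceeds \<open>\<lambda>\<^sub>1\<close> only with vanishing
    probability (\<open>overshoot_rare\<close>).  On the other hand \<open>\<psi> = 1 / u\<^sub>1\<close> gives
    \<open>E (\<lambda>\<^sub>1 / D) = E (x\<^sub>1 / u\<^sub>1) + o(1) \<le> 1 + o(1)\<close>.  Hence \<open>\<lambda>\<^sub>1 / D\<close> tends to \<open>1\<close> in mean
    (\<open>mass_concentration\<close>).  For \<open>k \<ge> 2\<close> the limit \<open>\<lambda>\<^sub>1\<close> of \<open>D\<close> exceeds \<open>\<lambda>\<^sub>k\<close>, so \<open>u\<^sub>k\<close> is
    asymptotically \<open>\<alpha>\<^sub>0\<close> and \<open>P(C = k)\<close> tends to \<open>\<alpha>\<^sub>0 / \<lambda>\<^sub>1\<close>; the first action takes the rest.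
\<close>

section \<open>Semigroups of jump processes\<close>

lemma integrable_pmf_bounded:
  fixes f :: "'a \<Rightarrow> real"
  assumes "\<And>x. \<bar>f x\<bar> \<le> B"
  shows "integrable (measure_pmf M) f"
  using assms by (intro measure_pmf.integrable_const_bound[where B = B]) auto

lemma abs_expectation_pmf_le:
  fixes f :: "'a \<Rightarrow> real"
  assumes "\<And>x. \<bar>f x\<bar> \<le> B"
  shows "\<bar>measure_pmf.expectation M f\<bar> \<le> B"
proof -
  have "\<bar>measure_pmf.expectation M f\<bar> \<le> measure_pmf.expectation M (\<lambda>x. \<bar>f x\<bar>)"
    by (rule integral_abs_bound)
  also have "\<dots> \<le> B"
    using assms by (intro measure_pmf.integral_le_const integrable_pmf_bounded[where B = B]) auto
  finally show ?thesis .
qed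

text \<open>
  Lebesgue integrals of nonnegative functions commute with binding; a function bounded by \<open>B\<close> is
  nonnegative after adding \<open>B\<close>.
\<close>

lemma expectation_bind_pmf:
  fixes f :: "'b \<Rightarrow> real"
  assumes bnd: "\<And>x. \<bar>f x\<bar> \<le> B"
  shows "measure_pmf.expectation (bind_pmf M k) f =
    measure_pmf.expectation M (\<lambda>x. measure_pmf.expectation (k x) f)"
proof -
  define g where "g x = f x + B" for x
  have g0: "0 \<le> g x" "\<bar>g x\<bar> \<le> 2 * B" for x using bnd[of x] by (auto simp: g_def)
  have int_f: "integrable (measure_pmf N) f" for N by (rule integrable_pmf_bounded[OF bnd])
  have int_g: "integrable (measure_pmf N) g" for N by (rule integrable_pmf_bounded[OF g0(2)])
  have bnd': "\<bar>measure_pmf.expectation (k x) f\<bar> \<le> B" for x by (rule abs_expectation_pmf_le[OF bnd])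
  have gk: "measure_pmf.expectation (k x) g = measure_pmf.expectation (k x) f + B" for x
    unfolding g_def by (simp add: int_f)
  have int_k: "integrable (measure_pmf M) (\<lambda>x. measure_pmf.expectation (k x) g)"
    by (rule integrable_pmf_bounded[OF abs_expectation_pmf_le[OF g0(2)]])
  have "ennreal (measure_pmf.expectation (bind_pmf M k) g) = (\<integral>\<^sup>+x. g x \<partial>bind_pmf M k)"
    by (intro nn_integral_eq_integral[symmetric] int_g) (simp add: g0)
  also have "\<dots> = (\<integral>\<^sup>+x. ennreal (measure_pmf.expectation (k x) g) \<partial>M)"
    unfolding nn_integral_bind_pmf using int_g g0
    by (intro nn_integral_cong nn_integral_eq_integral) auto
  also have "\<dots> = ennreal (measure_pmf.expectation M (\<lambda>x. measure_pmf.expectation (k x) g))"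
    by (intro nn_integral_eq_integral int_k) (auto intro: integral_nonneg_AE simp: g0)
  finally have "measure_pmf.expectation (bind_pmf M k) g =
      measure_pmf.expectation M (\<lambda>x. measure_pmf.expectation (k x) g)"
    by (subst (asm) ennreal_inj) (auto intro!: integral_nonneg_AE simp: g0)
  moreover have "measure_pmf.expectation (bind_pmf M k) g = measure_pmf.expectation (bind_pmf M k) f + B"
    unfolding g_def by (simp add: int_f)
  moreover have "measure_pmf.expectation M (\<lambda>x. measure_pmf.expectation (k x) g) =
      measure_pmf.expectation M (\<lambda>x. measure_pmf.expectation (k x) f) + B"
    unfolding gk by (simp add: integrable_pmf_bounded[OF bnd'])
  ultimately show ?thesis by simp
qed

text \<open>
  The kernels \<open>p t\<close> have total mass \<open>1\<close>, so there is no explosion.  The rates are known only as right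
  derivatives at time \<open>0\<close>, one state at a time.  The set \<open>N w\<close> of possible targets of a jump from \<open>w\<close>
  is finite, and the total rate of leaving \<open>w\<close> is the sum of the rates into \<open>N w\<close>.
\<close>

locale markov_semigroup =
  fixes S :: "'s set" and p :: "real \<Rightarrow> 's \<Rightarrow> 's pmf"
    and r :: "'s \<Rightarrow> 's \<Rightarrow> real" and N :: "'s \<Rightarrow> 's set"
  assumes closed: "\<And>w t. w \<in> S \<Longrightarrow> t \<ge> 0 \<Longrightarrow> set_pmf (p t w) \<subseteq> S"
    and start: "\<And>w. w \<in> S \<Longrightarrow> p 0 w = return_pmf w"
    and semigroup: "\<And>w s t. w \<in> S \<Longrightarrow> s \<ge> 0 \<Longrightarrow> t \<ge> 0 \<Longrightarrow> p (s + t) w = bind_pmf (p s w) (p t)"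
    and finite_nbrs: "\<And>w. w \<in> S \<Longrightarrow> finite (N w)"
    and nbrs: "\<And>w. w \<in> S \<Longrightarrow> N w \<subseteq> S - {w}"
    and rate: "\<And>w v. w \<in> S \<Longrightarrow> v \<in> N w \<Longrightarrow> ((\<lambda>h. pmf (p h w) v / h) \<longlongrightarrow> r w v) (at_right 0)"
    and exit: "\<And>w. w \<in> S \<Longrightarrow>
      ((\<lambda>h. (1 - pmf (p h w) w) / h) \<longlongrightarrow> (\<Sum>v\<in>N w. r w v)) (at_right 0)"
begin

definition ev :: "real \<Rightarrow> ('s \<Rightarrow> real) \<Rightarrow> 's \<Rightarrow> real" where
  "ev t f w = measure_pmf.expectation (p t w) f"

definition gen :: "('s \<Rightarrow> real) \<Rightarrow> 's \<Rightarrow> real" where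
  "gen f w = (\<Sum>v\<in>N w. r w v * (f v - f w))"

definition exit_rate :: "'s \<Rightarrow> real" where
  "exit_rate w = (\<Sum>v\<in>N w. r w v)"

lemma rate_nonneg: "r w v \<ge> 0" if "w \<in> S" "v \<in> N w"
proof (rule tendsto_lowerbound[OF rate[OF that]])
  show "\<forall>\<^sub>F h in at_right 0. 0 \<le> pmf (p h w) v / h"
    by (auto simp: eventually_at_right_less intro!: eventually_mono[OF eventually_at_right_less])
qed simp

lemma exit_rate_nonneg: "w \<in> S \<Longrightarrow> exit_rate w \<ge> 0"
  unfolding exit_rate_def by (auto intro: sum_nonneg rate_nonneg)

lemma ev_bounded: "(\<And>x. \<bar>f x\<bar> \<le> B) \<Longrightarrow> \<bar>ev t f w\<bar> \<le> B"
  unfolding ev_def by (rule abs_expectation_pmf_le)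

lemma ev_0: "w \<in> S \<Longrightarrow> ev 0 f w = f w"
  unfolding ev_def by (simp add: start)

lemma ev_add:
  assumes "\<And>x. \<bar>f x\<bar> \<le> B" "w \<in> S" "s \<ge> 0" "t \<ge> 0"
  shows "ev (s + t) f w = ev s (ev t f) w"
  unfolding ev_def semigroup[OF assms(2-4)] by (rule expectation_bind_pmf[OF assms(1)])

text \<open>
  Up to a factor this is the error, divided by \<open>h\<close>, of the first-order expansion of the semigroup at
  time \<open>0\<close>.  The first part compares the jump probabilities with the rates; the second is the probability, divided by \<open>h\<close>, of
  being neither at \<open>w\<close> nor in \<open>N w\<close>, which is small because the rates into \<open>N w\<close> already exhaust the
  rate of leaving.
\<close>

definition modulus :: "real \<Rightarrow> 's \<Rightarrow> real" where
  "modulus h w = (\<Sum>v\<in>N w. \<bar>pmf (p h w) v / h - r w v\<bar>) +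
    ((1 - pmf (p h w) w) / h - (\<Sum>v\<in>N w. pmf (p h w) v / h))"

lemma modulus_tendsto_0:
  assumes w: "w \<in> S"
  shows "((\<lambda>h. modulus h w) \<longlongrightarrow> 0) (at_right 0)"
proof -
  have "((\<lambda>h. modulus h w) \<longlongrightarrow> (\<Sum>v\<in>N w. \<bar>r w v - r w v\<bar>) + ((\<Sum>v\<in>N w. r w v) - (\<Sum>v\<in>N w. r w v)))
      (at_right 0)"
    unfolding modulus_def by (intro tendsto_intros rate exit w)
  then show ?thesis by simp
qed

text \<open>
  The point is that the error depends on \<open>f\<close> only through its bound, so that \<open>f\<close> may later be replaced
  by the moving function \<open>ev s f\<close>.
\<close>

lemma first_order:
  assumes w: "w \<in> S" and h: "h > 0" and bnd: "\<And>x. \<bar>f x\<bar> \<le> B"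
  shows "\<bar>ev h f w - f w - h * gen f w\<bar> \<le> 2 * B * h * modulus h w"
proof -
  define g where "g v = f v - f w" for v
  define A where "A = insert w (N w)"
  let ?M = "p h w"
  have fin: "finite A" using finite_nbrs[OF w] by (simp add: A_def)
  have wN: "w \<notin> N w" using nbrs[OF w] by auto
  have gB: "\<bar>g v\<bar> \<le> 2 * B" for v using bnd[of v] bnd[of w] by (auto simp: g_def)
  have B0: "B \<ge> 0" using bnd[of w] by linarith
  have intf: "integrable (measure_pmf ?M) f" by (rule integrable_pmf_bounded[OF bnd])
  have bA: "\<bar>g v * indicator X v\<bar> \<le> 2 * B" for v X
    using gB[of v] B0 by (auto simp: indicator_def)
  have iA: "integrable (measure_pmf ?M) (\<lambda>v. g v * indicator X v)" for X
    by (rule integrable_pmf_bounded[OF bA])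
  have "ev h f w - f w = measure_pmf.expectation ?M g"
    unfolding ev_def g_def using intf by simp
  also have "g = (\<lambda>v. g v * indicator A v + g v * indicator (- A) v)"
    by (auto simp: fun_eq_iff indicator_def)
  also have "measure_pmf.expectation ?M \<dots> = measure_pmf.expectation ?M (\<lambda>v. g v * indicator A v)
      + measure_pmf.expectation ?M (\<lambda>v. g v * indicator (- A) v)"
    by (intro Bochner_Integration.integral_add iA)
  also have "measure_pmf.expectation ?M (\<lambda>v. g v * indicator A v) = (\<Sum>v\<in>A. g v * indicator A v * pmf ?M v)"
    by (rule integral_measure_pmf_real[OF fin]) (auto simp: indicator_def)
  also have "\<dots> = (\<Sum>v\<in>N w. g v * pmf ?M v)"
    unfolding A_def using finite_nbrs[OF w] wN by (simp add: g_def)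
  finally have split: "ev h f w - f w = (\<Sum>v\<in>N w. g v * pmf ?M v)
      + measure_pmf.expectation ?M (\<lambda>v. g v * indicator (- A) v)" .
  have "\<bar>measure_pmf.expectation ?M (\<lambda>v. g v * indicator (- A) v)\<bar>
      \<le> measure_pmf.expectation ?M (\<lambda>v. \<bar>g v * indicator (- A) v\<bar>)"
    by (rule integral_abs_bound)
  also have "\<dots> \<le> measure_pmf.expectation ?M (\<lambda>v. 2 * B * indicator (- A) v)"
  proof (rule integral_mono)
    show "integrable (measure_pmf ?M) (\<lambda>v. \<bar>g v * indicator (- A) v\<bar>)" by (rule integrable_abs[OF iA])
    show "integrable (measure_pmf ?M) (\<lambda>v. 2 * B * indicator (- A) v)"
      by (rule integrable_pmf_bounded[where B = "2 * B"]) (use B0 in \<open>auto simp: indicator_def\<close>)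
    show "\<bar>g v * indicator (- A) v\<bar> \<le> 2 * B * indicator (- A) v" for v
      using gB[of v] by (auto simp: indicator_def)
  qed
  also have "\<dots> = 2 * B * measure (measure_pmf ?M) (- A)" by simp
  also have "measure (measure_pmf ?M) (- A) = 1 - measure (measure_pmf ?M) A"
    using measure_pmf.prob_compl[of A ?M] by (simp add: Compl_eq_Diff_UNIV)
  also have "measure (measure_pmf ?M) A = (\<Sum>v\<in>A. pmf ?M v)"
    by (rule measure_measure_pmf_finite[OF fin])
  also have "\<dots> = pmf ?M w + (\<Sum>v\<in>N w. pmf ?M v)"
    unfolding A_def using finite_nbrs[OF w] wN by simp
  finally have out: "\<bar>measure_pmf.expectation ?M (\<lambda>v. g v * indicator (- A) v)\<bar>
      \<le> 2 * B * (1 - (pmf ?M w + (\<Sum>v\<in>N w. pmf ?M v)))" .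
  have "\<bar>(\<Sum>v\<in>N w. g v * pmf ?M v) - h * gen f w\<bar> = \<bar>\<Sum>v\<in>N w. g v * (h * (pmf ?M v / h - r w v))\<bar>"
    unfolding gen_def g_def sum_distrib_left sum_subtractf[symmetric] using h
    by (intro arg_cong[where f = abs] sum.cong) (auto simp: field_simps)
  also have "\<dots> \<le> (\<Sum>v\<in>N w. 2 * B * (h * \<bar>pmf ?M v / h - r w v\<bar>))"
    unfolding abs_mult using h B0
    by (intro order_trans[OF sum_abs] sum_mono) (auto simp: abs_mult mult.assoc[symmetric] intro!: mult_right_mono gB)
  also have "\<dots> = 2 * B * h * (\<Sum>v\<in>N w. \<bar>pmf ?M v / h - r w v\<bar>)"
    by (simp add: sum_distrib_left mult.assoc)
  finally have "\<bar>(\<Sum>v\<in>N w. g v * pmf ?M v) - h * gen f w\<bar> \<le> \<dots>" .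
  moreover have eq: "2 * B * (1 - (pmf ?M w + (\<Sum>v\<in>N w. pmf ?M v))) =
      2 * B * h * ((1 - pmf ?M w) / h - (\<Sum>v\<in>N w. pmf ?M v / h))"
    using h by (simp add: sum_divide_distrib[symmetric] field_simps)
  ultimately show ?thesis
    using split out unfolding modulus_def distrib_left[of "2 * B * h"] eq[symmetric] by linarith
qed

lemma stay_supermultiplicative:
  assumes "w \<in> S" "s \<ge> 0" "t \<ge> 0"
  shows "pmf (p s w) w * pmf (p t w) w \<le> pmf (p (s + t) w) w"
proof -
  have "pmf (p s w) w * pmf (p t w) w = measure_pmf.expectation (p s w) (\<lambda>v. indicator {w} v * pmf (p t w) w)"
    by (simp add: measure_pmf_single)
  also have "\<dots> \<le> measure_pmf.expectation (p s w) (\<lambda>v. pmf (p t v) w)"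
    by (intro integral_mono integrable_pmf_bounded[where B = 1])
      (auto simp: indicator_def pmf_le_1)
  also have "\<dots> = pmf (p (s + t) w) w" by (simp add: semigroup assms pmf_bind)
  finally show ?thesis .
qed

lemma leave_subadditive:
  assumes "w \<in> S" "t \<ge> 0"
  shows "1 - pmf (p (real n * t) w) w \<le> real n * (1 - pmf (p t w) w)"
proof (induction n)
  case 0
  then show ?case by (simp add: start assms)
next
  case (Suc n)
  let ?a = "pmf (p (real n * t) w) w" and ?b = "pmf (p t w) w"
  have "(1 - ?a) * (1 - ?b) \<ge> 0" by (intro mult_nonneg_nonneg) (auto simp: pmf_le_1)
  then have "1 - ?a * ?b \<le> (1 - ?a) + (1 - ?b)" by (simp add: algebra_simps)
  moreover have "?a * ?b \<le> pmf (p (real n * t + t) w) w"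
    by (rule stay_supermultiplicative) (use assms in auto)
  ultimately show ?case using Suc by (simp add: algebra_simps)
qed

text \<open>
  The probability of having left \<open>w\<close> is a subadditive function of time, so its slope over \<open>[0, t]\<close> is
  at most its slope at \<open>0\<close>.
\<close>

lemma leave_le:
  assumes w: "w \<in> S" and t: "t \<ge> 0"
  shows "1 - pmf (p t w) w \<le> exit_rate w * t"
proof (cases "t = 0")
  case True
  then show ?thesis by (simp add: start w)
next
  case False
  with t have t: "t > 0" by simp
  have "filterlim (\<lambda>n. t / real (Suc n)) (at_right 0) sequentially"
  proof (rule filterlim_at_withinI)
    show "(\<lambda>n. t / real (Suc n)) \<longlonglongrightarrow> 0"
      using LIMSEQ_Suc[OF lim_const_over_n[of t]] by simp
  qed (use t in auto)
  from filterlim_compose[OF exit[OF w] this]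
  have lim: "(\<lambda>n. t * ((1 - pmf (p (t / real (Suc n)) w) w) / (t / real (Suc n)))) \<longlonglongrightarrow> t * exit_rate w"
    unfolding exit_rate_def by (rule tendsto_mult_left)
  have "1 - pmf (p t w) w \<le> t * exit_rate w"
  proof (rule LIMSEQ_le_const[OF lim], intro exI allI impI)
    fix n :: nat
    have "1 - pmf (p (real (Suc n) * (t / real (Suc n))) w) w
        \<le> real (Suc n) * (1 - pmf (p (t / real (Suc n)) w) w)"
      by (rule leave_subadditive) (use w t in auto)
    also have "real (Suc n) * (t / real (Suc n)) = t" by simp
    also have "real (Suc n) * (1 - pmf (p (t / real (Suc n)) w) w) =
        t * ((1 - pmf (p (t / real (Suc n)) w) w) / (t / real (Suc n)))"
      using t by (simp add: field_simps del: of_nat_Suc)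
    finally show "1 - pmf (p t w) w \<le> t * ((1 - pmf (p (t / real (Suc n)) w) w) / (t / real (Suc n)))" .
  qed
  then show ?thesis by (simp add: mult.commute)
qed

lemma ev_change_le:
  assumes w: "w \<in> S" and h: "h \<ge> 0" and bnd: "\<And>x. \<bar>f x\<bar> \<le> B"
  shows "\<bar>ev h f w - f w\<bar> \<le> 2 * B * exit_rate w * h"
proof -
  have B0: "B \<ge> 0" using bnd[of w] by linarith
  have b1: "\<bar>2 * B * indicator (- {w}) x\<bar> \<le> 2 * B" for x using B0 by (auto simp: indicator_def)
  have b2: "\<bar>f x - f w\<bar> \<le> 2 * B" for x using bnd[of x] bnd[of w] by linarith
  have "ev h f w - f w = measure_pmf.expectation (p h w) (\<lambda>v. f v - f w)"
    unfolding ev_def using integrable_pmf_bounded[of f B, OF bnd] by simp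
  also have "\<bar>\<dots>\<bar> \<le> measure_pmf.expectation (p h w) (\<lambda>v. \<bar>f v - f w\<bar>)"
    by (rule integral_abs_bound)
  also have "\<dots> \<le> measure_pmf.expectation (p h w) (\<lambda>v. 2 * B * indicator (- {w}) v)"
  proof (intro integral_mono)
    show "integrable (measure_pmf (p h w)) (\<lambda>v. 2 * B * indicator (- {w}) v)"
      by (rule integrable_pmf_bounded[OF b1])
    show "integrable (measure_pmf (p h w)) (\<lambda>v. \<bar>f v - f w\<bar>)"
      by (rule integrable_abs[OF integrable_pmf_bounded[OF b2]])
  qed (use b2 in \<open>auto simp: indicator_def\<close>)
  also have "\<dots> = 2 * B * (1 - pmf (p h w) w)"
    using measure_pmf.prob_compl[of "{w}" "p h w"]
    by (simp add: Compl_eq_Diff_UNIV measure_pmf_single)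
  also have "\<dots> \<le> 2 * B * (exit_rate w * h)"
    using B0 by (intro mult_left_mono leave_le w h) auto
  finally show ?thesis by (simp add: mult.assoc)
qed

lemma continuous_on_ev:
  assumes w: "w \<in> S" and bnd: "\<And>x. \<bar>f x\<bar> \<le> B"
  shows "continuous_on {0..} (\<lambda>t. ev t f w)"
proof -
  have B0: "B \<ge> 0" using bnd[of w] by linarith
  have *: "\<bar>ev t f w - ev s f w\<bar> \<le> 2 * B * exit_rate w * (t - s)" if "0 \<le> s" "s \<le> t" for s t
  proof -
    have "ev t f w = ev (t - s) (ev s f) w" using ev_add[OF bnd w, of "t - s" s] that by simp
    then show ?thesis using ev_change_le[OF w, of "t - s" "ev s f" B] ev_bounded[OF bnd] that by simp
  qed
  have "(2 * B * exit_rate w)-lipschitz_on {0..} (\<lambda>t. ev t f w)"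
  proof (rule lipschitz_onI)
    fix s t :: real assume "s \<in> {0..}" "t \<in> {0..}"
    then show "dist (ev s f w) (ev t f w) \<le> 2 * B * exit_rate w * dist s t"
      using *[of s t] *[of t s] by (cases "s \<le> t") (auto simp: dist_real_def abs_minus_commute)
  qed (use B0 exit_rate_nonneg[OF w] in auto)
  then show ?thesis by (rule lipschitz_on_continuous_on)
qed

text \<open>
  The left derivative comes from writing the time \<open>t\<close> as a short time \<open>t - s\<close> followed by \<open>s\<close> and
  expanding the first piece by \<open>first_order\<close>.  It is the side needed at the first time at which a
  minimum is attained.
\<close>

lemma backward_equation:
  assumes w: "w \<in> S" and t: "t > 0" and bnd: "\<And>x. \<bar>f x\<bar> \<le> B"
  shows "((\<lambda>t. ev t f w) has_real_derivative gen (ev t f) w) (at_left t)"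
proof -
  have cont: "((\<lambda>s. ev s f v) \<longlongrightarrow> ev t f v) (at_left t)" if "v \<in> S" for v
  proof -
    have "(\<lambda>s. ev s f v) \<midarrow>t\<rightarrow> ev t f v"
      using continuous_on_interior[OF continuous_on_ev[OF that bnd], of t] t
      by (auto simp: isCont_def interior_real_atLeast)
    then show ?thesis by (rule filterlim_at_split[THEN iffD1, THEN conjunct1])
  qed
  have gl: "((\<lambda>s. gen (ev s f) w) \<longlongrightarrow> gen (ev t f) w) (at_left t)"
    unfolding gen_def using nbrs[OF w] by (intro tendsto_intros cont) (auto simp: w)
  have fl: "filterlim (\<lambda>s. t - s) (at_right 0) (at_left t)"
  proof (rule filterlim_at_withinI)
    show "((\<lambda>s. t - s) \<longlongrightarrow> 0) (at_left t)" by (auto intro!: tendsto_eq_intros)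
    show "\<forall>\<^sub>F x in at_left t. t - x \<in> {0<..} - {0}"
      by (auto simp: eventually_at_filter)
  qed
  have mod: "((\<lambda>s. 2 * B * modulus (t - s) w) \<longlongrightarrow> 0) (at_left t)"
    using tendsto_mult_left[OF filterlim_compose[OF modulus_tendsto_0[OF w] fl], of "2 * B"] by simp
  have "((\<lambda>s. (ev s f w - ev t f w) / (s - t) - gen (ev s f) w) \<longlongrightarrow> 0) (at_left t)"
  proof (rule Lim_null_comparison[OF _ mod])
    have "\<forall>\<^sub>F s in at_left t. s < t" by (auto simp: eventually_at_filter)
    moreover have "\<forall>\<^sub>F s in at_left t. 0 < s"
      using eventually_at_left[of 0 t] t by (auto intro!: exI[of _ 0])
    ultimately show "\<forall>\<^sub>F s in at_left t.
        norm ((ev s f w - ev t f w) / (s - t) - gen (ev s f) w) \<le> 2 * B * modulus (t - s) w"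
    proof eventually_elim
      case (elim s)
      let ?h = "t - s"
      have h: "?h > 0" using elim by simp
      have "ev t f w = ev ?h (ev s f) w" using ev_add[OF bnd w, of ?h s] elim by simp
      then have "\<bar>ev t f w - ev s f w - ?h * gen (ev s f) w\<bar> \<le> 2 * B * ?h * modulus ?h w"
        using first_order[OF w h ev_bounded[OF bnd]] by simp
      then have "\<bar>ev t f w - ev s f w - ?h * gen (ev s f) w\<bar> / ?h \<le> 2 * B * modulus ?h w"
        unfolding pos_divide_le_eq[OF h] by (simp only: mult_ac)
      moreover have "\<bar>ev t f w - ev s f w - ?h * gen (ev s f) w\<bar> / ?h =
          \<bar>(ev t f w - ev s f w - ?h * gen (ev s f) w) / ?h\<bar>"
        using h by (simp add: abs_divide)
      moreover have "(ev t f w - ev s f w - ?h * gen (ev s f) w) / ?h =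
          (ev s f w - ev t f w) / (s - t) - gen (ev s f) w"
        using elim by (simp add: divide_simps) (simp add: algebra_simps)
      ultimately show ?case by simp
    qed
  qed
  from tendsto_add[OF this gl] have "((\<lambda>s. (ev s f w - ev t f w) / (s - t)) \<longlongrightarrow> gen (ev t f) w) (at_left t)"
    by simp
  then show ?thesis by (simp add: has_field_derivative_iff)
qed

text \<open>
  A negative value of \<open>d\<close> would give \<open>d + \<epsilon> t\<close> a negative minimum, attained in the finite set \<open>F\<close> at a
  positive time.  There the generator is nonnegative, so \<open>d + \<epsilon> t\<close> has a positive left derivative,
  which contradicts minimality.
\<close>

lemma minimum_principle:
  assumes F: "finite F" "F \<subseteq> S" and T: "T > 0"
    and out: "\<And>t w. w \<in> S - F \<Longrightarrow> 0 \<le> t \<Longrightarrow> t \<le> T \<Longrightarrow> d t w \<ge> 0"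
    and init: "\<And>w. w \<in> F \<Longrightarrow> d 0 w \<ge> 0"
    and cont: "\<And>w. w \<in> F \<Longrightarrow> continuous_on {0..T} (\<lambda>t. d t w)"
    and der: "\<And>t w. w \<in> F \<Longrightarrow> 0 < t \<Longrightarrow> t \<le> T \<Longrightarrow>
      \<exists>D. ((\<lambda>t. d t w) has_real_derivative D) (at_left t) \<and> D \<ge> gen (d t) w"
    and t1: "0 \<le> t1" "t1 \<le> T" and w1: "w1 \<in> S"
  shows "d t1 w1 \<ge> 0"
proof (rule ccontr)
  assume neg: "\<not> d t1 w1 \<ge> 0"
  with out t1 w1 have w1F: "w1 \<in> F" by auto
  \<comment> \<open>so small that adding \<open>\<epsilon> * t\<close> keeps the value at \<open>(t1, w1)\<close> negative\<close>
  define \<epsilon> where "\<epsilon> = - d t1 w1 / (2 * T)"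
  have \<epsilon>: "\<epsilon> > 0" using neg T by (auto simp: \<epsilon>_def divide_simps)
  define e where "e t w = d t w + \<epsilon> * t" for t w
  have "\<epsilon> * t1 \<le> \<epsilon> * T" using \<epsilon> t1 by simp
  also have "\<epsilon> * T = - d t1 w1 / 2" using T by (simp add: \<epsilon>_def)
  finally have e1: "e t1 w1 < 0" using neg by (simp add: e_def)
  have "\<exists>t. t \<in> {0..T} \<and> (\<forall>s\<in>{0..T}. e t w \<le> e s w)" if "w \<in> F" for w
  proof -
    have "continuous_on {0..T} (\<lambda>t. e t w)" unfolding e_def by (intro continuous_intros cont that)
    then show ?thesis using T continuous_attains_inf[of "{0..T}" "\<lambda>t. e t w"] by auto
  qed
  then obtain \<tau> where \<tau>: "\<And>w. w \<in> F \<Longrightarrow> \<tau> w \<in> {0..T}"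
    "\<And>w s. w \<in> F \<Longrightarrow> s \<in> {0..T} \<Longrightarrow> e (\<tau> w) w \<le> e s w" by metis
  obtain w0 where w0: "w0 \<in> F" "\<And>w. w \<in> F \<Longrightarrow> e (\<tau> w0) w0 \<le> e (\<tau> w) w"
    using ex_min_if_finite[of "(\<lambda>w. e (\<tau> w) w) ` F"] F w1F by (auto simp: not_less)
  define t0 where "t0 = \<tau> w0"
  have t0: "0 \<le> t0" "t0 \<le> T" using \<tau>(1)[OF w0(1)] by (auto simp: t0_def)
  have le: "e t0 w0 \<le> e s w" if "w \<in> F" "s \<in> {0..T}" for s w
    using w0(2)[OF that(1)] \<tau>(2)[OF that] by (simp add: t0_def)
  have e0: "e t0 w0 < 0" using le[OF w1F, of t1] t1 e1 by simp
  then have "t0 \<noteq> 0" using init[OF w0(1)] by (auto simp: e_def)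
  with t0 have t0p: "t0 > 0" by simp
  obtain D where D: "((\<lambda>t. d t w0) has_real_derivative D) (at_left t0)" "D \<ge> gen (d t0) w0"
    using der[OF w0(1) t0p t0(2)] by blast
  have d0: "d t0 w0 < 0" using e0 mult_pos_pos[OF \<epsilon> t0p] by (simp add: e_def)
  have "gen (d t0) w0 \<ge> 0"
    unfolding gen_def
  proof (intro sum_nonneg mult_nonneg_nonneg)
    fix v assume v: "v \<in> N w0"
    have w0S: "w0 \<in> S" using w0 F by auto
    show "r w0 v \<ge> 0" by (rule rate_nonneg[OF w0S v])
    show "0 \<le> d t0 v - d t0 w0"
    proof (cases "v \<in> F")
      case True
      then show ?thesis using le[OF True, of t0] t0 by (simp add: e_def)
    next
      case False
      then show ?thesis using out[of v t0] nbrs[OF w0S] v t0 d0 by force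
    qed
  qed
  then have "D + \<epsilon> > 0" using D \<epsilon> by simp
  moreover have "((\<lambda>t. e t w0) has_real_derivative D + \<epsilon>) (at_left t0)"
    unfolding e_def by (auto intro!: derivative_eq_intros D(1))
  ultimately obtain \<delta> where \<delta>: "\<delta> > 0" "\<And>h. h > 0 \<Longrightarrow> t0 - h \<in> {..<t0} \<Longrightarrow> h < \<delta> \<Longrightarrow> e (t0 - h) w0 < e t0 w0"
    using has_real_derivative_pos_inc_left by blast
  define h where "h = min (\<delta> / 2) t0"
  have "e (t0 - h) w0 < e t0 w0" using \<delta> t0p by (intro \<delta>(2)) (auto simp: h_def min_def)
  moreover have "e t0 w0 \<le> e (t0 - h) w0" using \<delta> t0p t0 by (intro le w0(1)) (auto simp: h_def min_def)
  ultimately show False by simp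
qed

text \<open>
  For short times the process stays with positive probability by \<open>leave_le\<close>; longer times are
  composed of short ones.
\<close>

lemma stay_possible: "w \<in> set_pmf (p t w)" if w: "w \<in> S" and t: "t \<ge> 0"
proof -
  \<comment> \<open>so many that the probability of leaving \<open>w\<close> within \<open>t / n\<close> is below \<open>1\<close>\<close>
  define n where "n = nat \<lceil>t * (exit_rate w + 1)\<rceil> + 1"
  have n: "real n > t * (exit_rate w + 1)" "n > 0" unfolding n_def by linarith+
  have "exit_rate w * (t / real n) \<le> (t * (exit_rate w + 1)) / real n"
    using n t by (simp add: field_simps)
  also have "\<dots> < 1" using n by simp
  finally have "exit_rate w * (t / real n) < 1" .
  moreover have "1 - pmf (p (t / real n) w) w \<le> exit_rate w * (t / real n)"
    by (rule leave_le[OF w]) (use t n in auto)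
  ultimately have "pmf (p (t / real n) w) w > 0" by linarith
  then have base: "w \<in> set_pmf (p (t / real n) w)" by (simp add: set_pmf_eq)
  have "w \<in> set_pmf (p (real k * (t / real n)) w)" for k
  proof (induction k)
    case 0
    then show ?case by (simp add: start w)
  next
    case (Suc k)
    have "real (Suc k) * (t / real n) = real k * (t / real n) + t / real n"
      unfolding of_nat_Suc by (simp only: distrib_right mult_1 add.commute)
    then have "p (real (Suc k) * (t / real n)) w = bind_pmf (p (real k * (t / real n)) w) (p (t / real n))"
      using semigroup[OF w, of "real k * (t / real n)" "t / real n"] t n by (simp del: of_nat_Suc)
    then show ?case using Suc base by (auto simp: set_bind_pmf)
  qed
  from this[of n] n show ?thesis by simp
qed

lemma reachable:
  assumes "(\<lambda>w v. v \<in> N w \<and> r w v > 0)\<^sup>*\<^sup>* w v" "w \<in> S" "t > 0"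
  shows "v \<in> S \<and> v \<in> set_pmf (p t w)"
  using assms
proof (induction arbitrary: t rule: rtranclp_induct)
  case base
  then show ?case using stay_possible by auto
next
  case (step v u)
  then have v: "v \<in> S" and u: "u \<in> N v" "r v u > 0" by auto
  have uS: "u \<in> S" using nbrs[OF v] u by auto
  have "\<forall>\<^sub>F h in at_right 0. pmf (p h v) u / h > 0"
    using order_tendstoD(1)[OF rate[OF v u(1)] u(2)] .
  moreover have "\<forall>\<^sub>F h in at_right 0. 0 < h \<and> h < t / 2"
    using step by (auto simp: eventually_at_right_field intro!: exI[of _ "t / 2"])
  ultimately have "\<forall>\<^sub>F h in at_right 0. 0 < h \<and> h < t / 2 \<and> pmf (p h v) u / h > 0"
    by eventually_elim auto
  then obtain h where h: "0 < h" "h < t / 2" "pmf (p h v) u / h > 0"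
    using eventually_happens[of _ "at_right (0::real)"] by auto
  have "pmf (p h v) u > 0" using h by (simp add: zero_less_divide_iff)
  then have "u \<in> set_pmf (p h v)" by (simp add: set_pmf_eq)
  moreover have "v \<in> set_pmf (p (t - h) w)" using step h by auto
  moreover have "p t w = bind_pmf (p (t - h) w) (p h)"
    using semigroup[of w "t - h" h] step.prems h by simp
  ultimately show ?case using uS by (auto simp: set_bind_pmf)
qed

definition invariant :: "'s pmf \<Rightarrow> bool" where
  "invariant \<pi> \<longleftrightarrow> set_pmf \<pi> \<subseteq> S \<and> (\<forall>t\<ge>0. bind_pmf \<pi> (p t) = \<pi>)"

text \<open>
  The right-hand side satisfies the backward equation as a differential inequality.  Its difference to
  \<open>ev t f\<close> is nonnegative wherever \<open>V\<close> is large, because \<open>f\<close> is bounded; the minimum principle controls the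
  remaining finite set.
\<close>

lemma ev_le_lyapunov:
  assumes V0: "\<And>x. 0 \<le> V x" and V: "\<And>a. finite {w \<in> S. V w \<le> a}"
    and drift: "\<And>w. w \<in> S \<Longrightarrow> gen V w \<le> C - V w" and C: "C \<ge> 0"
    and bnd: "\<And>x. \<bar>f x\<bar> \<le> B" and fV: "\<And>x. f x \<le> V x"
    and w: "w \<in> S" and t: "t \<ge> 0"
  shows "ev t f w \<le> exp (- t) * V w + C * (1 - exp (- t))"
proof -
  define T where "T = t + 1"
  define d where "d s w = exp (- s) * V w + C * (1 - exp (- s)) - ev s f w" for s w
  \<comment> \<open>outside \<open>F\<close> the term \<open>exp (- s) * V w\<close> alone exceeds the bound \<open>B\<close> of \<open>ev s f\<close>, for all \<open>s \<le> T\<close>\<close>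
  define F where "F = {w \<in> S. V w \<le> B * exp T}"
  have B0: "B \<ge> 0" using bnd[of w] by linarith
  have evB: "ev s f v \<le> B" for s v using ev_bounded[of f B, OF bnd, of s v] by linarith
  have "d t w \<ge> 0"
  proof (rule minimum_principle[where d = d and F = F and T = T and ?t1.0 = t and ?w1.0 = w])
    show "finite F" "F \<subseteq> S" using V by (auto simp: F_def)
    show "T > 0" "0 \<le> t" "t \<le> T" using t by (auto simp: T_def)
    show "w \<in> S" by fact
    show "0 \<le> d s v" if "v \<in> S - F" "0 \<le> s" "s \<le> T" for s v
    proof -
      have "B = exp (- T) * (B * exp T)" by (simp add: exp_minus field_simps)
      also have "\<dots> \<le> exp (- s) * V v"
        using that B0 V0 by (intro mult_mono) (auto simp: F_def)
      finally have "B \<le> exp (- s) * V v" .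
      moreover have "0 \<le> C * (1 - exp (- s))" using that C by simp
      ultimately show ?thesis using evB[of s v] by (simp add: d_def)
    qed
    show "0 \<le> d 0 v" if "v \<in> F" for v
      using that fV[of v] by (auto simp: d_def F_def ev_0)
    show "continuous_on {0..T} (\<lambda>s. d s v)" if "v \<in> F" for v
      unfolding d_def using that
      by (intro continuous_intros continuous_on_subset[OF continuous_on_ev[of v f B, OF _ bnd]])
        (auto simp: F_def)
    show "\<exists>D. ((\<lambda>s. d s v) has_real_derivative D) (at_left s) \<and> D \<ge> gen (d s) v"
      if "v \<in> F" "0 < s" "s \<le> T" for s v
    proof (intro exI conjI)
      have vS: "v \<in> S" using that by (simp add: F_def)
      show "((\<lambda>s. d s v) has_real_derivative
          - exp (- s) * V v + C * exp (- s) - gen (ev s f) v) (at_left s)"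
        unfolding d_def
        by (auto intro!: derivative_eq_intros backward_equation[OF vS that(2) bnd])
      have "gen (d s) v = exp (- s) * gen V v - gen (ev s f) v"
        unfolding gen_def d_def sum_distrib_left sum_subtractf[symmetric]
        by (intro sum.cong) (auto simp: algebra_simps)
      also have "\<dots> \<le> exp (- s) * (C - V v) - gen (ev s f) v"
        using drift[OF vS] by simp
      finally show "gen (d s) v \<le> - exp (- s) * V v + C * exp (- s) - gen (ev s f) v"
        by (simp add: algebra_simps)
    qed
  qed
  then show ?thesis by (simp add: d_def)
qed

end

text \<open>
  The drift inequality pushes the process into the finite sublevel sets of \<open>V\<close>, at a rate that makes
  \<open>V\<close> decay exponentially in mean, up to a constant.
\<close>

locale ergodic_semigroup = markov_semigroup +
  fixes V :: "'a \<Rightarrow> real" and C :: real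
  assumes countable_S: "countable S" and nonempty: "S \<noteq> {}"
    and V_nonneg: "\<And>x. 0 \<le> V x" and sublevel: "\<And>a. finite {w \<in> S. V w \<le> a}"
    and drift: "\<And>w. w \<in> S \<Longrightarrow> gen V w \<le> C - V w" and C_nonneg: "C \<ge> 0"
    and irreducible: "\<And>w v. w \<in> S \<Longrightarrow> v \<in> S \<Longrightarrow> (\<lambda>w v. v \<in> N w \<and> r w v > 0)\<^sup>*\<^sup>* w v"
begin

text \<open>
  If two invariant distributions differ, each exceeds the other somewhere.  Since every transition in
  time \<open>1\<close> has positive probability, their minimum \<open>\<theta>\<close> would then be transported to a function
  strictly below it, although transport preserves the total mass.
\<close>

lemma invariant_unique_at_1:
  assumes "set_pmf \<pi>\<^sub>1 \<subseteq> S" "bind_pmf \<pi>\<^sub>1 (p 1) = \<pi>\<^sub>1"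
    and "set_pmf \<pi>\<^sub>2 \<subseteq> S" "bind_pmf \<pi>\<^sub>2 (p 1) = \<pi>\<^sub>2"
  shows "\<pi>\<^sub>1 = \<pi>\<^sub>2"
proof (rule ccontr)
  assume neq: "\<pi>\<^sub>1 \<noteq> \<pi>\<^sub>2"
  define \<theta> where "\<theta> z = min (pmf \<pi>\<^sub>1 z) (pmf \<pi>\<^sub>2 z)" for z
  define T where "T y = (\<integral>\<^sup>+z. ennreal (\<theta> z) * ennreal (pmf (p 1 z) y) \<partial>count_space UNIV)" for y
  have \<theta>0: "\<theta> z \<ge> 0" for z by (simp add: \<theta>_def)
  have flow: "(\<integral>\<^sup>+z. ennreal (pmf \<pi> z) * ennreal (pmf (p 1 z) y) \<partial>count_space UNIV) = ennreal (pmf \<pi> y)"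
    if "bind_pmf \<pi> (p 1) = \<pi>" for \<pi> y
    using ennreal_pmf_bind[of \<pi> "p 1" y] that by (simp add: nn_integral_measure_pmf)
  have less: "T y < ennreal (pmf \<pi> y)"
    if \<pi>: "set_pmf \<pi> \<subseteq> S" "bind_pmf \<pi> (p 1) = \<pi>" and le: "\<And>z. \<theta> z \<le> pmf \<pi> z"
      and b: "\<theta> b < pmf \<pi> b" and y: "y \<in> S" for \<pi> b y
  proof -
    have le': "ennreal (\<theta> z) * ennreal (pmf (p 1 z) y) \<le> ennreal (pmf \<pi> z) * ennreal (pmf (p 1 z) y)" for z
      by (intro mult_right_mono ennreal_leI le) simp
    have "pmf \<pi> b > 0" using b \<theta>0[of b] by linarith
    then have bS: "b \<in> S" using \<pi> by (auto simp: set_pmf_eq)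
    have "y \<in> set_pmf (p 1 b)" using reachable[OF irreducible[OF bS y] bS] by simp
    then have pos: "pmf (p 1 b) y > 0" by (simp add: set_pmf_eq pmf_pos)
    have "\<theta> b * pmf (p 1 b) y < pmf \<pi> b * pmf (p 1 b) y" using b pos by simp
    then have strict: "ennreal (\<theta> b) * ennreal (pmf (p 1 b) y) < ennreal (pmf \<pi> b) * ennreal (pmf (p 1 b) y)"
      using \<theta>0[of b] by (simp add: ennreal_mult'[symmetric] ennreal_less_iff)
    have "T y < (\<integral>\<^sup>+z. ennreal (pmf \<pi> z) * ennreal (pmf (p 1 z) y) \<partial>count_space UNIV)"
      unfolding T_def
    proof (rule nn_integral_less)
      have "(\<integral>\<^sup>+z. ennreal (\<theta> z) * ennreal (pmf (p 1 z) y) \<partial>count_space UNIV)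
          \<le> (\<integral>\<^sup>+z. ennreal (pmf \<pi> z) * ennreal (pmf (p 1 z) y) \<partial>count_space UNIV)"
        by (intro nn_integral_mono le')
      also have "\<dots> < \<infinity>" by (simp add: flow[OF \<pi>(2)])
      finally show "(\<integral>\<^sup>+z. ennreal (\<theta> z) * ennreal (pmf (p 1 z) y) \<partial>count_space UNIV) \<noteq> \<infinity>" by simp
      show "\<not> (AE z in count_space UNIV. ennreal (pmf \<pi> z) * ennreal (pmf (p 1 z) y)
          \<le> ennreal (\<theta> z) * ennreal (pmf (p 1 z) y))"
        using strict by (auto simp: AE_count_space not_le)
    qed (auto intro: le')
    then show ?thesis by (simp add: flow[OF \<pi>(2)])
  qed
  obtain a where a: "pmf \<pi>\<^sub>1 a < pmf \<pi>\<^sub>2 a" using pmf_neq_exists_less[OF neq] by blast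
  obtain b where b: "pmf \<pi>\<^sub>2 b < pmf \<pi>\<^sub>1 b" using pmf_neq_exists_less[OF neq[symmetric]] by blast
  have l1: "T y < ennreal (pmf \<pi>\<^sub>1 y)" and l2: "T y < ennreal (pmf \<pi>\<^sub>2 y)" if "y \<in> S" for y
    using less[OF assms(1,2), of b y] less[OF assms(3,4), of a y] a b that by (auto simp: \<theta>_def)
  \<comment> \<open>\<open>T\<close> is the image of \<open>\<theta>\<close> under the kernel\<close>
  have Tlt: "T y < ennreal (\<theta> y)" if "y \<in> S" for y
    using l1[OF that] l2[OF that] by (auto simp: \<theta>_def min_def)
  have Tout: "T y = 0" if "y \<notin> S" for y
  proof -
    have "\<theta> z = 0 \<or> pmf (p 1 z) y = 0" for z
      using closed[of z 1] that assms(1) by (cases "z \<in> S") (force simp: \<theta>_def set_pmf_eq min_def)+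
    then have "ennreal (\<theta> z) * ennreal (pmf (p 1 z) y) = 0" for z
      by (metis ennreal_0 mult_zero_left mult_zero_right)
    then show ?thesis unfolding T_def by (simp only: nn_integral_const mult_zero_left)
  qed
  obtain s where s: "s \<in> S" using nonempty by auto
  have fin: "(\<integral>\<^sup>+y. ennreal (\<theta> y) \<partial>count_space UNIV) < \<infinity>"
  proof -
    have "(\<integral>\<^sup>+y. ennreal (\<theta> y) \<partial>count_space UNIV) \<le> (\<integral>\<^sup>+y. ennreal (pmf \<pi>\<^sub>1 y) \<partial>count_space UNIV)"
      by (intro nn_integral_mono ennreal_leI) (simp add: \<theta>_def)
    then show ?thesis by (simp add: nn_integral_pmf le_less_trans)
  qed
  have Tle: "T y \<le> ennreal (\<theta> y)" for y using Tlt[of y] Tout[of y] by (cases "y \<in> S") auto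
  have "(\<integral>\<^sup>+y. T y \<partial>count_space UNIV) < (\<integral>\<^sup>+y. ennreal (\<theta> y) \<partial>count_space UNIV)"
  proof (rule nn_integral_less)
    have "(\<integral>\<^sup>+y. T y \<partial>count_space UNIV) \<le> (\<integral>\<^sup>+y. ennreal (\<theta> y) \<partial>count_space UNIV)"
      by (intro nn_integral_mono Tle)
    then show "(\<integral>\<^sup>+y. T y \<partial>count_space UNIV) \<noteq> \<infinity>" using fin by (auto simp: top_unique)
    show "\<not> (AE y in count_space UNIV. ennreal (\<theta> y) \<le> T y)"
      using Tlt[OF s] by (auto simp: AE_count_space not_le)
  qed (auto intro: Tle)
  moreover have "(\<integral>\<^sup>+y. T y \<partial>count_space UNIV) =
      (\<integral>\<^sup>+z. \<integral>\<^sup>+y. ennreal (\<theta> z) * ennreal (pmf (p 1 z) y) \<partial>count_space UNIV \<partial>count_space UNIV)"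
    unfolding T_def
    using nn_integral_snd_count_space[of "\<lambda>(z, y). ennreal (\<theta> z) * ennreal (pmf (p 1 z) y)"]
      nn_integral_fst_count_space[of "\<lambda>(z, y). ennreal (\<theta> z) * ennreal (pmf (p 1 z) y)"] by simp
  moreover have "\<dots> = (\<integral>\<^sup>+z. ennreal (\<theta> z) \<partial>count_space UNIV)"
    by (simp add: nn_integral_cmult nn_integral_pmf)
  ultimately show False by simp
qed

text \<open>
  This is the argument of Krylov and Bogoliubov.  The time averages of the laws started at one state
  are tight by the Lyapunov bound; a pointwise limit along a subsequence has mass \<open>1\<close> by tightness, and
  by Fatou's lemma it dominates its own image under the kernel, hence equals it.
\<close>

lemma invariant_exists_at_1: "\<exists>\<pi>. set_pmf \<pi> \<subseteq> S \<and> bind_pmf \<pi> (p 1) = \<pi>"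
proof -
  obtain w where w: "w \<in> S" using nonempty by auto
  define \<mu> where "\<mu> n = bind_pmf (pmf_of_set {..n}) (\<lambda>j. p (real j) w)" for n :: nat
  have \<mu>: "pmf (\<mu> n) y = (\<Sum>j\<le>n. pmf (p (real j) w) y) / real (Suc n)" for n y
    unfolding \<mu>_def by (subst pmf_bind_pmf_of_set) auto
  have \<mu>S: "set_pmf (\<mu> n) \<subseteq> S" for n
  proof -
    have "set_pmf (p (real j) w) \<subseteq> S" for j using closed[OF w] by simp
    then show ?thesis by (auto simp: \<mu>_def set_pmf_of_set)
  qed
  have step: "pmf (bind_pmf (\<mu> n) (p 1)) y \<le> pmf (\<mu> n) y + 1 / real (Suc n)" for n y
  proof -
    have "bind_pmf (\<mu> n) (p 1) = bind_pmf (pmf_of_set {..n}) (\<lambda>j. p (real j + 1) w)"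
      unfolding \<mu>_def bind_assoc_pmf using semigroup[OF w, of _ 1] by simp
    then have "pmf (bind_pmf (\<mu> n) (p 1)) y = (\<Sum>j\<le>n. pmf (p (real j + 1) w) y) / real (Suc n)"
      by (simp add: pmf_bind_pmf_of_set)
    also have "(\<Sum>j\<le>n. pmf (p (real j + 1) w) y) = (\<Sum>j\<le>n. pmf (p (real (Suc j)) w) y)"
      by (simp add: add.commute)
    also have "\<dots> \<le> (\<Sum>j\<le>Suc n. pmf (p (real j) w) y)"
      unfolding sum.atMost_Suc_shift[of _ n] by simp
    also have "\<dots> \<le> (\<Sum>j\<le>n. pmf (p (real j) w) y) + 1"
      by (simp add: pmf_le_1)
    finally show ?thesis unfolding \<mu> by (simp add: add_divide_distrib divide_right_mono)
  qed
  have tight: "(\<Sum>y\<in>{v \<in> S. V v \<le> a}. pmf (\<mu> n) y) \<ge> 1 - (V w + C) / a" if a: "a > 0" for a n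
  proof -
    let ?F = "{v \<in> S. V v \<le> a}"
    \<comment> \<open>Markov's inequality, with \<open>V\<close> truncated at \<open>a\<close> because the Lyapunov bound is for bounded functions\<close>
    define f where "f x = min (V x) a" for x
    have fb: "\<bar>f x\<bar> \<le> a" for x using V_nonneg[of x] a by (auto simp: f_def)
    have one: "(\<Sum>y\<in>?F. pmf (p t w) y) \<ge> 1 - (V w + C) / a" if t: "t \<ge> 0" for t
    proof -
      have "ev t f w \<le> exp (- t) * V w + C * (1 - exp (- t))"
        by (rule ev_le_lyapunov[OF V_nonneg sublevel drift C_nonneg fb _ w t]) (auto simp: f_def)
      also have "\<dots> \<le> 1 * V w + C * 1"
        using t C_nonneg V_nonneg[of w] by (intro add_mono mult_mono) auto
      finally have ub: "ev t f w \<le> V w + C" by simp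
      have "a * (1 - (\<Sum>y\<in>?F. pmf (p t w) y)) = a * (1 - measure (measure_pmf (p t w)) ?F)"
        by (simp add: measure_measure_pmf_finite[OF sublevel])
      also have "\<dots> = a * measure (measure_pmf (p t w)) (- ?F)"
        using measure_pmf.prob_compl[of ?F "p t w"] by (simp add: Compl_eq_Diff_UNIV)
      also have "\<dots> = measure_pmf.expectation (p t w) (\<lambda>v. a * indicator (- ?F) v)" by simp
      also have "\<dots> \<le> ev t f w"
        unfolding ev_def
      proof (rule integral_mono_AE)
        show "integrable (measure_pmf (p t w)) f" by (rule integrable_pmf_bounded[OF fb])
        show "integrable (measure_pmf (p t w)) (\<lambda>v. a * indicator (- ?F) v)"
          by (rule integrable_pmf_bounded[where B = a]) (use a in \<open>auto simp: indicator_def\<close>)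
        show "AE v in p t w. a * indicator (- ?F) v \<le> f v"
          using closed[OF w t] V_nonneg a by (auto simp: AE_measure_pmf_iff f_def indicator_def)
      qed
      finally have "a * (1 - (\<Sum>y\<in>?F. pmf (p t w) y)) \<le> V w + C" using ub by simp
      then show ?thesis using a by (simp add: field_simps)
    qed
    have "1 - (V w + C) / a = (\<Sum>j\<le>n. 1 - (V w + C) / a) / real (Suc n)" by simp
    also have "\<dots> \<le> (\<Sum>j\<le>n. \<Sum>y\<in>?F. pmf (p (real j) w) y) / real (Suc n)"
      by (intro divide_right_mono sum_mono one) auto
    also have "\<dots> = (\<Sum>y\<in>?F. pmf (\<mu> n) y)"
      unfolding \<mu> by (subst sum.swap) (simp add: sum_divide_distrib)
    finally show ?thesis .
  qed
  obtain k where k: "strict_mono (k :: nat \<Rightarrow> nat)"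
    and conv: "\<And>y. y \<in> S \<Longrightarrow> \<exists>l. (\<lambda>n. pmf (\<mu> (k n)) y) \<longlonglongrightarrow> l"
    using function_convergent_subsequence[OF countable_S, of "\<lambda>n y. pmf (\<mu> n) y" 1]
    by (auto simp: pmf_le_1)
  define l where "l y = lim (\<lambda>n. pmf (\<mu> (k n)) y)" for y
  have l: "(\<lambda>n. pmf (\<mu> (k n)) y) \<longlonglongrightarrow> l y" for y
  proof (cases "y \<in> S")
    case True
    then show ?thesis using conv unfolding l_def by (metis limI)
  next
    case False
    then have "pmf (\<mu> (k n)) y = 0" for n using \<mu>S by (auto simp: set_pmf_eq)
    then show ?thesis by (simp add: l_def)
  qed
  have l0: "l y \<ge> 0" for y by (rule LIMSEQ_le_const[OF l]) auto
  have lout: "l y = 0" if "y \<notin> S" for y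
  proof -
    have "pmf (\<mu> (k n)) y = 0" for n using \<mu>S that by (auto simp: set_pmf_eq)
    then show ?thesis using LIMSEQ_unique[OF l[of y]] by simp
  qed
  have lfin: "(\<Sum>y\<in>F. l y) \<le> 1" if "finite F" for F
  proof (rule LIMSEQ_le_const2)
    show "(\<lambda>n. \<Sum>y\<in>F. pmf (\<mu> (k n)) y) \<longlonglongrightarrow> (\<Sum>y\<in>F. l y)" by (intro tendsto_intros l)
    show "\<exists>N. \<forall>n\<ge>N. (\<Sum>y\<in>F. pmf (\<mu> (k n)) y) \<le> 1"
      by (auto simp: measure_measure_pmf_finite[OF that, symmetric])
  qed
  have lmass: "(\<Sum>y\<in>{v \<in> S. V v \<le> a}. l y) \<ge> 1 - (V w + C) / a" if "a > 0" for a
    by (rule LIMSEQ_le_const[where X = "\<lambda>n. \<Sum>y\<in>{v \<in> S. V v \<le> a}. pmf (\<mu> (k n)) y"])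
      (auto intro!: tendsto_intros l tight[OF that])
  have mass: "(\<integral>\<^sup>+y. ennreal (l y) \<partial>count_space UNIV) = 1"
  proof (rule antisym)
    show "(\<integral>\<^sup>+y. ennreal (l y) \<partial>count_space UNIV) \<le> 1"
    proof -
      have "(\<integral>\<^sup>+y. ennreal (l y) \<partial>count_space UNIV) =
          (\<integral>\<^sup>+y. liminf (\<lambda>n. ennreal (pmf (\<mu> (k n)) y)) \<partial>count_space UNIV)"
        by (intro nn_integral_cong lim_imp_Liminf[symmetric] tendsto_ennrealI l) simp
      also have "\<dots> \<le> liminf (\<lambda>n. \<integral>\<^sup>+y. ennreal (pmf (\<mu> (k n)) y) \<partial>count_space UNIV)"
        by (intro nn_integral_liminf) simp
      also have "\<dots> = 1" by (simp add: nn_integral_pmf Liminf_const)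
      finally show ?thesis .
    qed
    show "1 \<le> (\<integral>\<^sup>+y. ennreal (l y) \<partial>count_space UNIV)"
    proof (rule LIMSEQ_le_const2)
      have "(\<lambda>n. 1 - (V w + C) / real (Suc n)) \<longlonglongrightarrow> 1 - 0"
        by (intro tendsto_intros LIMSEQ_Suc[OF lim_const_over_n])
      then show "(\<lambda>n. ennreal (1 - (V w + C) / real (Suc n))) \<longlonglongrightarrow> 1"
        using tendsto_ennrealI by force
      have "ennreal (1 - (V w + C) / real (Suc n)) \<le> (\<integral>\<^sup>+y. ennreal (l y) \<partial>count_space UNIV)" for n
      proof -
        let ?F = "{v \<in> S. V v \<le> real (Suc n)}"
        have "ennreal (1 - (V w + C) / real (Suc n)) \<le> ennreal (\<Sum>y\<in>?F. l y)"
          by (intro ennreal_leI lmass) simp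
        also have "\<dots> = (\<Sum>y\<in>?F. ennreal (l y))" by (simp add: l0)
        also have "\<dots> = (\<integral>\<^sup>+y. ennreal (l y) \<partial>count_space ?F)"
          by (rule nn_integral_count_space_finite[OF sublevel, symmetric])
        also have "\<dots> \<le> (\<integral>\<^sup>+y. ennreal (l y) \<partial>count_space UNIV)"
          by (subst nn_integral_count_space_indicator) (auto intro!: nn_integral_mono simp: indicator_def)
        finally show ?thesis .
      qed
      then show "\<exists>N. \<forall>n\<ge>N. ennreal (1 - (V w + C) / real (Suc n)) \<le> (\<integral>\<^sup>+y. ennreal (l y) \<partial>count_space UNIV)"
        by blast
    qed
  qed
  define \<pi> where "\<pi> = embed_pmf l"
  have \<pi>: "pmf \<pi> y = l y" for y unfolding \<pi>_def by (rule pmf_embed_pmf[OF l0 mass])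
  have \<pi>S: "set_pmf \<pi> \<subseteq> S" using lout by (auto simp: set_pmf_eq \<pi>)
  have sub: "pmf (bind_pmf \<pi> (p 1)) y \<le> pmf \<pi> y" for y
  proof -
    have "ennreal (pmf (bind_pmf \<pi> (p 1)) y) =
        (\<integral>\<^sup>+z. ennreal (l z) * ennreal (pmf (p 1 z) y) \<partial>count_space UNIV)"
      by (simp add: ennreal_pmf_bind nn_integral_measure_pmf \<pi>)
    also have "\<dots> = (\<integral>\<^sup>+z. liminf (\<lambda>n. ennreal (pmf (\<mu> (k n)) z) * ennreal (pmf (p 1 z) y)) \<partial>count_space UNIV)"
      unfolding ennreal_mult''[OF pmf_nonneg, symmetric]
      by (intro nn_integral_cong lim_imp_Liminf[symmetric] tendsto_ennrealI tendsto_mult_right l) simp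
    also have "\<dots> \<le> liminf (\<lambda>n. \<integral>\<^sup>+z. ennreal (pmf (\<mu> (k n)) z) * ennreal (pmf (p 1 z) y) \<partial>count_space UNIV)"
      by (intro nn_integral_liminf) simp
    also have "\<dots> = liminf (\<lambda>n. ennreal (pmf (bind_pmf (\<mu> (k n)) (p 1)) y))"
      by (simp add: ennreal_pmf_bind nn_integral_measure_pmf)
    also have "\<dots> \<le> liminf (\<lambda>n. ennreal (pmf (\<mu> (k n)) y + 1 / real (Suc (k n))))"
      by (intro Liminf_mono always_eventually allI ennreal_leI step)
    also have "\<dots> = ennreal (l y)"
    proof (intro lim_imp_Liminf tendsto_ennrealI)
      have "(\<lambda>n. pmf (\<mu> (k n)) y + 1 / real (Suc (k n))) \<longlonglongrightarrow> l y + 0"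
        using LIMSEQ_subseq_LIMSEQ[OF LIMSEQ_Suc[OF lim_const_over_n[of 1]] k]
        by (intro tendsto_add l) (simp add: o_def)
      then show "(\<lambda>n. pmf (\<mu> (k n)) y + 1 / real (Suc (k n))) \<longlonglongrightarrow> l y" by simp
    qed simp
    finally show ?thesis by (simp add: \<pi> l0)
  qed
  have "bind_pmf \<pi> (p 1) = \<pi>"
  proof (rule ccontr)
    assume "bind_pmf \<pi> (p 1) \<noteq> \<pi>"
    then obtain y where "pmf \<pi> y < pmf (bind_pmf \<pi> (p 1)) y" using pmf_neq_exists_less by metis
    with sub[of y] show False by simp
  qed
  with \<pi>S show ?thesis by blast
qed

text \<open>
  The image of the distribution invariant at time \<open>1\<close> under any \<open>p t\<close> is again invariant at time \<open>1\<close>,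
  because the kernels commute; uniqueness at time \<open>1\<close> then makes it invariant at all times.
\<close>

theorem unique_invariant: "\<exists>!\<pi>. invariant \<pi>"
proof -
  obtain \<pi> where \<pi>: "set_pmf \<pi> \<subseteq> S" "bind_pmf \<pi> (p 1) = \<pi>" using invariant_exists_at_1 by blast
  have "bind_pmf \<pi> (p t) = \<pi>" if t: "t \<ge> 0" for t
  proof (rule invariant_unique_at_1)
    show "set_pmf (bind_pmf \<pi> (p t)) \<subseteq> S" unfolding set_bind_pmf using \<pi>(1) closed[OF _ t] by blast
    have "bind_pmf (bind_pmf \<pi> (p t)) (p 1) = bind_pmf \<pi> (p (t + 1))"
      unfolding bind_assoc_pmf
    proof (rule bind_pmf_cong[OF refl])
      fix w assume "w \<in> set_pmf \<pi>"
      with \<pi>(1) have "w \<in> S" by blast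
      from semigroup[OF this t, of 1] show "bind_pmf (p t w) (p 1) = p (t + 1) w" by simp
    qed
    also have "\<dots> = bind_pmf \<pi> (\<lambda>w. bind_pmf (p 1 w) (p t))"
    proof (rule bind_pmf_cong[OF refl])
      fix w assume "w \<in> set_pmf \<pi>"
      with \<pi>(1) have "w \<in> S" by blast
      from semigroup[OF this _ t, of 1] show "p (t + 1) w = bind_pmf (p 1 w) (p t)"
        by (simp add: add.commute)
    qed
    also have "\<dots> = bind_pmf \<pi> (p t)" unfolding bind_assoc_pmf[symmetric] \<pi>(2) ..
    finally show "bind_pmf (bind_pmf \<pi> (p t)) (p 1) = bind_pmf \<pi> (p t)" .
  qed (fact \<pi>)+
  then have "invariant \<pi>" using \<pi>(1) unfolding invariant_def by blast
  moreover have "\<sigma> = \<pi>" if "invariant \<sigma>" for \<sigma>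
  proof (rule invariant_unique_at_1)
    show "set_pmf \<sigma> \<subseteq> S" "bind_pmf \<sigma> (p 1) = \<sigma>" using that unfolding invariant_def by simp_all
  qed (fact \<pi>)+
  ultimately show ?thesis by blast
qed

text \<open>
  Invariance lets the bound of \<open>ev_le_lyapunov\<close> be applied at arbitrarily late times, where the initial
  state is forgotten.  A truncation keeps all functions bounded until the very end.
\<close>

lemma integrable_lyapunov:
  assumes "invariant \<pi>"
  shows "integrable (measure_pmf \<pi>) V"
proof -
  have \<pi>S: "set_pmf \<pi> \<subseteq> S" and inv: "\<And>t. t \<ge> 0 \<Longrightarrow> bind_pmf \<pi> (p t) = \<pi>"
    using assms by (auto simp: invariant_def)
  have le: "measure_pmf.expectation \<pi> (\<lambda>x. min (V x) (real n)) \<le> C" for n :: nat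
  proof -
    define f where "f x = min (V x) (real n)" for x
    have fb: "\<bar>f x\<bar> \<le> real n" for x using V_nonneg[of x] by (auto simp: f_def)
    \<comment> \<open>the Lyapunov bound of \<open>ev t f\<close>, truncated to be uniformly bounded\<close>
    define g where "g t w = min (real n) (exp (- real t) * V w + C)" for t :: nat and w
    have gb: "\<bar>g t w\<bar> \<le> real n" for t w using V_nonneg[of w] C_nonneg by (auto simp: g_def)
    have "measure_pmf.expectation \<pi> f \<le> measure_pmf.expectation \<pi> (g t)" for t
    proof -
      have "measure_pmf.expectation \<pi> f = measure_pmf.expectation (bind_pmf \<pi> (p (real t))) f"
        by (simp add: inv)
      also have "\<dots> = measure_pmf.expectation \<pi> (ev (real t) f)"
        unfolding expectation_bind_pmf[OF fb] ev_def ..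
      also have "\<dots> \<le> measure_pmf.expectation \<pi> (g t)"
      proof (rule integral_mono_AE)
        show "integrable (measure_pmf \<pi>) (ev (real t) f)"
          by (rule integrable_pmf_bounded[OF ev_bounded[OF fb]])
        show "integrable (measure_pmf \<pi>) (g t)" by (rule integrable_pmf_bounded[OF gb])
        have "ev (real t) f w \<le> g t w" if w: "w \<in> S" for w
        proof -
          have "ev (real t) f w \<le> exp (- real t) * V w + C * (1 - exp (- real t))"
            by (rule ev_le_lyapunov[OF V_nonneg sublevel drift C_nonneg fb _ w]) (auto simp: f_def)
          also have "\<dots> \<le> exp (- real t) * V w + C * 1"
            using C_nonneg by (intro add_left_mono mult_left_mono) auto
          finally show ?thesis using ev_bounded[of f "real n", OF fb, of "real t" w] by (simp add: g_def)
        qed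
        then show "AE w in \<pi>. ev (real t) f w \<le> g t w" using \<pi>S by (auto simp: AE_measure_pmf_iff)
      qed
      finally show ?thesis .
    qed
    moreover have "(\<lambda>t. measure_pmf.expectation \<pi> (g t)) \<longlonglongrightarrow> measure_pmf.expectation \<pi> (\<lambda>w. min (real n) (0 * V w + C))"
    proof (rule integral_dominated_convergence[where w = "\<lambda>_. real n"])
      have "(\<lambda>t. exp (- real t)) \<longlonglongrightarrow> 0"
        by (rule filterlim_compose[OF exp_at_bot filterlim_compose[OF filterlim_uminus_at_bot_at_top filterlim_real_sequentially]])
      then show "AE w in \<pi>. (\<lambda>t. g t w) \<longlonglongrightarrow> min (real n) (0 * V w + C)"
        unfolding g_def by (intro AE_I2 tendsto_intros)
    qed (use gb in auto)
    ultimately have "measure_pmf.expectation \<pi> f \<le> measure_pmf.expectation \<pi> (\<lambda>w. min (real n) (0 * V w + C))"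
      by (intro LIMSEQ_le_const) auto
    also have "\<dots> \<le> C" by simp
    finally show ?thesis by (simp add: f_def[abs_def])
  qed
  have bn: "\<bar>min (V x) (real n)\<bar> \<le> real n" for x n using V_nonneg[of x] by auto
  have "(\<integral>\<^sup>+x. ennreal (V x) \<partial>\<pi>) \<le> (\<integral>\<^sup>+x. liminf (\<lambda>n. ennreal (min (V x) (real n))) \<partial>\<pi>)"
  proof (intro nn_integral_mono eq_refl lim_imp_Liminf[symmetric] tendsto_ennrealI)
    fix x
    have "\<forall>\<^sub>F n in sequentially. min (V x) (real n) = V x"
      using eventually_ge_at_top[of "nat \<lceil>V x\<rceil>"] by eventually_elim linarith
    then show "(\<lambda>n. min (V x) (real n)) \<longlonglongrightarrow> V x" by (rule tendsto_eventually)
  qed simp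
  also have "\<dots> \<le> liminf (\<lambda>n. \<integral>\<^sup>+x. ennreal (min (V x) (real n)) \<partial>\<pi>)"
    by (intro nn_integral_liminf) simp
  also have "\<dots> \<le> liminf (\<lambda>n. ennreal C)"
  proof (intro Liminf_mono always_eventually allI)
    fix n
    have "(\<integral>\<^sup>+x. ennreal (min (V x) (real n)) \<partial>\<pi>) = ennreal (measure_pmf.expectation \<pi> (\<lambda>x. min (V x) (real n)))"
      by (intro nn_integral_eq_integral integrable_pmf_bounded[OF bn]) (simp add: V_nonneg)
    then show "(\<integral>\<^sup>+x. ennreal (min (V x) (real n)) \<partial>\<pi>) \<le> ennreal C" using le by (simp add: ennreal_leI)
  qed
  also have "\<dots> = ennreal C" by (simp add: Liminf_const)
  finally show ?thesis
    by (intro integrableI_nonneg) (auto simp: V_nonneg intro: le_less_trans)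
qed

text \<open>
  By invariance \<open>(ev h f - f) / h\<close> has expectation \<open>0\<close>.  As \<open>h\<close> tends to \<open>0\<close> it converges to the generator
  applied to \<open>f\<close>, dominated by the exit rate.
\<close>

lemma expectation_gen_bounded:
  assumes \<pi>: "invariant \<pi>" and bnd: "\<And>x. \<bar>f x\<bar> \<le> B"
    and er: "integrable (measure_pmf \<pi>) exit_rate"
  shows "measure_pmf.expectation \<pi> (gen f) = 0"
proof -
  have \<pi>S: "set_pmf \<pi> \<subseteq> S" and inv: "\<And>t. t \<ge> 0 \<Longrightarrow> bind_pmf \<pi> (p t) = \<pi>"
    using \<pi> by (auto simp: invariant_def)
  define h where "h n = 1 / real (Suc n)" for n
  have h: "h n > 0" for n by (simp add: h_def)
  have hlim: "filterlim h (at_right 0) sequentially"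
  proof (rule filterlim_at_withinI)
    show "h \<longlonglongrightarrow> 0" using LIMSEQ_Suc[OF lim_const_over_n[of 1]] by (simp add: h_def[abs_def])
  qed (auto simp: h_def)
  have "(\<lambda>n. measure_pmf.expectation \<pi> (\<lambda>w. (ev (h n) f w - f w) / h n)) \<longlonglongrightarrow> measure_pmf.expectation \<pi> (gen f)"
  proof (rule integral_dominated_convergence[where w = "\<lambda>w. 2 * B * exit_rate w"])
    show "integrable (measure_pmf \<pi>) (\<lambda>w. 2 * B * exit_rate w)" using er by simp
    show "AE w in \<pi>. norm ((ev (h n) f w - f w) / h n) \<le> 2 * B * exit_rate w" for n
    proof (unfold AE_measure_pmf_iff, intro ballI)
      fix w assume "w \<in> set_pmf \<pi>"
      then have "\<bar>ev (h n) f w - f w\<bar> \<le> 2 * B * exit_rate w * h n"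
        using \<pi>S h[of n] by (intro ev_change_le bnd) auto
      then show "norm ((ev (h n) f w - f w) / h n) \<le> 2 * B * exit_rate w"
        using h[of n] by (simp add: abs_divide pos_divide_le_eq)
    qed
    show "AE w in \<pi>. (\<lambda>n. (ev (h n) f w - f w) / h n) \<longlonglongrightarrow> gen f w"
    proof (unfold AE_measure_pmf_iff, intro ballI)
      fix w assume "w \<in> set_pmf \<pi>"
      then have w: "w \<in> S" using \<pi>S by auto
      have m0: "(\<lambda>n. 2 * B * modulus (h n) w) \<longlonglongrightarrow> 0"
        using tendsto_mult_left[OF filterlim_compose[OF modulus_tendsto_0[OF w] hlim], of "2 * B"] by simp
      have "(\<lambda>n. (ev (h n) f w - f w) / h n - gen f w) \<longlonglongrightarrow> 0"
      proof (rule Lim_null_comparison[OF _ m0], intro always_eventually allI)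
        fix n
        have "\<bar>ev (h n) f w - f w - h n * gen f w\<bar> \<le> 2 * B * h n * modulus (h n) w"
          by (rule first_order[OF w h bnd])
        moreover have "(ev (h n) f w - f w) / h n - gen f w = (ev (h n) f w - f w - h n * gen f w) / h n"
          using h[of n] by (simp add: field_simps)
        ultimately show "norm ((ev (h n) f w - f w) / h n - gen f w) \<le> 2 * B * modulus (h n) w"
          using h[of n] by (simp add: abs_divide pos_divide_le_eq mult_ac)
      qed
      then show "(\<lambda>n. (ev (h n) f w - f w) / h n) \<longlonglongrightarrow> gen f w" by (simp add: LIM_zero_iff)
    qed
  qed auto
  moreover have "measure_pmf.expectation \<pi> (\<lambda>w. (ev (h n) f w - f w) / h n) = 0" for n
  proof -
    have "measure_pmf.expectation \<pi> (ev (h n) f) = measure_pmf.expectation \<pi> f"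
      using expectation_bind_pmf[of f B \<pi> "p (h n)", OF bnd] inv[of "h n"] h[of n]
      by (simp add: ev_def[abs_def])
    then show ?thesis
      using integrable_pmf_bounded[of f B, OF bnd] integrable_pmf_bounded[of "ev (h n) f" B, OF ev_bounded[OF bnd]]
      by simp
  qed
  ultimately have "(\<lambda>n :: nat. 0) \<longlonglongrightarrow> measure_pmf.expectation \<pi> (gen f)" by (simp only:)
  from LIMSEQ_unique[OF tendsto_const this] show ?thesis by simp
qed

text \<open>
  Clipping \<open>f\<close> at \<open>\<plusminus>n\<close> does not increase its increments, so dominated convergence extends the
  balance equation from bounded functions.
\<close>

theorem expectation_gen:
  assumes \<pi>: "invariant \<pi>"
    and er: "\<And>w. w \<in> S \<Longrightarrow> exit_rate w \<le> A * V w"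
    and var: "\<And>w. w \<in> S \<Longrightarrow> (\<Sum>v\<in>N w. r w v * \<bar>f v - f w\<bar>) \<le> A * V w"
  shows "measure_pmf.expectation \<pi> (gen f) = 0"
proof -
  have \<pi>S: "set_pmf \<pi> \<subseteq> S" using \<pi> by (auto simp: invariant_def)
  have intV: "integrable (measure_pmf \<pi>) (\<lambda>w. A * V w)" using integrable_lyapunov[OF \<pi>] by simp
  have er': "integrable (measure_pmf \<pi>) exit_rate"
  proof (rule Bochner_Integration.integrable_bound[OF intV])
    have "norm (exit_rate w) \<le> norm (A * V w)" if "w \<in> S" for w
      using er[OF that] exit_rate_nonneg[OF that] by simp
    then show "AE w in \<pi>. norm (exit_rate w) \<le> norm (A * V w)"
      using \<pi>S by (auto simp: AE_measure_pmf_iff)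
  qed simp
  define clip where "clip n x = max (- real n) (min (real n) (f x))" for n :: nat and x
  have zero: "measure_pmf.expectation \<pi> (gen (clip n)) = 0" for n
    by (rule expectation_gen_bounded[OF \<pi> _ er', of _ "real n"]) (auto simp: clip_def)
  have "(\<lambda>n. measure_pmf.expectation \<pi> (gen (clip n))) \<longlonglongrightarrow> measure_pmf.expectation \<pi> (gen f)"
  proof (rule integral_dominated_convergence[OF _ _ intV])
    show "AE w in \<pi>. norm (gen (clip n) w) \<le> A * V w" for n
    proof (unfold AE_measure_pmf_iff, intro ballI)
      fix w assume "w \<in> set_pmf \<pi>"
      then have w: "w \<in> S" using \<pi>S by auto
      have "norm (gen (clip n) w) \<le> (\<Sum>v\<in>N w. \<bar>r w v * (clip n v - clip n w)\<bar>)"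
        unfolding gen_def by simp
      also have "\<dots> \<le> (\<Sum>v\<in>N w. r w v * \<bar>f v - f w\<bar>)"
      proof (rule sum_mono)
        fix v assume "v \<in> N w"
        then have "r w v \<ge> 0" by (rule rate_nonneg[OF w])
        moreover have "\<bar>clip n v - clip n w\<bar> \<le> \<bar>f v - f w\<bar>" unfolding clip_def by linarith
        ultimately show "\<bar>r w v * (clip n v - clip n w)\<bar> \<le> r w v * \<bar>f v - f w\<bar>"
          by (simp only: abs_mult abs_of_nonneg mult_left_mono)
      qed
      finally show "norm (gen (clip n) w) \<le> A * V w" using var[OF w] by simp
    qed
    have "(\<lambda>n. clip n x) \<longlonglongrightarrow> f x" for x
    proof (rule tendsto_eventually)
      show "\<forall>\<^sub>F n in sequentially. clip n x = f x"
        using eventually_ge_at_top[of "nat \<lceil>\<bar>f x\<bar>\<rceil>"]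
      proof eventually_elim
        case (elim n)
        then have "\<bar>f x\<bar> \<le> real n" by linarith
        then show ?case by (auto simp: clip_def)
      qed
    qed
    then show "AE w in \<pi>. (\<lambda>n. gen (clip n) w) \<longlonglongrightarrow> gen f w"
      unfolding gen_def by (intro AE_I2 tendsto_intros)
  qed auto
  then show ?thesis unfolding zero using LIMSEQ_unique[OF _ tendsto_const] by metis
qed

end

section \<open>The semigroup of a Markov jump process\<close>

locale jump_process =
  fixes S :: "'s set" and r :: "'s \<Rightarrow> 's \<Rightarrow> real" and P :: "'s \<Rightarrow> 'w measure"
    and X :: "real \<Rightarrow> 'w \<Rightarrow> 's"
  assumes countable_states: "countable S" and mjp: "markov_jump_process S r P X"
begin

text \<open>
  Point probabilities determine the distribution and sum to \<open>1\<close> because \<open>S\<close> is countable.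
\<close>

definition law :: "real \<Rightarrow> 's \<Rightarrow> 's pmf" where
  "law t w = embed_pmf (\<lambda>y. \<P>(\<omega> in P w. X t \<omega> = y))"

lemmas mjp_at = mjp[unfolded markov_jump_process_def, THEN bspec]

lemma prob_space_P: "w \<in> S \<Longrightarrow> prob_space (P w)"
  by (drule mjp_at) (elim conjE)

lemma measurable_X: "w \<in> S \<Longrightarrow> t \<ge> 0 \<Longrightarrow> X t \<in> measurable (P w) (count_space S)"
  by (drule mjp_at) simp

lemma start_P: "w \<in> S \<Longrightarrow> \<P>(\<omega> in P w. X 0 \<omega> = w) = 1"
  by (drule mjp_at) (elim conjE)

lemma markov_property:
  assumes w: "w \<in> S" and s: "s \<ge> 0" and z: "z \<in> S" and t: "t \<ge> 0" and y: "y \<in> S"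
  shows "\<P>(\<omega> in P w. X s \<omega> = z \<and> X (s + t) \<omega> = y) = \<P>(\<omega> in P w. X s \<omega> = z) * \<P>(\<omega> in P z. X t \<omega> = y)"
proof -
  from mjp_at[OF w] have "\<forall>s\<ge>0. \<forall>I x. finite I \<and> I \<subseteq> {0..s} \<and> s \<in> I \<and> (\<forall>u\<in>I. x u \<in> S) \<longrightarrow>
        (\<forall>t\<ge>0. \<forall>y\<in>S.
          \<P>(\<omega> in P w. (\<forall>u\<in>I. X u \<omega> = x u) \<and> X (s + t) \<omega> = y) =
          \<P>(\<omega> in P w. \<forall>u\<in>I. X u \<omega> = x u) * \<P>(\<omega> in P (x s). X t \<omega> = y))"
    by (elim conjE)
  from this[rule_format, OF s, of "{s}" "\<lambda>_. z" t y] show ?thesis using s z t y by simp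
qed

lemma jump_rate:
  "w \<in> S \<Longrightarrow> v \<in> S - {w} \<Longrightarrow> ((\<lambda>h. \<P>(\<omega> in P w. X h \<omega> = v) / h) \<longlongrightarrow> r w v) (at_right 0)"
  by (drule mjp_at) (elim conjE, erule bspec)

lemma leave_rate:
  "w \<in> S \<Longrightarrow> ((\<lambda>h. (1 - \<P>(\<omega> in P w. X h \<omega> = w)) / h) \<longlongrightarrow> (\<Sum>\<^sub>\<infinity>v\<in>S - {w}. r w v)) (at_right 0)"
  by (drule mjp_at) (elim conjE)

lemma event_sets:
  assumes "w \<in> S" "t \<ge> 0"
  shows "{\<omega> \<in> space (P w). X t \<omega> \<in> A} \<in> sets (P w)"
proof -
  have "X t -` (A \<inter> S) \<inter> space (P w) \<in> sets (P w)"
    by (rule measurable_sets[OF measurable_X[OF assms]]) simp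
  also have "X t -` (A \<inter> S) \<inter> space (P w) = {\<omega> \<in> space (P w). X t \<omega> \<in> A}"
    using measurable_space[OF measurable_X[OF assms]] by auto
  finally show ?thesis .
qed

lemma in_states: "w \<in> S \<Longrightarrow> t \<ge> 0 \<Longrightarrow> \<omega> \<in> space (P w) \<Longrightarrow> X t \<omega> \<in> S"
  using measurable_space[OF measurable_X] by simp

lemma decompose:
  assumes "w \<in> S" "t \<ge> 0"
  shows "emeasure (P w) {\<omega> \<in> space (P w). X t \<omega> \<in> A} =
    (\<integral>\<^sup>+y. emeasure (P w) {\<omega> \<in> space (P w). X t \<omega> = y} \<partial>count_space (A \<inter> S))"
proof -
  have "{\<omega> \<in> space (P w). X t \<omega> \<in> A} = (\<Union>y\<in>A \<inter> S. {\<omega> \<in> space (P w). X t \<omega> = y})"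
    using in_states[OF assms] by auto
  also have "emeasure (P w) \<dots> = (\<integral>\<^sup>+y. emeasure (P w) {\<omega> \<in> space (P w). X t \<omega> = y} \<partial>count_space (A \<inter> S))"
    using event_sets[OF assms, of "{_}"] countable_states
    by (intro emeasure_UN_countable) (auto simp: disjoint_family_on_def)
  finally show ?thesis .
qed

lemma pmf_law:
  assumes w: "w \<in> S" and t: "t \<ge> 0"
  shows "pmf (law t w) y = \<P>(\<omega> in P w. X t \<omega> = y)"
  unfolding law_def
proof (rule pmf_embed_pmf)
  interpret prob_space "P w" by (rule prob_space_P[OF w])
  have "(\<integral>\<^sup>+y. ennreal (\<P>(\<omega> in P w. X t \<omega> = y)) \<partial>count_space UNIV) =
      (\<integral>\<^sup>+y. emeasure (P w) {\<omega> \<in> space (P w). X t \<omega> = y} \<partial>count_space S)"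
    unfolding emeasure_eq_measure
  proof (rule nn_integral_count_space_eq)
    fix y assume "y \<in> UNIV - S"
    then have "{\<omega> \<in> space (P w). X t \<omega> = y} = {}" using in_states[OF w t] by auto
    then show "ennreal (\<P>(\<omega> in P w. X t \<omega> = y)) = 0" by (simp only: measure_empty ennreal_0)
  qed auto
  also have "\<dots> = emeasure (P w) {\<omega> \<in> space (P w). X t \<omega> \<in> UNIV}"
    using decompose[OF w t, of UNIV] by simp
  also have "\<dots> = 1" using emeasure_space_1 by simp
  finally show "(\<integral>\<^sup>+y. ennreal (\<P>(\<omega> in P w. X t \<omega> = y)) \<partial>count_space UNIV) = 1" .
qed simp

lemma law_closed:
  assumes "w \<in> S" "t \<ge> 0"
  shows "set_pmf (law t w) \<subseteq> S"
proof
  fix y assume "y \<in> set_pmf (law t w)"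
  then have "\<P>(\<omega> in P w. X t \<omega> = y) \<noteq> 0" by (simp add: set_pmf_eq pmf_law[OF assms])
  then have "{\<omega> \<in> space (P w). X t \<omega> = y} \<noteq> {}" by (metis measure_empty)
  then show "y \<in> S" using in_states[OF assms] by auto
qed

lemma prob_law:
  assumes w: "w \<in> S" and t: "t \<ge> 0"
  shows "measure (measure_pmf (law t w)) A = \<P>(\<omega> in P w. X t \<omega> \<in> A)"
proof -
  interpret prob_space "P w" by (rule prob_space_P[OF w])
  have "emeasure (measure_pmf (law t w)) A = (\<integral>\<^sup>+y. ennreal (pmf (law t w) y) \<partial>count_space A)"
    by (simp add: nn_integral_pmf)
  also have "\<dots> = (\<integral>\<^sup>+y. ennreal (pmf (law t w) y) \<partial>count_space (A \<inter> S))"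
    using law_closed[OF w t] by (intro nn_integral_count_space_eq) (auto simp: set_pmf_eq)
  also have "\<dots> = emeasure (P w) {\<omega> \<in> space (P w). X t \<omega> \<in> A}"
    unfolding decompose[OF w t] pmf_law[OF w t] emeasure_eq_measure[symmetric] ..
  finally show ?thesis by (simp add: measure_def)
qed

lemma law_0:
  assumes w: "w \<in> S"
  shows "law 0 w = return_pmf w"
proof (rule ccontr)
  assume "law 0 w \<noteq> return_pmf w"
  then obtain x where "pmf (law 0 w) x < pmf (return_pmf w) x" using pmf_neq_exists_less by metis
  then show False using start_P[OF w] pmf_law[OF w, of 0 w]
    by (cases "w = x") (simp_all add: pmf_return)
qed

text \<open>
  The Markov property is used with the single observation time \<open>s\<close>, summed over the state at \<open>s\<close>.
\<close>

lemma law_add: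
  assumes w: "w \<in> S" and s: "s \<ge> 0" and t: "t \<ge> 0"
  shows "law (s + t) w = bind_pmf (law s w) (law t)"
proof (rule pmf_eqI)
  interpret prob_space "P w" by (rule prob_space_P[OF w])
  fix y
  show "pmf (law (s + t) w) y = pmf (bind_pmf (law s w) (law t)) y"
  proof (cases "y \<in> S")
    case False
    moreover have "set_pmf (law (s + t) w) \<subseteq> S" using s t by (intro law_closed w) simp
    moreover have "set_pmf (bind_pmf (law s w) (law t)) \<subseteq> S"
      unfolding set_bind_pmf
    proof (rule UN_least)
      fix z assume "z \<in> set_pmf (law s w)"
      then show "set_pmf (law t z) \<subseteq> S" using law_closed[OF w s] by (intro law_closed t) blast
    qed
    ultimately have "y \<notin> set_pmf (law (s + t) w)" "y \<notin> set_pmf (bind_pmf (law s w) (law t))" by blast+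
    then have "pmf (law (s + t) w) y = 0" "pmf (bind_pmf (law s w) (law t)) y = 0"
      unfolding pmf_eq_0_set_pmf .
    then show ?thesis by simp
  next
    case y: True
    have st: "s + t \<ge> 0" using s t by simp
    let ?E = "\<lambda>z. {\<omega> \<in> space (P w). X s \<omega> = z \<and> X (s + t) \<omega> = y}"
    have E: "?E z \<in> sets (P w)" for z
    proof -
      have "?E z = {\<omega> \<in> space (P w). X s \<omega> \<in> {z}} \<inter> {\<omega> \<in> space (P w). X (s + t) \<omega> \<in> {y}}" by auto
      then show ?thesis using event_sets[OF w s, of "{z}"] event_sets[OF w st, of "{y}"] by simp
    qed
    have mk: "emeasure (P w) (?E z) = ennreal (pmf (law s w) z) * ennreal (pmf (law t z) y)" if z: "z \<in> S" for z
      using markov_property[OF w s z t y]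
      by (simp add: emeasure_eq_measure pmf_law[OF w s] pmf_law[OF z t] ennreal_mult')
    have "ennreal (pmf (law (s + t) w) y) = emeasure (P w) {\<omega> \<in> space (P w). X (s + t) \<omega> = y}"
      by (simp add: pmf_law[OF w st] emeasure_eq_measure)
    also have "{\<omega> \<in> space (P w). X (s + t) \<omega> = y} = (\<Union>z\<in>S. ?E z)"
      using in_states[OF w s] by auto
    also have "emeasure (P w) \<dots> = (\<integral>\<^sup>+z. emeasure (P w) (?E z) \<partial>count_space S)"
      by (intro emeasure_UN_countable E countable_states) (auto simp: disjoint_family_on_def)
    also have "\<dots> = (\<integral>\<^sup>+z. ennreal (pmf (law s w) z) * ennreal (pmf (law t z) y) \<partial>count_space S)"
      by (intro nn_integral_cong mk) simp
    also have "\<dots> = (\<integral>\<^sup>+z. ennreal (pmf (law s w) z) * ennreal (pmf (law t z) y) \<partial>count_space UNIV)"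
      using law_closed[OF w s] by (intro nn_integral_count_space_eq) (auto simp: set_pmf_eq)
    also have "\<dots> = ennreal (pmf (bind_pmf (law s w) (law t)) y)"
      by (simp add: ennreal_pmf_bind nn_integral_measure_pmf)
    finally show ?thesis by simp
  qed
qed

lemma prob_from_function:
  assumes \<pi>: "set_pmf \<pi> \<subseteq> S" and t: "t \<ge> 0"
  shows "prob_from \<pi> P (\<lambda>\<omega>. h (X t \<omega>)) x = pmf (map_pmf h (bind_pmf \<pi> (law t))) x"
proof -
  have "prob_from \<pi> P (\<lambda>\<omega>. h (X t \<omega>)) x = measure_pmf.expectation \<pi> (\<lambda>w. pmf (map_pmf h (law t w)) x)"
    unfolding prob_from_def
  proof (rule integral_cong_AE)
    have "\<P>(\<omega> in P w. h (X t \<omega>) = x) = pmf (map_pmf h (law t w)) x" if "w \<in> S" for w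
      using prob_law[OF that t, of "h -` {x}"] by (simp add: pmf_map)
    then show "AE w in \<pi>. \<P>(\<omega> in P w. h (X t \<omega>) = x) = pmf (map_pmf h (law t w)) x"
      using \<pi> by (auto simp: AE_measure_pmf_iff)
  qed auto
  then show ?thesis by (simp add: map_bind_pmf pmf_bind)
qed

lemma stationary_iff:
  "stationary_distribution S P X \<pi> \<longleftrightarrow> set_pmf \<pi> \<subseteq> S \<and> (\<forall>t\<ge>0. bind_pmf \<pi> (law t) = \<pi>)"
  using prob_from_function[of \<pi> _ "\<lambda>x. x"]
  by (auto simp: stationary_distribution_def pmf_eq_iff)

end

section \<open>The reward process and its stationary distribution\<close>

definition arrive :: "state \<Rightarrow> state" where
  "arrive w = ((fst w)(snd w := fst w (snd w) + 1), snd w)"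

definition depart :: "nat \<Rightarrow> state \<Rightarrow> state" where
  "depart k w = ((fst w)(k := fst w k - 1), snd w)"

definition moves :: "nat \<Rightarrow> state \<Rightarrow> state set" where
  "moves K w = insert (arrive w) ((\<lambda>k. depart k w) ` {1..K} \<union> (\<lambda>c. (fst w, c)) ` {1..K})"

definition reward_gen ::
  "nat \<Rightarrow> (nat \<Rightarrow> real) \<Rightarrow> real \<Rightarrow> real \<Rightarrow> nat \<Rightarrow> (state \<Rightarrow> real) \<Rightarrow> state \<Rightarrow> real" where
  "reward_gen K lam \<beta> \<alpha> m f w =
     lam (snd w) * (f (arrive w) - f w) +
     (\<Sum>k\<in>{1..K}. real (fst w k) / real m * (f (depart k w) - f w)) +
     (\<Sum>c\<in>{1..K}. \<beta> * choice_prob K \<alpha> (fst w) c * (f (fst w, c) - f w))"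

definition total_reward :: "nat \<Rightarrow> state \<Rightarrow> nat" where
  "total_reward K w = (\<Sum>k\<in>{1..K}. fst w k)"

lemma countable_states: "countable (states K)"
proof -
  have "inj_on (\<lambda>w. (map (fst w) [1..<Suc K], snd w)) (states K)"
  proof (rule inj_onI)
    fix v w assume v: "v \<in> states K" and w: "w \<in> states K"
      and eq: "(map (fst v) [1..<Suc K], snd v) = (map (fst w) [1..<Suc K], snd w)"
    have "fst v k = fst w k" for k
    proof (cases "k \<in> {1..K}")
      case True
      then show ?thesis using eq by (auto simp del: upt_Suc)
    next
      case False
      then show ?thesis using v w by (auto simp: states_def)
    qed
    then show "v = w" using eq by (auto simp: prod_eq_iff)
  qed
  then show ?thesis by (rule countableI')
qed

lemma moves_in_states:
  assumes "w \<in> states K"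
  shows "moves K w \<subseteq> states K"
  using assms by (auto simp: moves_def states_def arrive_def depart_def)

lemma reward_rate_eq:
  assumes v: "v \<in> states K"
  shows "reward_rate K lam \<beta> \<alpha> m w v =
    (if v = arrive w then lam (snd w) else 0) +
    (\<Sum>k\<in>{1..K}. if v = depart k w then real (fst w k) / real m else 0) +
    (\<Sum>c\<in>{1..K}. if v = (fst w, c) then \<beta> * choice_prob K \<alpha> (fst w) c else 0)"
proof -
  obtain q c where w: "w = (q, c)" by (cases w)
  obtain q' c' where v': "v = (q', c')" by (cases v)
  have c': "c' \<in> {1..K}" using v by (auto simp: v' states_def)
  have "(\<Sum>d\<in>{1..K}. if v = (fst w, d) then \<beta> * choice_prob K \<alpha> (fst w) d else 0) =
      (\<Sum>d\<in>{1..K}. if d = c' then (if q' = q then \<beta> * choice_prob K \<alpha> q c' else 0) else 0)"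
    by (intro sum.cong) (auto simp: w v')
  also have "\<dots> = (if q' = q then \<beta> * choice_prob K \<alpha> q c' else 0)" using c' by simp
  finally show ?thesis
    unfolding arrive_def depart_def by (simp add: reward_rate_def w v' conj_commute cong: if_cong)
qed

lemma reward_rate_outside:
  assumes "v \<in> states K" "v \<notin> moves K w"
  shows "reward_rate K lam \<beta> \<alpha> m w v = 0"
proof -
  have "v \<noteq> arrive w" "\<And>k. k \<in> {1..K} \<Longrightarrow> v \<noteq> depart k w" "\<And>c. c \<in> {1..K} \<Longrightarrow> v \<noteq> (fst w, c)"
    using assms(2) by (auto simp: moves_def)
  then have "(\<Sum>k\<in>{1..K}. if v = depart k w then real (fst w k) / real m else 0) = 0"
      "(\<Sum>c\<in>{1..K}. if v = (fst w, c) then \<beta> * choice_prob K \<alpha> (fst w) c else 0) = 0" "v \<noteq> arrive w"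
    by (auto intro!: sum.neutral simp del: One_nat_def)
  then show ?thesis unfolding reward_rate_eq[OF assms(1)] by simp
qed

lemma finite_moves: "finite (moves K w)" by (simp add: moves_def)

text \<open>
  The diagonal is excluded on the left but not on the right: a departure at zero reward or an
  update that keeps the choice leads back to \<open>w\<close>, where \<open>g\<close> vanishes.
\<close>

lemma sum_reward_rate:
  assumes w: "w \<in> states K" and g: "g w = 0"
  shows "(\<Sum>v\<in>moves K w - {w}. reward_rate K lam \<beta> \<alpha> m w v * g v) =
    lam (snd w) * g (arrive w) + (\<Sum>k\<in>{1..K}. real (fst w k) / real m * g (depart k w)) +
    (\<Sum>c\<in>{1..K}. \<beta> * choice_prob K \<alpha> (fst w) c * g (fst w, c))"
proof -
  let ?M = "moves K w"
  have "(\<Sum>v\<in>?M - {w}. reward_rate K lam \<beta> \<alpha> m w v * g v) = (\<Sum>v\<in>?M. reward_rate K lam \<beta> \<alpha> m w v * g v)"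
    using g by (intro sum.mono_neutral_left finite_moves) auto
  also have "\<dots> = (\<Sum>v\<in>?M. (if v = arrive w then lam (snd w) * g v else 0) +
      (\<Sum>k\<in>{1..K}. if v = depart k w then real (fst w k) / real m * g v else 0) +
      (\<Sum>c\<in>{1..K}. if v = (fst w, c) then \<beta> * choice_prob K \<alpha> (fst w) c * g v else 0))"
  proof (rule sum.cong[OF refl])
    have mult_if: "(if b then x else 0) * y = (if b then x * y else 0)" for b and x y :: real by simp
    fix v assume "v \<in> ?M"
    then have v: "v \<in> states K" using moves_in_states[OF w] by blast
    show "reward_rate K lam \<beta> \<alpha> m w v * g v = (if v = arrive w then lam (snd w) * g v else 0) +
      (\<Sum>k\<in>{1..K}. if v = depart k w then real (fst w k) / real m * g v else 0) +
      (\<Sum>c\<in>{1..K}. if v = (fst w, c) then \<beta> * choice_prob K \<alpha> (fst w) c * g v else 0)"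
      unfolding reward_rate_eq[OF v] by (simp only: distrib_right sum_distrib_right mult_if)
  qed
  also have "\<dots> = (\<Sum>v\<in>?M. if v = arrive w then lam (snd w) * g v else 0) +
      (\<Sum>k\<in>{1..K}. \<Sum>v\<in>?M. if v = depart k w then real (fst w k) / real m * g v else 0) +
      (\<Sum>c\<in>{1..K}. \<Sum>v\<in>?M. if v = (fst w, c) then \<beta> * choice_prob K \<alpha> (fst w) c * g v else 0)"
    unfolding sum.distrib by (simp only: sum.swap[of _ ?M])
  also have "(\<Sum>v\<in>?M. if v = arrive w then lam (snd w) * g v else 0) = lam (snd w) * g (arrive w)"
    by (subst sum.delta[OF finite_moves]) (simp add: moves_def)
  also have "(\<Sum>k\<in>{1..K}. \<Sum>v\<in>?M. if v = depart k w then real (fst w k) / real m * g v else 0) =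
      (\<Sum>k\<in>{1..K}. real (fst w k) / real m * g (depart k w))"
    by (intro sum.cong refl, subst sum.delta[OF finite_moves]) (simp add: moves_def)
  also have "(\<Sum>c\<in>{1..K}. \<Sum>v\<in>?M. if v = (fst w, c) then \<beta> * choice_prob K \<alpha> (fst w) c * g v else 0) =
      (\<Sum>c\<in>{1..K}. \<beta> * choice_prob K \<alpha> (fst w) c * g (fst w, c))"
    by (intro sum.cong refl, subst sum.delta[OF finite_moves]) (simp add: moves_def)
  finally show ?thesis .
qed

lemma choice_prob_pos:
  assumes "\<alpha> > 0" "K \<ge> 1"
  shows "choice_prob K \<alpha> q k > 0"
  unfolding choice_prob_def using assms by (intro divide_pos_pos sum_pos) (auto simp: less_max_iff_disj)

lemma sum_choice_prob:
  assumes "\<alpha> > 0" "K \<ge> 1"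
  shows "(\<Sum>k\<in>{1..K}. choice_prob K \<alpha> q k) = 1"
proof -
  have "(\<Sum>i\<in>{1..K}. max (real (q i)) \<alpha>) > 0"
    using assms by (intro sum_pos) (auto simp: less_max_iff_disj)
  then show ?thesis unfolding choice_prob_def sum_divide_distrib[symmetric] by simp
qed

lemma cube_le_exp: "(1 + real n) ^ 3 \<le> 8 * 2 ^ n"
proof -
  have "(1 + n) ^ 3 \<le> 8 * 2 ^ n" for n :: nat
  proof (induction n)
    case (Suc n)
    consider "n = 0" | "n = 1" | "n = 2" | "n \<ge> 3" by linarith
    then show ?case
    proof cases
      case 4
      have "6 * n + 6 \<le> 9 * n" using 4 by simp
      also have "9 * n \<le> n ^ 3"
        using mult_mono[OF 4 4] by (simp add: power3_eq_cube)
      finally have "(2 + n) ^ 3 \<le> 2 * (1 + n) ^ 3"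
        by (simp add: power3_eq_cube algebra_simps)
      then show ?thesis using Suc by simp
    qed (auto simp: power3_eq_cube)
  qed simp
  then have "real ((1 + n) ^ 3) \<le> real (8 * 2 ^ n)" by (simp only: of_nat_le_iff)
  then show ?thesis by simp
qed

lemma total_upd:
  assumes "k \<in> {1..K}"
  shows "total_reward K (q(k := x), c) + q k = total_reward K (q, d) + x"
proof -
  have "total_reward K (q(k := x), c) = x + (\<Sum>i\<in>{1..K} - {k}. q i)"
    unfolding total_reward_def using sum.remove[OF _ assms, of "q(k := x)"] by simp
  moreover have "total_reward K (q, d) = q k + (\<Sum>i\<in>{1..K} - {k}. q i)"
    unfolding total_reward_def using sum.remove[OF _ assms, of q] by simp
  ultimately show ?thesis by simp
qed

lemma total_arrive: "w \<in> states K \<Longrightarrow> total_reward K (arrive w) = total_reward K w + 1"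
  using total_upd[of "snd w" K "fst w" "fst w (snd w) + 1" "snd w" "snd w"] by (auto simp: states_def arrive_def)

lemma total_depart: "k \<in> {1..K} \<Longrightarrow> total_reward K (depart k w) = total_reward K w - (if fst w k = 0 then 0 else 1)"
  using total_upd[of k K "fst w" "fst w k - 1" "snd w" "snd w"] by (auto simp: depart_def)

lemma finite_total_le: "finite {w \<in> states K. total_reward K w \<le> n}"
proof -
  have fin: "finite {q :: nat \<Rightarrow> nat. \<forall>i. (i \<in> {1..K} \<longrightarrow> q i \<in> {..n}) \<and> (i \<notin> {1..K} \<longrightarrow> q i = 0)}"
    by (rule finite_set_of_finite_funs) auto
  show ?thesis
  proof (rule finite_subset[OF _ finite_cartesian_product[OF fin finite_atLeastAtMost[of 1 K]]])
    show "{w \<in> states K. total_reward K w \<le> n} \<subseteq> {q. \<forall>i. (i \<in> {1..K} \<longrightarrow> q i \<in> {..n}) \<and> (i \<notin> {1..K} \<longrightarrow> q i = 0)} \<times> {1..K}"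
    proof
      fix w assume w: "w \<in> {w \<in> states K. total_reward K w \<le> n}"
      have "fst w i \<le> n" if "i \<in> {1..K}" for i
      proof -
        have "fst w i \<le> total_reward K w" unfolding total_reward_def by (rule member_le_sum[OF that]) auto
        then show ?thesis using w by simp
      qed
      then show "w \<in> {q. \<forall>i. (i \<in> {1..K} \<longrightarrow> q i \<in> {..n}) \<and> (i \<notin> {1..K} \<longrightarrow> q i = 0)} \<times> {1..K}"
        using w by (auto simp: states_def)
    qed
  qed
qed

definition lyap :: "nat \<Rightarrow> state \<Rightarrow> real" where
  "lyap K w = 2 ^ total_reward K w"

locale reward_process =
  fixes K m :: nat and lam :: "nat \<Rightarrow> real" and \<beta> \<alpha> :: real
    and P :: "state \<Rightarrow> 'w measure" and W :: "real \<Rightarrow> 'w \<Rightarrow> state"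
  assumes K: "K \<ge> 1" and lam: "\<And>k. k \<in> {1..K} \<Longrightarrow> lam k > 0" and m: "m \<ge> 1"
    and \<alpha>: "\<alpha> > 0" and \<beta>: "\<beta> > 0"
    and process: "markov_jump_process (states K) (reward_rate K lam \<beta> \<alpha> m) P W"
begin

sublocale jump_process "states K" "reward_rate K lam \<beta> \<alpha> m" P W
  by unfold_locales (rule countable_states, rule process)

abbreviation nbrs :: "state \<Rightarrow> state set" where
  "nbrs w \<equiv> moves K w - {w}"

sublocale markov_semigroup "states K" law "reward_rate K lam \<beta> \<alpha> m" nbrs
proof
  fix w assume w: "w \<in> states K"
  show "finite (nbrs w)" by (simp add: finite_moves)
  show nb: "nbrs w \<subseteq> states K - {w}" using moves_in_states[OF w] by auto
  have pos: "\<forall>\<^sub>F h in at_right (0::real). 0 \<le> h" by (auto simp: eventually_at_filter)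
  show "((\<lambda>h. pmf (law h w) v / h) \<longlongrightarrow> reward_rate K lam \<beta> \<alpha> m w v) (at_right 0)" if v: "v \<in> nbrs w" for v
  proof (rule Lim_transform_eventually[OF jump_rate[OF w]])
    show "v \<in> states K - {w}" using v nb by blast
    show "\<forall>\<^sub>F h in at_right 0. \<P>(\<omega> in P w. W h \<omega> = v) / h = pmf (law h w) v / h"
      using pos by eventually_elim (simp add: pmf_law[OF w])
  qed
  have "(\<Sum>\<^sub>\<infinity>v\<in>states K - {w}. reward_rate K lam \<beta> \<alpha> m w v) = (\<Sum>\<^sub>\<infinity>v\<in>nbrs w. reward_rate K lam \<beta> \<alpha> m w v)"
    using nb by (intro infsum_cong_neutral) (auto intro: reward_rate_outside)
  also have "\<dots> = (\<Sum>v\<in>nbrs w. reward_rate K lam \<beta> \<alpha> m w v)" by (simp add: finite_moves)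
  finally have eq: "(\<Sum>\<^sub>\<infinity>v\<in>states K - {w}. reward_rate K lam \<beta> \<alpha> m w v) = \<dots>" .
  show "((\<lambda>h. (1 - pmf (law h w) w) / h) \<longlongrightarrow> (\<Sum>v\<in>nbrs w. reward_rate K lam \<beta> \<alpha> m w v)) (at_right 0)"
  proof (rule Lim_transform_eventually[OF leave_rate[OF w, unfolded eq]])
    show "\<forall>\<^sub>F h in at_right 0. (1 - \<P>(\<omega> in P w. W h \<omega> = w)) / h = (1 - pmf (law h w) w) / h"
      using pos by eventually_elim (simp add: pmf_law[OF w])
  qed
qed (use law_closed law_0 law_add in auto)

lemma gen_eq:
  assumes "w \<in> states K"
  shows "gen f w = reward_gen K lam \<beta> \<alpha> m f w"
  unfolding gen_def reward_gen_def using sum_reward_rate[OF assms, of "\<lambda>v. f v - f w"] by simp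

definition Lam :: real where "Lam = (\<Sum>k\<in>{1..K}. lam k)"

lemma lam_le: "k \<in> {1..K} \<Longrightarrow> lam k \<le> Lam"
  unfolding Lam_def using lam by (intro member_le_sum) (auto simp: less_imp_le)

lemma Lam_pos: "Lam > 0"
  unfolding Lam_def using lam K by (intro sum_pos) auto

lemma sum_rate_le:
  assumes w: "w \<in> states K" and B: "B \<ge> 0" and g0: "g w = 0"
    and g: "\<And>v. v \<in> moves K w \<Longrightarrow> g v \<le> B"
  shows "(\<Sum>v\<in>nbrs w. reward_rate K lam \<beta> \<alpha> m w v * g v) \<le> (Lam + 1 + \<beta>) * (1 + real (total_reward K w)) * B"
proof -
  have c: "snd w \<in> {1..K}" using w by (auto simp: states_def)
  have "(\<Sum>v\<in>nbrs w. reward_rate K lam \<beta> \<alpha> m w v * g v) =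
    lam (snd w) * g (arrive w) + (\<Sum>k\<in>{1..K}. real (fst w k) / real m * g (depart k w)) +
    (\<Sum>c\<in>{1..K}. \<beta> * choice_prob K \<alpha> (fst w) c * g (fst w, c))"
    by (rule sum_reward_rate[where g = g, OF w g0])
  also have "\<dots> \<le> Lam * B + (\<Sum>k\<in>{1..K}. real (fst w k) * B) + (\<Sum>c\<in>{1..K}. \<beta> * choice_prob K \<alpha> (fst w) c * B)"
  proof (intro add_mono sum_mono)
    have "lam (snd w) * g (arrive w) \<le> lam (snd w) * B"
      using lam[OF c] by (intro mult_left_mono g) (auto simp: moves_def)
    also have "\<dots> \<le> Lam * B" using lam_le[OF c] B by (intro mult_right_mono) auto
    finally show "lam (snd w) * g (arrive w) \<le> Lam * B" .
    fix k assume k: "k \<in> {1..K}"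
    have "real (fst w k) / real m * g (depart k w) \<le> real (fst w k) / real m * B"
      using k by (intro mult_left_mono g) (auto simp: moves_def)
    also have "\<dots> \<le> real (fst w k) * B"
    proof (intro mult_right_mono B)
      have "real (fst w k) * 1 \<le> real (fst w k) * real m" using m by (intro mult_left_mono) auto
      then show "real (fst w k) / real m \<le> real (fst w k)" using m by (simp add: divide_le_eq)
    qed
    finally show "real (fst w k) / real m * g (depart k w) \<le> real (fst w k) * B" .
    show "\<beta> * choice_prob K \<alpha> (fst w) k * g (fst w, k) \<le> \<beta> * choice_prob K \<alpha> (fst w) k * B"
      using k \<beta> choice_prob_pos[OF \<alpha> K, of "fst w" k] by (intro mult_left_mono g) (auto simp: moves_def)
  qed
  also have "\<dots> = (Lam + real (total_reward K w) + \<beta>) * B"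
    unfolding sum_distrib_right[symmetric] sum_distrib_left[symmetric] sum_choice_prob[OF \<alpha> K]
    by (simp add: total_reward_def algebra_simps)
  also have "\<dots> \<le> ((Lam + 1 + \<beta>) * (1 + real (total_reward K w))) * B"
    using Lam_pos \<beta> B by (intro mult_right_mono) (auto simp: algebra_simps)
  finally show ?thesis .
qed

text \<open>
  An arrival doubles the Lyapunov function and a departure halves it, so the generator multiplies it
  by at most \<open>Lam - total_reward K w / (2 * m)\<close>.  This factor is at most \<open>-1\<close> as soon as the total
  exceeds \<open>2 * m * (Lam + 1)\<close>.
\<close>

lemma lyap_drift:
  assumes w: "w \<in> states K"
  shows "gen (lyap K) w \<le> (Lam + 1) * 2 ^ nat \<lceil>2 * real m * (Lam + 1)\<rceil> - lyap K w"
proof -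
  define n where "n = nat \<lceil>2 * real m * (Lam + 1)\<rceil>"
  define V where "V = lyap K w"
  have c: "snd w \<in> {1..K}" using w by (auto simp: states_def)
  have V: "V > 0" by (simp add: V_def lyap_def)
  have "lyap K (fst w, k) = V" for k by (simp add: V_def lyap_def total_reward_def)
  moreover have "lyap K (arrive w) = 2 * V" by (simp add: V_def lyap_def total_arrive[OF w])
  moreover have "real (fst w k) / real m * (lyap K (depart k w) - V) = - (real (fst w k) / real m * (V / 2))"
    if k: "k \<in> {1..K}" for k
  proof (cases "fst w k = 0")
    case False
    have "fst w k \<le> total_reward K w" unfolding total_reward_def by (rule member_le_sum[OF k]) auto
    with False have t: "total_reward K w = Suc (total_reward K w - 1)" by simp
    have "V = 2 * lyap K (depart k w)"
      unfolding V_def lyap_def total_depart[OF k] using False by (subst t) simp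
    then show ?thesis by simp
  qed simp
  ultimately have "gen (lyap K) w = lam (snd w) * V - (\<Sum>k\<in>{1..K}. real (fst w k) / real m * (V / 2))"
    unfolding gen_eq[OF w] reward_gen_def V_def[symmetric] by (simp add: sum_negf)
  also have "\<dots> = (lam (snd w) - real (total_reward K w) / (2 * real m)) * V"
    unfolding total_reward_def of_nat_sum sum_divide_distrib left_diff_distrib sum_distrib_right by (simp add: mult.commute)
  also have "\<dots> \<le> (Lam - real (total_reward K w) / (2 * real m)) * V"
    using lam_le[OF c] V by (intro mult_right_mono) auto
  also have "\<dots> \<le> (Lam + 1) * 2 ^ n - V"
  proof (cases "total_reward K w \<le> n")
    case True
    have "(Lam + 1 - real (total_reward K w) / (2 * real m)) * V \<le> (Lam + 1) * V"
      using V by (intro mult_right_mono) auto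
    also have "\<dots> \<le> (Lam + 1) * 2 ^ n"
      using Lam_pos True by (intro mult_left_mono) (auto simp: V_def lyap_def)
    finally show ?thesis by (simp add: algebra_simps)
  next
    case False
    then have "2 * real m * (Lam + 1) \<le> real (total_reward K w)" unfolding n_def by linarith
    then have "Lam + 1 \<le> real (total_reward K w) / (2 * real m)" using m by (simp add: field_simps)
    then have "(Lam - real (total_reward K w) / (2 * real m)) * V \<le> (- 1) * V"
      using V by (intro mult_right_mono) auto
    moreover have "0 \<le> (Lam + 1) * 2 ^ n" using Lam_pos by simp
    ultimately show ?thesis by linarith
  qed
  finally show ?thesis by (simp add: n_def V_def)
qed

abbreviation jump :: "state \<Rightarrow> state \<Rightarrow> bool" where
  "jump w v \<equiv> v \<in> nbrs w \<and> reward_rate K lam \<beta> \<alpha> m w v > 0"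

lemma reward_rate_ge:
  assumes w: "w \<in> states K"
  shows "reward_rate K lam \<beta> \<alpha> m w (arrive w) \<ge> lam (snd w)"
    and "k \<in> {1..K} \<Longrightarrow> reward_rate K lam \<beta> \<alpha> m w (depart k w) \<ge> real (fst w k) / real m"
    and "k \<in> {1..K} \<Longrightarrow> reward_rate K lam \<beta> \<alpha> m w (fst w, k) \<ge> \<beta> * choice_prob K \<alpha> (fst w) k"
proof -
  have in_states: "v \<in> states K" if "v \<in> moves K w" for v using moves_in_states[OF w] that by blast
  have l: "lam (snd w) \<ge> 0" using lam[of "snd w"] w by (force simp: states_def)
  have p: "\<beta> * choice_prob K \<alpha> (fst w) c \<ge> 0" for c
    using \<beta> choice_prob_pos[OF \<alpha> K] by (simp add: less_imp_le)
  let ?d = "\<lambda>v. \<Sum>k\<in>{1..K}. if v = depart k w then real (fst w k) / real m else 0"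
  let ?u = "\<lambda>v. \<Sum>c\<in>{1..K}. if v = (fst w, c) then \<beta> * choice_prob K \<alpha> (fst w) c else 0"
  have d0: "?d v \<ge> 0" and u0: "?u v \<ge> 0" for v using p by (auto intro!: sum_nonneg)
  show "reward_rate K lam \<beta> \<alpha> m w (arrive w) \<ge> lam (snd w)"
    using d0[of "arrive w"] u0[of "arrive w"]
    by (subst reward_rate_eq[OF in_states]) (auto simp: moves_def simp del: One_nat_def)
  show "reward_rate K lam \<beta> \<alpha> m w (depart k w) \<ge> real (fst w k) / real m" if k: "k \<in> {1..K}"
  proof -
    have "(if depart k w = depart k w then real (fst w k) / real m else 0) \<le> ?d (depart k w)"
      by (rule member_le_sum[OF k]) auto
    moreover have "depart k w \<in> moves K w" using k by (auto simp: moves_def)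
    moreover have "(if depart k w = arrive w then lam (snd w) else 0) \<ge> 0" using l by simp
    ultimately show ?thesis using u0[of "depart k w"] by (subst reward_rate_eq[OF in_states]) simp_all
  qed
  show "reward_rate K lam \<beta> \<alpha> m w (fst w, k) \<ge> \<beta> * choice_prob K \<alpha> (fst w) k" if k: "k \<in> {1..K}"
  proof -
    have "(if (fst w, k) = (fst w, k) then \<beta> * choice_prob K \<alpha> (fst w) k else 0) \<le> ?u (fst w, k)"
      by (rule member_le_sum[OF k]) (use p in auto)
    moreover have "(fst w, k) \<in> moves K w" using k by (auto simp: moves_def)
    moreover have "(if (fst w, k) = arrive w then lam (snd w) else 0) \<ge> 0" using l by simp
    ultimately show ?thesis using d0[of "(fst w, k)"] k by (subst reward_rate_eq[OF in_states]) simp_all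
  qed
qed

lemma jump_arrive: "w \<in> states K \<Longrightarrow> jump w (arrive w)"
  using reward_rate_ge(1)[of w] lam[of "snd w"]
  by (cases w) (force simp: moves_def states_def arrive_def fun_eq_iff)

lemma jump_depart: "w \<in> states K \<Longrightarrow> k \<in> {1..K} \<Longrightarrow> fst w k > 0 \<Longrightarrow> jump w (depart k w)"
  using reward_rate_ge(2)[of w k] m
  by (cases w) (force simp: moves_def states_def depart_def fun_eq_iff intro: less_le_trans[rotated] divide_pos_pos)

lemma jumps_choice:
  assumes "(q, c) \<in> states K" "k \<in> {1..K}"
  shows "jump\<^sup>*\<^sup>* (q, c) (q, k)"
proof (cases "k = c")
  case False
  have "0 < \<beta> * choice_prob K \<alpha> q k" using \<beta> choice_prob_pos[OF \<alpha> K] by simp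
  then have "jump (q, c) (q, k)"
    using reward_rate_ge(3)[OF assms] assms(2) False by (auto simp: moves_def)
  then show ?thesis by blast
qed simp

lemma jumps_to_empty: "w \<in> states K \<Longrightarrow> jump\<^sup>*\<^sup>* w (\<lambda>_. 0, snd w)"
proof (induction "total_reward K w" arbitrary: w rule: less_induct)
  case less
  show ?case
  proof (cases "\<exists>k\<in>{1..K}. fst w k > 0")
    case True
    then obtain k where k: "k \<in> {1..K}" "fst w k > 0" by blast
    have j: "jump w (depart k w)" by (rule jump_depart[OF less.prems k])
    have "fst w k \<le> total_reward K w" unfolding total_reward_def by (rule member_le_sum[OF k(1)]) auto
    then have "total_reward K (depart k w) < total_reward K w" using k total_depart[OF k(1), of w] by simp
    moreover have "depart k w \<in> states K" using j moves_in_states[OF less.prems] by blast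
    ultimately have "jump\<^sup>*\<^sup>* (depart k w) (\<lambda>_. 0, snd (depart k w))" by (rule less.hyps)
    then show ?thesis using j by (auto simp: depart_def intro: converse_rtranclp_into_rtranclp)
  next
    case False
    then have "fst w = (\<lambda>_. 0)" using less.prems by (auto simp: states_def fun_eq_iff)
    then have "w = (\<lambda>_. 0, snd w)" by (simp add: prod_eq_iff)
    then show ?thesis by (metis rtranclp.rtrancl_refl)
  qed
qed

text \<open>
  The target is built backwards: the last unit of some action \<open>k\<close> is added while \<open>k\<close> is chosen, and
  finally the choice is set.
\<close>

lemma jumps_from_empty: "w \<in> states K \<Longrightarrow> c \<in> {1..K} \<Longrightarrow> jump\<^sup>*\<^sup>* (\<lambda>_. 0, c) w"
proof (induction "total_reward K w" arbitrary: w rule: less_induct)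
  case less
  obtain q d where w: "w = (q, d)" by (cases w)
  have d: "d \<in> {1..K}" using less.prems by (auto simp: w states_def)
  show ?case
  proof (cases "\<exists>k\<in>{1..K}. q k > 0")
    case True
    then obtain k where k: "k \<in> {1..K}" "q k > 0" by blast
    define v where "v = (q(k := q k - 1), k)"
    have v: "v \<in> states K" using less.prems k by (auto simp: v_def w states_def)
    have "total_reward K v < total_reward K w"
      using total_upd[OF k(1), of q "q k - 1" k d] k by (simp add: v_def w)
    then have "jump\<^sup>*\<^sup>* (\<lambda>_. 0, c) v" by (rule less.hyps) (fact v, fact less.prems(2))
    also have "jump v (arrive v)" by (rule jump_arrive[OF v])
    also have "arrive v = (q, k)" using k by (auto simp: v_def arrive_def)
    also have "jump\<^sup>*\<^sup>* (q, k) (q, d)"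
      using less.prems k by (intro jumps_choice d) (auto simp: w states_def)
    finally show ?thesis by (simp add: w)
  next
    case False
    then have "q = (\<lambda>_. 0)" using less.prems by (auto simp: w states_def fun_eq_iff)
    then show ?thesis unfolding w using less.prems d
      by (simp only:, intro jumps_choice) (auto simp: states_def)
  qed
qed

sublocale ergodic_semigroup "states K" law "reward_rate K lam \<beta> \<alpha> m" nbrs "lyap K"
  "(Lam + 1) * 2 ^ nat \<lceil>2 * real m * (Lam + 1)\<rceil>"
proof
  show "countable (states K)" by (rule countable_states)
  show "states K \<noteq> {}" using K by (auto simp: states_def)
  show "0 \<le> lyap K w" for w by (simp add: lyap_def)
  show "0 \<le> (Lam + 1) * 2 ^ nat \<lceil>2 * real m * (Lam + 1)\<rceil>" using Lam_pos by simp
  show "finite {w \<in> states K. lyap K w \<le> a}" for a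
  proof (rule finite_subset[OF _ finite_total_le[of K "nat \<lceil>a\<rceil>"]])
    have "total_reward K w \<le> nat \<lceil>a\<rceil>" if "lyap K w \<le> a" for w
    proof -
      have "real (total_reward K w) < 2 ^ total_reward K w" by (rule of_nat_less_two_power)
      then show ?thesis using that unfolding lyap_def by linarith
    qed
    then show "{w \<in> states K. lyap K w \<le> a} \<subseteq> {w \<in> states K. total_reward K w \<le> nat \<lceil>a\<rceil>}" by auto
  qed
  show "jump\<^sup>*\<^sup>* w v" if w: "w \<in> states K" and v: "v \<in> states K" for w v
    by (rule rtranclp_trans[OF jumps_to_empty[OF w] jumps_from_empty[OF v]]) (use w in \<open>auto simp: states_def\<close>)
qed (rule lyap_drift)

lemma stationary_iff_invariant: "stationary_distribution (states K) P W \<pi> \<longleftrightarrow> invariant \<pi>"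
  by (simp add: stationary_iff invariant_def)

lemma integrable_polynomial:
  assumes \<pi>: "invariant \<pi>" and f: "\<And>w. w \<in> states K \<Longrightarrow> \<bar>f w\<bar> \<le> L * (1 + real (total_reward K w)) ^ 3"
  shows "integrable (measure_pmf \<pi>) f"
proof (rule Bochner_Integration.integrable_bound)
  show "integrable (measure_pmf \<pi>) (\<lambda>w. \<bar>L\<bar> * 8 * lyap K w)" using integrable_lyapunov[OF \<pi>] by simp
  have "norm (f w) \<le> norm (\<bar>L\<bar> * 8 * lyap K w)" if w: "w \<in> states K" for w
  proof -
    have "\<bar>f w\<bar> \<le> L * (1 + real (total_reward K w)) ^ 3" by (rule f[OF w])
    also have "\<dots> \<le> \<bar>L\<bar> * (8 * 2 ^ total_reward K w)" by (intro mult_mono cube_le_exp) auto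
    finally show ?thesis by (simp add: lyap_def)
  qed
  then show "AE w in \<pi>. norm (f w) \<le> norm (\<bar>L\<bar> * 8 * lyap K w)"
    using \<pi> by (auto simp: invariant_def AE_measure_pmf_iff)
qed simp

lemma expectation_reward_gen:
  assumes \<pi>: "invariant \<pi>" and f: "\<And>w. w \<in> states K \<Longrightarrow> \<bar>f w\<bar> \<le> L * (1 + real (total_reward K w))\<^sup>2"
  shows "measure_pmf.expectation \<pi> (reward_gen K lam \<beta> \<alpha> m f) = 0"
proof -
  define R where "R = Lam + 1 + \<beta>"
  \<comment> \<open>a jump changes \<open>f\<close> by at most \<open>8 * \<bar>L\<bar> * (1 + n)\<^sup>2\<close>; the other factor \<open>8\<close> comes from \<open>cube_le_exp\<close>\<close>
  define A where "A = R * (8 + 64 * \<bar>L\<bar>)"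
  have R: "R > 0" using Lam_pos \<beta> by (simp add: R_def)
  have "measure_pmf.expectation \<pi> (gen f) = 0"
  proof (rule expectation_gen[OF \<pi>, where A = A])
    fix w assume w: "w \<in> states K"
    let ?n = "real (total_reward K w)"
    have "exit_rate w = (\<Sum>v\<in>nbrs w. reward_rate K lam \<beta> \<alpha> m w v * (if v = w then 0 else 1))"
      unfolding exit_rate_def by (intro sum.cong) auto
    also have "\<dots> \<le> R * (1 + ?n) * 1"
      unfolding R_def by (rule sum_rate_le[OF w]) auto
    also have "\<dots> \<le> R * (8 * lyap K w)"
    proof -
      have "1 + ?n \<le> (1 + ?n) ^ 3" by (rule self_le_power) auto
      also have "\<dots> \<le> 8 * lyap K w" unfolding lyap_def by (rule cube_le_exp)
      finally show ?thesis using R by simp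
    qed
    also have "\<dots> \<le> A * lyap K w"
      using R by (simp add: A_def lyap_def)
    finally show "exit_rate w \<le> A * lyap K w" .
    have "(\<Sum>v\<in>nbrs w. reward_rate K lam \<beta> \<alpha> m w v * \<bar>f v - f w\<bar>) \<le> R * (1 + ?n) * (8 * \<bar>L\<bar> * (1 + ?n)\<^sup>2)"
      unfolding R_def
    proof (rule sum_rate_le[OF w])
      fix v assume v: "v \<in> moves K w"
      have vS: "v \<in> states K" using moves_in_states[OF w] v by blast
      have "total_reward K v \<le> total_reward K w + 1"
        using v total_arrive[OF w] total_depart[of _ K w] by (auto simp: moves_def total_reward_def)
      then have "1 + real (total_reward K v) \<le> 2 * (1 + ?n)" by simp
      then have "(1 + real (total_reward K v))\<^sup>2 \<le> (2 * (1 + ?n))\<^sup>2" by (rule power_mono) simp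
      then have "(1 + real (total_reward K v))\<^sup>2 \<le> 4 * (1 + ?n)\<^sup>2" by (simp only: power_mult_distrib) simp
      then have "\<bar>L\<bar> * (1 + real (total_reward K v))\<^sup>2 \<le> \<bar>L\<bar> * (4 * (1 + ?n)\<^sup>2)"
        by (intro mult_left_mono) auto
      moreover have "L * (1 + real (total_reward K v))\<^sup>2 \<le> \<bar>L\<bar> * (1 + real (total_reward K v))\<^sup>2"
        "L * (1 + ?n)\<^sup>2 \<le> \<bar>L\<bar> * (1 + ?n)\<^sup>2" "0 \<le> \<bar>L\<bar> * (1 + ?n)\<^sup>2"
        by (auto intro: mult_right_mono)
      ultimately show "\<bar>f v - f w\<bar> \<le> 8 * \<bar>L\<bar> * (1 + ?n)\<^sup>2" using f[OF vS] f[OF w] by linarith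
    qed auto
    also have "\<dots> = R * (8 * \<bar>L\<bar>) * (1 + ?n) ^ 3" by (simp add: power2_eq_square power3_eq_cube)
    also have "\<dots> \<le> R * (8 * \<bar>L\<bar>) * (8 * lyap K w)"
      unfolding lyap_def using R by (intro mult_left_mono cube_le_exp) auto
    also have "\<dots> \<le> A * lyap K w" using R by (simp add: A_def lyap_def algebra_simps)
    finally show "(\<Sum>v\<in>nbrs w. reward_rate K lam \<beta> \<alpha> m w v * \<bar>f v - f w\<bar>) \<le> A * lyap K w" .
  qed
  moreover have "measure_pmf.expectation \<pi> (gen f) = measure_pmf.expectation \<pi> (reward_gen K lam \<beta> \<alpha> m f)"
    using \<pi> gen_eq by (intro integral_cong_AE) (auto simp: invariant_def AE_measure_pmf_iff)
  ultimately show ?thesis by simp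
qed

text \<open>
  The scaled reward is a function of the state, so its stationary law is the image of \<open>\<pi>\<close>.
\<close>

lemma steady_state_iff:
  assumes \<pi>: "invariant \<pi>"
  shows "steady_state_distribution K m P W \<mu> \<longleftrightarrow>
    \<mu> = map_pmf (\<lambda>w k. real (fst w k) / real m) \<pi>"
proof -
  let ?h = "\<lambda>w k. real (fst w k) / real m"
  have uniq: "stationary_distribution (states K) P W \<sigma> \<longleftrightarrow> \<sigma> = \<pi>" for \<sigma>
    using unique_invariant \<pi> by (auto simp: stationary_iff_invariant)
  have "prob_from \<pi> P (scaled_reward m W t) x = pmf (map_pmf ?h \<pi>) x" if "t \<ge> 0" for t x
  proof -
    have "prob_from \<pi> P (\<lambda>\<omega>. ?h (W (real m * t) \<omega>)) x = pmf (map_pmf ?h (bind_pmf \<pi> (law (real m * t)))) x"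
      by (rule prob_from_function) (use \<pi> that in \<open>auto simp: invariant_def\<close>)
    also have "bind_pmf \<pi> (law (real m * t)) = \<pi>" using \<pi> that by (simp add: invariant_def)
    finally show ?thesis by (simp add: scaled_reward_def[abs_def])
  qed
  then show ?thesis unfolding steady_state_distribution_def uniq 
    using pmf_eqI[of \<mu> "map_pmf ?h \<pi>"] by (auto dest: spec[of _ 0])
qed

end

section \<open>Test functions in equilibrium\<close>

definition scaled :: "nat \<Rightarrow> nat \<Rightarrow> state \<Rightarrow> real" where
  "scaled m k w = real (fst w k) / real m"

definition active :: "nat \<Rightarrow> state \<Rightarrow> real" where
  "active k w = (if snd w = k then 1 else 0)"

definition weight :: "nat \<Rightarrow> real \<Rightarrow> nat \<Rightarrow> state \<Rightarrow> real" where
  "weight m a k w = max (scaled m k w) a"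

definition mass :: "nat \<Rightarrow> nat \<Rightarrow> real \<Rightarrow> state \<Rightarrow> real" where
  "mass K m a w = (\<Sum>k\<in>{1..K}. weight m a k w)"

definition share :: "nat \<Rightarrow> nat \<Rightarrow> real \<Rightarrow> nat \<Rightarrow> state \<Rightarrow> real" where
  "share K m a k w = weight m a k w / mass K m a w"

text \<open>
  With \<open>x\<close> the scaled reward of the action this is \<open>max 0 (x - a) / max x a\<close>: a bounded measure of how
  far \<open>x\<close> lies above the threshold.
\<close>

definition excess :: "nat \<Rightarrow> real \<Rightarrow> nat \<Rightarrow> state \<Rightarrow> real" where
  "excess m a k w = 1 - a / weight m a k w"

text \<open>
  The value of \<open>mass\<close> when the scaled reward of \<open>k\<close> is \<open>lam k\<close> and all others are \<open>0\<close>, as it is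
  between rare updates.
\<close>

definition inert_weight :: "nat \<Rightarrow> (nat \<Rightarrow> real) \<Rightarrow> real \<Rightarrow> nat \<Rightarrow> real" where
  "inert_weight K lam a k = max (lam k) a + (real K - 1) * a"

text \<open>
  A convex function with Lipschitz derivative \<open>huber'\<close> that approximates the positive part up to
  \<open>e / 2\<close>.  The smoothing is essential where it is used as a Lyapunov function: at a kink the effects
  of upward and downward jumps would not match.
\<close>

definition huber :: "real \<Rightarrow> real \<Rightarrow> real" where
  "huber e y = (if y \<le> 0 then 0 else if y \<le> e then y\<^sup>2 / (2 * e) else y - e / 2)"

definition huber' :: "real \<Rightarrow> real \<Rightarrow> real" where
  "huber' e y = min 1 (max 0 (y / e))"

lemma huber'_bounds: "0 \<le> huber' e y" "huber' e y \<le> 1"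
  by (auto simp: huber'_def)

lemma huber'_eq_0: "e > 0 \<Longrightarrow> y \<le> 0 \<Longrightarrow> huber' e y = 0"
  by (simp add: huber'_def divide_le_0_iff)

lemma huber'_eq_1: "e > 0 \<Longrightarrow> y \<ge> e \<Longrightarrow> huber' e y = 1"
  by (simp add: huber'_def)

lemma huber'_lipschitz:
  assumes "e > 0"
  shows "\<bar>huber' e y - huber' e z\<bar> \<le> \<bar>y - z\<bar> / e"
proof -
  have "\<bar>huber' e y - huber' e z\<bar> \<le> \<bar>y / e - z / e\<bar>" unfolding huber'_def by linarith
  also have "\<dots> = \<bar>y - z\<bar> / e" using assms by (simp add: diff_divide_distrib[symmetric])
  finally show ?thesis .
qed

lemma huber_convex:
  assumes e: "e > 0"
  shows "huber e y + huber' e y * (z - y) \<le> huber e z"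
proof -
  have sq: "y\<^sup>2 / (2 * e) + y / e * (z - y) \<le> z\<^sup>2 / (2 * e)" for y z
  proof -
    have "z\<^sup>2 / (2 * e) - (y\<^sup>2 / (2 * e) + y / e * (z - y)) = (z - y)\<^sup>2 / (2 * e)"
      using e by (simp add: field_simps power2_eq_square)
    moreover have "(z - y)\<^sup>2 / (2 * e) \<ge> 0" using e by simp
    ultimately show ?thesis by linarith
  qed
  have lin: "z - e / 2 \<le> z\<^sup>2 / (2 * e)" for z
    using sq[of e z] e by (simp add: power2_eq_square field_simps)
  have nn: "z\<^sup>2 / (2 * e) \<ge> 0" for z using e by simp
  consider "y \<le> 0" | "0 < y" "y \<le> e" | "e < y" by linarith
  then show ?thesis
  proof cases
    case 1
    then have "huber e y = 0" "huber' e y = 0" using e by (auto simp: huber_def huber'_eq_0)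
    moreover have "huber e z \<ge> 0" using e nn by (auto simp: huber_def)
    ultimately show ?thesis by simp
  next
    case 2
    have h: "huber e y = y\<^sup>2 / (2 * e)" "huber' e y = y / e" using 2 e by (auto simp: huber_def huber'_def)
    consider "z \<le> 0" | "0 < z" "z \<le> e" | "e < z" by linarith
    then show ?thesis
    proof cases
      case 1
      have "y / e * (z - y) \<le> y / e * (- y)" using 1 2 e by (intro mult_left_mono) auto
      also have "\<dots> \<le> - (y\<^sup>2 / (2 * e))" using 2 e by (simp add: power2_eq_square field_simps)
      finally show ?thesis using 1 h by (simp add: huber_def)
    next
      case 2
      then show ?thesis using sq[of y z] h by (simp add: huber_def)
    next
      case 3
      have "y\<^sup>2 / (2 * e) + y / e * (e - y) \<le> e\<^sup>2 / (2 * e)" by (rule sq)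
      moreover have "y / e * (z - e) \<le> 1 * (z - e)" using 2 3 e by (intro mult_right_mono) auto
      moreover have "e\<^sup>2 / (2 * e) = e / 2" using e by (simp add: power2_eq_square)
      moreover have "y / e * (z - y) = y / e * (e - y) + y / e * (z - e)" 
        using distrib_left[of "y / e" "e - y" "z - e"] by simp
      ultimately show ?thesis using 3 e h by (simp add: huber_def)
    qed
  next
    case 3
    then have h: "huber e y = y - e / 2" "huber' e y = 1" using e by (auto simp: huber_def huber'_def)
    show ?thesis unfolding h using lin[of z] e by (auto simp: huber_def)
  qed
qed

lemma huber_bounds:
  assumes "e > 0"
  shows "0 \<le> huber e y" "huber e y \<le> max 0 y" "max 0 y - e / 2 \<le> huber e y"
proof -
  show "0 \<le> huber e y" using assms by (auto simp: huber_def)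
  have "y\<^sup>2 / (2 * e) \<le> y" if "0 < y" "y \<le> e"
  proof -
    have "y * y \<le> y * (2 * e)" using that by (intro mult_left_mono) auto
    then show ?thesis using assms by (simp add: power2_eq_square divide_le_eq)
  qed
  then show "huber e y \<le> max 0 y" using assms by (auto simp: huber_def)
  show "max 0 y - e / 2 \<le> huber e y"
    using huber_convex[OF assms, of e y] huber_convex[OF assms, of 0 y] assms
    by (auto simp: huber'_def huber_def[of e e] huber_def[of e 0] power2_eq_square)
qed

text \<open>
  Of the stationary distribution \<open>\<pi>\<close> only the integrability of cubic functions and the balance
  equation for quadratic ones are used.  The threshold is \<open>a\<close> in the scaled variables.
\<close>

locale stationary_reward =
  fixes K m :: nat and lam :: "nat \<Rightarrow> real" and \<beta> a :: real and \<pi> :: "state pmf"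
  assumes K: "K \<ge> 1" and lam: "\<And>k. k \<in> {1..K} \<Longrightarrow> lam k > 0" and m: "m \<ge> 1"
    and a: "a > 0" and \<beta>: "\<beta> > 0"
    and supp: "set_pmf \<pi> \<subseteq> states K"
    and polynomial: "\<And>f L. (\<And>w. w \<in> states K \<Longrightarrow> \<bar>f w\<bar> \<le> L * (1 + real (total_reward K w)) ^ 3) \<Longrightarrow>
      integrable (measure_pmf \<pi>) f"
    and balance: "\<And>f L. (\<And>w. w \<in> states K \<Longrightarrow> \<bar>f w\<bar> \<le> L * (1 + real (total_reward K w))\<^sup>2) \<Longrightarrow>
      measure_pmf.expectation \<pi> (reward_gen K lam \<beta> (a * real m) m f) = 0"
begin

abbreviation x :: "nat \<Rightarrow> state \<Rightarrow> real" where "x \<equiv> scaled m"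
abbreviation u :: "nat \<Rightarrow> state \<Rightarrow> real" where "u \<equiv> weight m a"
abbreviation D :: "state \<Rightarrow> real" where "D \<equiv> mass K m a"
abbreviation pr :: "nat \<Rightarrow> state \<Rightarrow> real" where "pr \<equiv> share K m a"
abbreviation s :: "nat \<Rightarrow> state \<Rightarrow> real" where "s \<equiv> excess m a"
abbreviation wt :: "nat \<Rightarrow> real" where "wt \<equiv> inert_weight K lam a"
abbreviation E :: "(state \<Rightarrow> real) \<Rightarrow> real" where "E f \<equiv> measure_pmf.expectation \<pi> f"
abbreviation b :: real where "b \<equiv> real m * \<beta>"
abbreviation Lam :: real where "Lam \<equiv> \<Sum>k\<in>{1..K}. lam k"

lemma b_pos: "b > 0" using m \<beta> by simp

lemma x_nonneg: "x k w \<ge> 0" by (simp add: scaled_def)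

lemma u_ge: "u k w \<ge> a" "u k w \<ge> x k w" by (auto simp: weight_def)

lemma u_pos: "u k w > 0" using u_ge(1)[of k w] a by linarith

lemma D_ge: "D w \<ge> real K * a"
proof -
  have "(\<Sum>k\<in>{1..K}. a) \<le> D w" unfolding mass_def by (intro sum_mono u_ge)
  then show ?thesis by simp
qed

lemma Ka_pos: "real K * a > 0" using K a by simp

lemma D_pos: "D w > 0" using D_ge[of w] Ka_pos by linarith

lemma u_le_D: "k \<in> {1..K} \<Longrightarrow> u k w \<le> D w"
  unfolding mass_def by (intro member_le_sum) (simp_all add: u_pos less_imp_le)

lemma pr_nonneg: "pr k w \<ge> 0"
  unfolding share_def using u_pos[of k w] D_pos[of w] by simp

lemma pr_le_1: "k \<in> {1..K} \<Longrightarrow> pr k w \<le> 1"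
  unfolding share_def using u_le_D[of k w] D_pos[of w] by simp

lemma sum_pr: "(\<Sum>k\<in>{1..K}. pr k w) = 1"
  unfolding share_def sum_divide_distrib[symmetric] using D_pos[of w] by (simp add: mass_def)

lemma choice_prob_eq: "choice_prob K (a * real m) (fst w) k = pr k w"
proof -
  have "max (real (fst w k)) (a * real m) = real m * u k w" for k
    using m by (auto simp: weight_def scaled_def max_def field_simps)
  then show ?thesis
    using m by (simp add: choice_prob_def share_def mass_def sum_distrib_left[symmetric])
qed

lemma sum_x: "(\<Sum>k\<in>{1..K}. x k w) = real (total_reward K w) / real m"
  by (simp add: scaled_def total_reward_def sum_divide_distrib)

lemma sum_x_le: "(\<Sum>k\<in>{1..K}. x k w) \<le> real (total_reward K w)"
proof -
  have "real (total_reward K w) * 1 \<le> real (total_reward K w) * real m" using m by (intro mult_left_mono) auto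
  then show ?thesis unfolding sum_x using m by (simp add: pos_divide_le_eq)
qed

lemma x_le: "k \<in> {1..K} \<Longrightarrow> x k w \<le> real (total_reward K w)"
  using member_le_sum[of k "{1..K}" "\<lambda>k. x k w"] sum_x_le[of w] x_nonneg by fastforce

lemma power_growth:
  fixes t :: nat
  shows "real t \<le> (1 + real t)\<^sup>2" "1 \<le> (1 + real t)\<^sup>2" "(real t)\<^sup>2 \<le> (1 + real t)\<^sup>2"
    "(1 + real t)\<^sup>2 \<le> (1 + real t) ^ 3"
proof -
  show "real t \<le> (1 + real t)\<^sup>2" "1 \<le> (1 + real t)\<^sup>2" "(real t)\<^sup>2 \<le> (1 + real t)\<^sup>2"
    by (auto simp: power2_eq_square algebra_simps)
  show "(1 + real t)\<^sup>2 \<le> (1 + real t) ^ 3" by (rule power_increasing) auto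
qed

lemma integrable_2:
  assumes "\<And>w. w \<in> states K \<Longrightarrow> \<bar>f w\<bar> \<le> (1 + real (total_reward K w))\<^sup>2"
  shows "integrable (measure_pmf \<pi>) f"
proof (rule polynomial[of _ 1])
  fix w assume "w \<in> states K"
  then show "\<bar>f w\<bar> \<le> 1 * (1 + real (total_reward K w)) ^ 3"
    using assms[of w] power_growth(4)[of "total_reward K w"] by simp
qed

lemma integrable_x: "k \<in> {1..K} \<Longrightarrow> integrable (measure_pmf \<pi>) (x k)"
  using x_le x_nonneg power_growth(1) by (intro integrable_2) (simp, blast intro: order_trans)

lemma integrable_x2: "k \<in> {1..K} \<Longrightarrow> integrable (measure_pmf \<pi>) (\<lambda>w. (x k w)\<^sup>2)"
proof (rule integrable_2)
  fix w assume "k \<in> {1..K}"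
  then have "(x k w)\<^sup>2 \<le> (real (total_reward K w))\<^sup>2" by (intro power_mono x_le x_nonneg)
  then show "\<bar>(x k w)\<^sup>2\<bar> \<le> (1 + real (total_reward K w))\<^sup>2" using power_growth(3)[of "total_reward K w"] by (simp only: abs_power2)
qed

lemma integrable_mult_bounded:
  fixes f g :: "state \<Rightarrow> real"
  assumes "integrable (measure_pmf \<pi>) f" "\<And>w. \<bar>g w\<bar> \<le> B"
  shows "integrable (measure_pmf \<pi>) (\<lambda>w. f w * g w)"
proof (rule Bochner_Integration.integrable_bound)
  show "integrable (measure_pmf \<pi>) (\<lambda>w. B * \<bar>f w\<bar>)" using assms(1) by simp
  have B: "B \<ge> 0" using assms(2)[of undefined] by linarith
  have "norm (f w * g w) \<le> norm (B * \<bar>f w\<bar>)" for w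
    using mult_right_mono[OF assms(2)[of w] abs_ge_zero[of "f w"]] B by (simp add: abs_mult mult.commute)
  then show "AE w in \<pi>. norm (f w * g w) \<le> norm (B * \<bar>f w\<bar>)" by simp
qed simp

lemma active_bounds: "0 \<le> active k w" "active k w \<le> 1" "\<bar>active k w\<bar> \<le> 1"
  by (auto simp: active_def)

lemma abs_pr: "k \<in> {1..K} \<Longrightarrow> \<bar>pr k w\<bar> \<le> 1"
  using pr_nonneg[of k w] pr_le_1[of k w] by simp

lemma integrable_active: "integrable (measure_pmf \<pi>) (active k)"
  by (rule integrable_pmf_bounded[OF active_bounds(3)])

lemma integrable_pr: "k \<in> {1..K} \<Longrightarrow> integrable (measure_pmf \<pi>) (pr k)"
  by (rule integrable_pmf_bounded[OF abs_pr])

lemma integrable_active_x: "k \<in> {1..K} \<Longrightarrow> integrable (measure_pmf \<pi>) (\<lambda>w. active k w * x k w)"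
  by (subst mult.commute, rule integrable_mult_bounded[OF integrable_x active_bounds(3)])

lemma integrable_pr_x: "k \<in> {1..K} \<Longrightarrow> integrable (measure_pmf \<pi>) (\<lambda>w. pr k w * x k w)"
  by (subst mult.commute, rule integrable_mult_bounded[OF integrable_x abs_pr])

lemma E_cong:
  assumes "\<And>w. w \<in> states K \<Longrightarrow> f w = g w"
  shows "E f = E g"
  using assms supp by (intro integral_cong_AE) (auto simp: AE_measure_pmf_iff)

lemma E_mono:
  assumes "integrable (measure_pmf \<pi>) f" "integrable (measure_pmf \<pi>) g" "\<And>w. w \<in> states K \<Longrightarrow> f w \<le> g w"
  shows "E f \<le> E g"
  using assms supp by (intro integral_mono_AE) (auto simp: AE_measure_pmf_iff)

lemma snd_in: "w \<in> states K \<Longrightarrow> snd w \<in> {1..K}" by (auto simp: states_def)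

lemma x_arrive: "x k (arrive w) = x k w + active k w / real m"
  using m by (auto simp: scaled_def arrive_def active_def add_divide_distrib)

lemma x_depart: "fst w j > 0 \<Longrightarrow> x k (depart j w) = x k w - (if k = j then 1 / real m else 0)"
  using m by (auto simp: scaled_def depart_def of_nat_diff diff_divide_distrib Suc_leI)

lemma snd_moves [simp]: "snd (arrive w) = snd w" "snd (depart j w) = snd w"
  by (auto simp: arrive_def depart_def)

lemma active_moves [simp]: "active k (arrive w) = active k w" "active k (depart j w) = active k w"
  by (auto simp: active_def arrive_def depart_def)

definition scaled_gen :: "(state \<Rightarrow> real) \<Rightarrow> state \<Rightarrow> real" where
  "scaled_gen f w = real m * lam (snd w) * (f (arrive w) - f w) +
     (\<Sum>j\<in>{1..K}. real (fst w j) * (f (depart j w) - f w)) +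
     b * (\<Sum>c\<in>{1..K}. pr c w * (f (fst w, c) - f w))"

text \<open>
  The balance equation with time scaled by \<open>m\<close>.  Jumps of the scaled reward have size \<open>1 / m\<close> and
  rates of order \<open>m\<close>, whereas updates occur at rate \<open>b\<close>.
\<close>

lemma scaled_balance:
  assumes "\<And>w. w \<in> states K \<Longrightarrow> \<bar>f w\<bar> \<le> L * (1 + real (total_reward K w))\<^sup>2"
  shows "E (scaled_gen f) = 0"
proof -
  have "E (\<lambda>w. real m * reward_gen K lam \<beta> (a * real m) m f w) = 0"
    using balance[OF assms] by simp
  also have "(\<lambda>w. real m * reward_gen K lam \<beta> (a * real m) m f w) = scaled_gen f"
    unfolding scaled_gen_def reward_gen_def choice_prob_eq distrib_left sum_distrib_left
    using m by (intro ext arg_cong2[where f = "(+)"] sum.cong) (auto simp: field_simps)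
  finally show ?thesis .
qed

text \<open>
  Only updates change the choice, so the balance equation for \<open>active k\<close> compares its mean before
  and after an update.
\<close>

lemma mean_active:
  assumes k: "k \<in> {1..K}"
  shows "E (active k) = E (pr k)"
proof -
  have "(\<Sum>c\<in>{1..K}. pr c w * (active k (fst w, c) - active k w)) = pr k w - active k w" for w
  proof -
    have "(\<Sum>c\<in>{1..K}. pr c w * (active k (fst w, c) - active k w)) =
        (\<Sum>c\<in>{1..K}. if c = k then pr c w else 0) - active k w * (\<Sum>c\<in>{1..K}. pr c w)"
      unfolding sum_distrib_left sum_subtractf[symmetric]
      by (intro sum.cong) (auto simp: active_def algebra_simps)
    then show ?thesis using k by (simp add: sum_pr del: One_nat_def)
  qed
  moreover have "\<bar>active k w\<bar> \<le> 1 * (1 + real (total_reward K w))\<^sup>2" for w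
    using order_trans[OF active_bounds(3)[of k w] power_growth(2)[of "total_reward K w"]] by simp
  ultimately have "E (\<lambda>w. b * (pr k w - active k w)) = 0"
    using scaled_balance[of "active k" 1] by (simp add: scaled_gen_def[abs_def])
  then show ?thesis using m \<beta> integrable_pr[OF k] integrable_active[of k] by simp
qed

lemma mean_x:
  assumes k: "k \<in> {1..K}"
  shows "E (x k) = lam k * E (active k)"
proof -
  have "E (\<lambda>w. lam k * active k w - x k w) = E (scaled_gen (x k))"
  proof (rule E_cong)
    fix w
    have "real (fst w j) * (x k (depart j w) - x k w) = (if j = k then - x k w else 0)" for j
    proof (cases "fst w j = 0")
      case False
      then show ?thesis by (auto simp: x_depart) (simp add: scaled_def)
    qed (auto simp: scaled_def)
    then have "(\<Sum>j\<in>{1..K}. real (fst w j) * (x k (depart j w) - x k w)) = - x k w"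
      using k by (simp del: One_nat_def)
    moreover have "real m * lam (snd w) * (x k (arrive w) - x k w) = lam k * active k w"
      using m by (simp add: x_arrive active_def)
    ultimately show "lam k * active k w - x k w = scaled_gen (x k) w"
      by (simp add: scaled_gen_def scaled_def)
  qed
  also have "\<dots> = 0"
  proof (rule scaled_balance[of _ 1])
    show "\<bar>x k w\<bar> \<le> 1 * (1 + real (total_reward K w))\<^sup>2" for w
      using x_le[OF k, of w] x_nonneg[of k w] power_growth(1)[of "total_reward K w"] by simp
  qed
  finally show ?thesis using integrable_x[OF k] integrable_active[of k] by simp
qed

lemma mean_active_le_1: "E (active k) \<le> 1"
  using active_bounds[of k]
  by (auto intro!: measure_pmf.integral_le_const integrable_active)

lemma mean_x_le: "k \<in> {1..K} \<Longrightarrow> E (x k) \<le> lam k"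
  using mean_x[of k] mean_active_le_1[of k] lam[of k] mult_left_mono[of "E (active k)" 1 "lam k"] by simp

lemma sum_mean_active: "(\<Sum>k\<in>{1..K}. E (active k)) = 1"
proof -
  have "(\<Sum>k\<in>{1..K}. E (active k)) = (\<Sum>k\<in>{1..K}. E (pr k))" using mean_active by (rule sum.cong[OF refl])
  also have "\<dots> = E (\<lambda>w. \<Sum>k\<in>{1..K}. pr k w)" by (subst Bochner_Integration.integral_sum) (auto intro: integrable_pr)
  also have "\<dots> = 1" unfolding sum_pr by simp
  finally show ?thesis .
qed

lemma second_moment:
  assumes k: "k \<in> {1..K}"
  shows "E (\<lambda>w. (x k w)\<^sup>2) = lam k * E (\<lambda>w. active k w * x k w) + E (x k) / real m"
proof -
  let ?f = "\<lambda>w. (x k w)\<^sup>2"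
  have "E (\<lambda>w. 2 * lam k * (active k w * x k w) + lam k / real m * active k w - 2 * (x k w)\<^sup>2 + x k w / real m) = E (scaled_gen ?f)"
  proof (rule E_cong)
    fix w
    have "real (fst w j) * (?f (depart j w) - ?f w) = (if j = k then - 2 * (x k w)\<^sup>2 + x k w / real m else 0)" for j
    proof (cases "fst w j = 0")
      case False
      have "real (fst w k) = real m * x k w" using m by (simp add: scaled_def)
      then show ?thesis using False m by (simp add: x_depart) (simp add: power2_eq_square field_simps)
    qed (auto simp: scaled_def)
    then have "(\<Sum>j\<in>{1..K}. real (fst w j) * (?f (depart j w) - ?f w)) = - 2 * (x k w)\<^sup>2 + x k w / real m"
      using k by (simp del: One_nat_def)
    moreover have "real m * lam (snd w) * (?f (arrive w) - ?f w) =
        2 * lam k * (active k w * x k w) + lam k / real m * active k w"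
      using m by (simp add: x_arrive active_def power2_eq_square field_simps)
    moreover have "x k (fst w, c) = x k w" for c by (simp add: scaled_def)
    ultimately show "2 * lam k * (active k w * x k w) + lam k / real m * active k w - 2 * (x k w)\<^sup>2 + x k w / real m = scaled_gen ?f w"
      by (simp add: scaled_gen_def)
  qed
  also have "\<dots> = 0"
  proof (rule scaled_balance[of _ 1])
    fix w
    have "(x k w)\<^sup>2 \<le> (real (total_reward K w))\<^sup>2" by (intro power_mono x_le k x_nonneg)
    then show "\<bar>(x k w)\<^sup>2\<bar> \<le> 1 * (1 + real (total_reward K w))\<^sup>2" using power_growth(3)[of "total_reward K w"] by (simp only: abs_power2 mult_1)
  qed
  finally have "2 * lam k * E (\<lambda>w. active k w * x k w) + lam k / real m * E (active k)
      - 2 * E (\<lambda>w. (x k w)\<^sup>2) + E (x k) / real m = 0"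
    using integrable_x[OF k] integrable_active[of k] integrable_active_x[OF k] integrable_x2[OF k] by simp
  moreover have "E (x k) / real m = lam k / real m * E (active k)" by (simp add: mean_x[OF k])
  ultimately show ?thesis by linarith
qed

text \<open>
  Were there no updates, the balance equation for \<open>active k * x k\<close> would make the right-hand side zero:
  given the choice \<open>k\<close>, the mean of \<open>x k\<close> would be \<open>lam k\<close>.
\<close>

lemma correlation:
  assumes k: "k \<in> {1..K}"
  shows "lam k * E (active k) - E (\<lambda>w. active k w * x k w) =
    b * (E (\<lambda>w. active k w * x k w) - E (\<lambda>w. pr k w * x k w))"
proof -
  let ?f = "\<lambda>w. active k w * x k w"
  have "E (\<lambda>w. lam k * active k w - ?f w + b * (pr k w * x k w - ?f w)) = E (scaled_gen ?f)"
  proof (rule E_cong)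
    fix w
    have "real (fst w j) * (?f (depart j w) - ?f w) = (if j = k then - ?f w else 0)" for j
    proof (cases "fst w j = 0")
      case False
      then show ?thesis by (auto simp: x_depart algebra_simps) (simp add: scaled_def)
    qed (auto simp: scaled_def)
    then have 1: "(\<Sum>j\<in>{1..K}. real (fst w j) * (?f (depart j w) - ?f w)) = - ?f w"
      using k by (simp del: One_nat_def)
    have 2: "real m * lam (snd w) * (?f (arrive w) - ?f w) = lam k * active k w"
      using m by (simp add: x_arrive active_def)
    have "(\<Sum>c\<in>{1..K}. pr c w * (?f (fst w, c) - ?f w)) =
        (\<Sum>c\<in>{1..K}. if c = k then pr c w * x k w else 0) - ?f w * (\<Sum>c\<in>{1..K}. pr c w)"
      unfolding sum_distrib_left sum_subtractf[symmetric]
      by (intro sum.cong) (auto simp: active_def scaled_def algebra_simps)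
    then have 3: "(\<Sum>c\<in>{1..K}. pr c w * (?f (fst w, c) - ?f w)) = pr k w * x k w - ?f w"
      using k by (simp add: sum_pr del: One_nat_def)
    show "lam k * active k w - ?f w + b * (pr k w * x k w - ?f w) = scaled_gen ?f w"
      unfolding scaled_gen_def 1 2 3 by simp
  qed
  also have "\<dots> = 0"
  proof (rule scaled_balance[of _ 1])
    fix w
    show "\<bar>?f w\<bar> \<le> 1 * (1 + real (total_reward K w))\<^sup>2"
      using x_le[OF k, of w] x_nonneg[of k w] power_growth(1,2)[of "total_reward K w"] by (auto simp: active_def)
  qed
  finally show ?thesis
    using integrable_active[of k] integrable_active_x[OF k] integrable_pr_x[OF k]
    by (simp add: algebra_simps)
qed

text \<open>
  Expanding the square and inserting \<open>second_moment\<close> leaves \<open>lam k\<close> times the left-hand side of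
  \<open>correlation\<close>, which is of order \<open>b\<close>, and a variance of order \<open>1 / m\<close>.
\<close>

lemma square_deviation:
  assumes k: "k \<in> {1..K}"
  shows "E (\<lambda>w. (x k w - lam k * active k w)\<^sup>2) \<le> (lam k)\<^sup>2 * b + lam k / real m"
proof -
  have l: "lam k > 0" by (rule lam[OF k])
  have "E (\<lambda>w. (x k w - lam k * active k w)\<^sup>2) =
      E (\<lambda>w. (x k w)\<^sup>2 - 2 * lam k * (active k w * x k w) + (lam k)\<^sup>2 * active k w)"
    by (intro Bochner_Integration.integral_cong refl) (auto simp: active_def power2_eq_square algebra_simps)
  also have "\<dots> = E (\<lambda>w. (x k w)\<^sup>2) - 2 * lam k * E (\<lambda>w. active k w * x k w) + (lam k)\<^sup>2 * E (active k)"
    using integrable_x2[OF k] integrable_active[of k] integrable_active_x[OF k] by simp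
  also have "\<dots> = lam k * (lam k * E (active k) - E (\<lambda>w. active k w * x k w)) + E (x k) / real m"
    unfolding second_moment[OF k] by (simp add: power2_eq_square algebra_simps)
  also have "\<dots> \<le> lam k * (b * lam k) + lam k / real m"
  proof (intro add_mono mult_left_mono divide_right_mono mean_x_le k)
    have "E (\<lambda>w. active k w * x k w) \<le> E (x k)"
      using x_nonneg[of k] by (intro E_mono integrable_x integrable_active_x k) (auto simp: active_def)
    moreover have "E (\<lambda>w. pr k w * x k w) \<ge> 0"
      using x_nonneg[of k] pr_nonneg[of k] by (intro integral_nonneg_AE) auto
    ultimately have "E (\<lambda>w. active k w * x k w) - E (\<lambda>w. pr k w * x k w) \<le> lam k"
      using mean_x_le[OF k] by linarith
    then show "lam k * E (active k) - E (\<lambda>w. active k w * x k w) \<le> b * lam k"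
      unfolding correlation[OF k] using b_pos by (intro mult_left_mono) auto
  qed (use l in auto)
  finally show ?thesis by (simp add: power2_eq_square mult_ac)
qed

lemma abs_deviation:
  assumes k: "k \<in> {1..K}"
  shows "E (\<lambda>w. \<bar>x k w - lam k * active k w\<bar>) \<le> sqrt ((lam k)\<^sup>2 * b + lam k / real m)"
proof -
  let ?y = "\<lambda>w. \<bar>x k w - lam k * active k w\<bar>"
  have iy: "integrable (measure_pmf \<pi>) ?y" using integrable_x[OF k] integrable_active[of k] by simp
  have "integrable (measure_pmf \<pi>) (\<lambda>w. (x k w)\<^sup>2 - 2 * lam k * (active k w * x k w) + (lam k)\<^sup>2 * active k w)"
    using integrable_x2[OF k] integrable_active[of k] integrable_active_x[OF k] by simp
  also have "(\<lambda>w. (x k w)\<^sup>2 - 2 * lam k * (active k w * x k w) + (lam k)\<^sup>2 * active k w) = (\<lambda>w. (?y w)\<^sup>2)"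
    by (auto simp: fun_eq_iff active_def power2_eq_square algebra_simps)
  finally have iy2: "integrable (measure_pmf \<pi>) (\<lambda>w. (?y w)\<^sup>2)" .
  define e where "e = E ?y"
  have "0 \<le> E (\<lambda>w. (?y w - e)\<^sup>2)" by (intro integral_nonneg_AE) auto
  also have "\<dots> = E (\<lambda>w. (?y w)\<^sup>2 - 2 * e * ?y w + e\<^sup>2)"
    by (intro Bochner_Integration.integral_cong refl) (auto simp: power2_eq_square algebra_simps)
  also have "\<dots> = E (\<lambda>w. (?y w)\<^sup>2) - e\<^sup>2"
    using iy iy2 by (simp add: e_def power2_eq_square del: power2_abs)
  finally have "e\<^sup>2 \<le> (lam k)\<^sup>2 * b + lam k / real m" using square_deviation[OF k] by simp
  then show ?thesis unfolding e_def by (rule real_le_rsqrt)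
qed

text \<open>
  In the balance equation for \<open>active k * g\<close> the updates contribute \<open>b * (pr k - active k) * g\<close>, while
  the arrivals and departures, which change \<open>g\<close> by at most \<open>L / m\<close> at rates of order \<open>m\<close>, contribute a
  bounded amount.  Dividing by \<open>b\<close> gives the bound.
\<close>

lemma averaging:
  assumes k: "k \<in> {1..K}" and L: "L \<ge> 0"
    and bnd: "\<And>q. \<bar>g q\<bar> \<le> B"
    and lip: "\<And>q j. j \<in> {1..K} \<Longrightarrow> \<bar>g (q(j := q j + 1)) - g q\<bar> \<le> L / real m"
  shows "\<bar>E (\<lambda>w. (active k w - pr k w) * g (fst w))\<bar> \<le> 2 * L * Lam / b"
proof -
  \<comment> \<open>the contribution of arrivals and departures to the generator at \<open>g\<close>\<close>
  define h where "h w = real m * lam (snd w) * (g (fst (arrive w)) - g (fst w)) +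
      (\<Sum>j\<in>{1..K}. real (fst w j) * (g (fst (depart j w)) - g (fst w)))" for w
  let ?f = "\<lambda>w. active k w * g (fst w)"
  have B: "B \<ge> 0" using bnd[of undefined] by linarith
  have "E (\<lambda>w. active k w * h w - b * ((active k w - pr k w) * g (fst w))) = E (scaled_gen ?f)"
  proof (rule E_cong)
    fix w
    have "(\<Sum>c\<in>{1..K}. pr c w * (?f (fst w, c) - ?f w)) =
        (\<Sum>c\<in>{1..K}. if c = k then pr c w * g (fst w) else 0) - ?f w * (\<Sum>c\<in>{1..K}. pr c w)"
      unfolding sum_distrib_left sum_subtractf[symmetric]
      by (intro sum.cong) (auto simp: active_def algebra_simps)
    then have 1: "(\<Sum>c\<in>{1..K}. pr c w * (?f (fst w, c) - ?f w)) = pr k w * g (fst w) - ?f w"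
      using k by (simp add: sum_pr del: One_nat_def)
    show "active k w * h w - b * ((active k w - pr k w) * g (fst w)) = scaled_gen ?f w"
      unfolding scaled_gen_def 1 by (simp add: h_def active_def left_diff_distrib right_diff_distrib)
  qed
  also have "\<dots> = 0"
  proof (rule scaled_balance[of _ B])
    fix w
    have "\<bar>?f w\<bar> \<le> 1 * B" unfolding abs_mult using active_bounds(3)[of k w] bnd by (intro mult_mono) auto
    also have "\<dots> \<le> B * (1 + real (total_reward K w))\<^sup>2"
      using mult_left_mono[OF power_growth(2)[of "total_reward K w"] B] by simp
    finally show "\<bar>?f w\<bar> \<le> B * (1 + real (total_reward K w))\<^sup>2" .
  qed
  finally have eq: "E (\<lambda>w. active k w * h w - b * ((active k w - pr k w) * g (fst w))) = 0" .
  have hle: "\<bar>active k w * h w\<bar> \<le> L * Lam + L * (\<Sum>j\<in>{1..K}. x j w)" if w: "w \<in> states K" for w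
  proof -
    have lam_le: "lam (snd w) \<le> Lam"
      using snd_in[OF w] lam by (intro member_le_sum) (auto simp: less_imp_le)
    have "\<bar>h w\<bar> \<le> \<bar>real m * lam (snd w) * (g (fst (arrive w)) - g (fst w))\<bar> +
        (\<Sum>j\<in>{1..K}. \<bar>real (fst w j) * (g (fst (depart j w)) - g (fst w))\<bar>)"
      unfolding h_def by (intro order_trans[OF abs_triangle_ineq] add_mono order_refl sum_abs)
    also have "\<dots> \<le> L * Lam + (\<Sum>j\<in>{1..K}. L * x j w)"
    proof (intro add_mono sum_mono)
      have l: "lam (snd w) > 0" using lam[OF snd_in[OF w]] .
      have "\<bar>real m * lam (snd w) * (g (fst (arrive w)) - g (fst w))\<bar> \<le> real m * lam (snd w) * (L / real m)"
        unfolding abs_mult using l lip[OF snd_in[OF w], of "fst w"]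
        by (intro mult_mono) (auto simp: arrive_def)
      also have "\<dots> = lam (snd w) * L" using m by simp
      also have "\<dots> \<le> L * Lam" using lam_le L by (simp add: mult.commute mult_left_mono)
      finally show "\<bar>real m * lam (snd w) * (g (fst (arrive w)) - g (fst w))\<bar> \<le> L * Lam" .
      fix j assume j: "j \<in> {1..K}"
      show "\<bar>real (fst w j) * (g (fst (depart j w)) - g (fst w))\<bar> \<le> L * x j w"
      proof (cases "fst w j = 0")
        case True
        then show ?thesis using x_nonneg[of j w] L by simp
      next
        case False
        let ?q = "(fst w)(j := fst w j - 1)"
        have "?q(j := ?q j + 1) = fst w" using False by auto
        then have "\<bar>g (fst (depart j w)) - g (fst w)\<bar> \<le> L / real m"
          using lip[OF j, of ?q] by (simp add: depart_def abs_minus_commute)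
        then have "\<bar>real (fst w j) * (g (fst (depart j w)) - g (fst w))\<bar> \<le> real (fst w j) * (L / real m)"
          unfolding abs_mult by (intro mult_mono) auto
        then show ?thesis by (simp add: scaled_def mult.commute)
      qed
    qed
    also have "\<dots> = L * Lam + L * (\<Sum>j\<in>{1..K}. x j w)" by (simp add: sum_distrib_left)
    finally have *: "\<bar>h w\<bar> \<le> L * Lam + L * (\<Sum>j\<in>{1..K}. x j w)" .
    have "\<bar>active k w * h w\<bar> \<le> 1 * \<bar>h w\<bar>"
      unfolding abs_mult by (intro mult_right_mono active_bounds) simp
    then show ?thesis using * by simp
  qed
  have isum: "integrable (measure_pmf \<pi>) (\<lambda>w. L * Lam + L * (\<Sum>j\<in>{1..K}. x j w))"
    by (intro Bochner_Integration.integrable_add Bochner_Integration.integrable_mult_right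
        Bochner_Integration.integrable_sum integrable_x) auto
  have ih: "integrable (measure_pmf \<pi>) (\<lambda>w. active k w * h w)"
  proof (rule Bochner_Integration.integrable_bound[OF isum])
    show "AE w in \<pi>. norm (active k w * h w) \<le> norm (L * Lam + L * (\<Sum>j\<in>{1..K}. x j w))"
      using hle supp by (force simp: AE_measure_pmf_iff intro: order_trans[OF _ abs_ge_self])
  qed simp
  have abs_g: "\<bar>(active k w - pr k w) * g (fst w)\<bar> \<le> 1 * B" for w
    unfolding abs_mult
    by (intro mult_mono bnd) (use active_bounds[of k w] pr_nonneg[of k w] pr_le_1[OF k, of w] in auto)
  have ig: "integrable (measure_pmf \<pi>) (\<lambda>w. (active k w - pr k w) * g (fst w))"
    by (rule integrable_pmf_bounded[OF abs_g])
  have "b * \<bar>E (\<lambda>w. (active k w - pr k w) * g (fst w))\<bar> = \<bar>E (\<lambda>w. active k w * h w)\<bar>"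
    using eq ih ig \<beta> by (simp add: abs_mult)
  also have "\<dots> \<le> E (\<lambda>w. \<bar>active k w * h w\<bar>)" by (rule integral_abs_bound)
  also have "\<dots> \<le> E (\<lambda>w. L * Lam + L * (\<Sum>j\<in>{1..K}. x j w))"
    by (rule E_mono[OF integrable_abs[OF ih] isum hle])
  also have "\<dots> = L * Lam + L * (\<Sum>j\<in>{1..K}. E (x j))"
  proof -
    have "integrable (measure_pmf \<pi>) (\<lambda>w. \<Sum>j\<in>{1..K}. x j w)"
      by (intro Bochner_Integration.integrable_sum integrable_x)
    moreover have "E (\<lambda>w. \<Sum>j\<in>{1..K}. x j w) = (\<Sum>j\<in>{1..K}. E (x j))"
      by (intro Bochner_Integration.integral_sum integrable_x)
    ultimately show ?thesis by simp
  qed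
  also have "\<dots> \<le> L * Lam + L * Lam"
    using L by (intro add_left_mono mult_left_mono sum_mono mean_x_le)
  finally show ?thesis using b_pos by (simp add: pos_le_divide_eq mult_ac)
qed

text \<open>
  The test function is the discrete antiderivative \<open>\<phi>\<close> of \<open>\<psi>\<close> on the lattice of multiples of \<open>1 / m\<close>.
  Its increments are exact: an arrival contributes \<open>\<psi>\<close> at \<open>x k\<close> and a departure \<open>\<psi>\<close> at
  \<open>x k - 1 / m\<close>.  Then \<open>averaging\<close> replaces \<open>active k\<close> by \<open>pr k\<close>.
\<close>

lemma drift_test:
  assumes k: "k \<in> {1..K}" and L: "L \<ge> 0"
    and bnd: "\<And>y. \<bar>\<psi> y\<bar> \<le> B" and lip: "\<And>y z. \<bar>\<psi> y - \<psi> z\<bar> \<le> L * \<bar>y - z\<bar>"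
  shows "\<bar>E (\<lambda>w. (lam k * pr k w - x k w) * \<psi> (x k w))\<bar> \<le> L * lam k / real m + lam k * (2 * L * Lam / b)"
proof -
  define \<phi> where "\<phi> n = (\<Sum>j<n. \<psi> (real j / real m) / real m)" for n
  let ?f = "\<lambda>w. \<phi> (fst w k)"
  have B: "B \<ge> 0" using bnd[of undefined] by linarith
  have "E (\<lambda>w. lam k * active k w * \<psi> (x k w) - x k w * \<psi> (x k w - 1 / real m)) = E (scaled_gen ?f)"
  proof (rule E_cong)
    fix w
    have "real (fst w j) * (?f (depart j w) - ?f w) = (if j = k then - (x k w * \<psi> (x k w - 1 / real m)) else 0)" for j
    proof (cases "fst w j = 0")
      case False
      then obtain n where n: "fst w j = Suc n" by (cases "fst w j") auto
      have "real (Suc n) / real m - 1 / real m = real n / real m" by (simp add: diff_divide_distrib[symmetric])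
      then show ?thesis
        using n by (cases "j = k") (auto simp: depart_def \<phi>_def scaled_def simp del: of_nat_Suc)
    qed (auto simp: scaled_def)
    then have 1: "(\<Sum>j\<in>{1..K}. real (fst w j) * (?f (depart j w) - ?f w)) = - (x k w * \<psi> (x k w - 1 / real m))"
      using k by (simp del: One_nat_def)
    have 2: "real m * lam (snd w) * (?f (arrive w) - ?f w) = lam k * active k w * \<psi> (x k w)"
      using m by (auto simp: arrive_def active_def \<phi>_def scaled_def)
    show "lam k * active k w * \<psi> (x k w) - x k w * \<psi> (x k w - 1 / real m) = scaled_gen ?f w"
      unfolding scaled_gen_def 1 2 by simp
  qed
  also have "\<dots> = 0"
  proof (rule scaled_balance[of _ B])
    fix w :: state
    have "\<bar>?f w\<bar> \<le> (\<Sum>j<fst w k. \<bar>\<psi> (real j / real m) / real m\<bar>)" unfolding \<phi>_def by (rule sum_abs)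
    also have "\<dots> \<le> (\<Sum>j<fst w k. B / real m)" using bnd by (intro sum_mono) (simp add: divide_right_mono)
    also have "\<dots> = B * x k w" by (simp add: scaled_def)
    also have "\<dots> \<le> B * (1 + real (total_reward K w))\<^sup>2"
      using order_trans[OF x_le[OF k, of w] power_growth(1)[of "total_reward K w"]] B by (rule mult_left_mono)
    finally show "\<bar>?f w\<bar> \<le> B * (1 + real (total_reward K w))\<^sup>2" .
  qed
  finally have eq: "E (\<lambda>w. lam k * active k w * \<psi> (x k w) - x k w * \<psi> (x k w - 1 / real m)) = 0" .
  have ia: "integrable (measure_pmf \<pi>) (\<lambda>w. active k w * \<psi> (x k w))"
    by (rule integrable_mult_bounded[OF integrable_active bnd])
  have ip: "integrable (measure_pmf \<pi>) (\<lambda>w. pr k w * \<psi> (x k w))"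
    by (rule integrable_mult_bounded[OF integrable_pr[OF k] bnd])
  have ix: "integrable (measure_pmf \<pi>) (\<lambda>w. x k w * \<psi> (x k w))"
    by (rule integrable_mult_bounded[OF integrable_x[OF k] bnd])
  have ix': "integrable (measure_pmf \<pi>) (\<lambda>w. x k w * \<psi> (x k w - 1 / real m))"
    by (rule integrable_mult_bounded[OF integrable_x[OF k] bnd])
  have "E (\<lambda>w. (lam k * pr k w - x k w) * \<psi> (x k w)) =
      lam k * E (\<lambda>w. pr k w * \<psi> (x k w)) - E (\<lambda>w. x k w * \<psi> (x k w))"
    using ip ix by (simp add: left_diff_distrib mult.assoc)
  moreover have "lam k * E (\<lambda>w. active k w * \<psi> (x k w)) = E (\<lambda>w. x k w * \<psi> (x k w - 1 / real m))"
    using eq ia ix' by (simp add: mult.assoc)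
  moreover have "\<bar>E (\<lambda>w. active k w * \<psi> (x k w)) - E (\<lambda>w. pr k w * \<psi> (x k w))\<bar> \<le> 2 * L * Lam / b"
  proof -
    have lip': "\<bar>\<psi> (real ((q(j := q j + 1)) k) / real m) - \<psi> (real (q k) / real m)\<bar> \<le> L / real m" for q :: "nat \<Rightarrow> nat" and j
      using lip[of "real (q k + 1) / real m" "real (q k) / real m"] L
      by (auto simp: diff_divide_distrib[symmetric])
    have "\<bar>E (\<lambda>w. (active k w - pr k w) * \<psi> (x k w))\<bar> \<le> 2 * L * Lam / b"
      unfolding scaled_def
      by (rule averaging[where g = "\<lambda>q. \<psi> (real (q k) / real m)", OF k L bnd lip'])
    also have "E (\<lambda>w. (active k w - pr k w) * \<psi> (x k w)) =
        E (\<lambda>w. active k w * \<psi> (x k w)) - E (\<lambda>w. pr k w * \<psi> (x k w))"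
      unfolding left_diff_distrib by (rule Bochner_Integration.integral_diff[OF ia ip])
    finally show ?thesis .
  qed
  then have "lam k * \<bar>E (\<lambda>w. active k w * \<psi> (x k w)) - E (\<lambda>w. pr k w * \<psi> (x k w))\<bar> \<le> lam k * (2 * L * Lam / b)"
    using lam[OF k] by (intro mult_left_mono) auto
  then have "\<bar>lam k * E (\<lambda>w. active k w * \<psi> (x k w)) - lam k * E (\<lambda>w. pr k w * \<psi> (x k w))\<bar> \<le> lam k * (2 * L * Lam / b)"
    by (simp only: right_diff_distrib[symmetric] abs_mult abs_of_pos[OF lam[OF k]])
  moreover have "\<bar>E (\<lambda>w. x k w * \<psi> (x k w - 1 / real m)) - E (\<lambda>w. x k w * \<psi> (x k w))\<bar> \<le> L * lam k / real m"
  proof -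
    have "\<bar>E (\<lambda>w. x k w * \<psi> (x k w - 1 / real m)) - E (\<lambda>w. x k w * \<psi> (x k w))\<bar> =
        \<bar>E (\<lambda>w. x k w * \<psi> (x k w - 1 / real m) - x k w * \<psi> (x k w))\<bar>"
      using ix ix' by simp
    also have "\<dots> \<le> E (\<lambda>w. \<bar>x k w * \<psi> (x k w - 1 / real m) - x k w * \<psi> (x k w)\<bar>)" by (rule integral_abs_bound)
    also have "\<dots> \<le> E (\<lambda>w. L / real m * x k w)"
    proof (intro E_mono)
      fix w
      have "\<bar>x k w * \<psi> (x k w - 1 / real m) - x k w * \<psi> (x k w)\<bar> =
          x k w * \<bar>\<psi> (x k w - 1 / real m) - \<psi> (x k w)\<bar>"
        by (simp only: right_diff_distrib[symmetric] abs_mult abs_of_nonneg[OF x_nonneg])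
      also have "\<dots> \<le> x k w * (L / real m)"
        using lip[of "x k w - 1 / real m" "x k w"] x_nonneg[of k w] by (intro mult_left_mono) auto
      finally show "\<bar>x k w * \<psi> (x k w - 1 / real m) - x k w * \<psi> (x k w)\<bar> \<le> L / real m * x k w"
        by (simp add: mult.commute)
    qed (use ix ix' integrable_x[OF k] in auto)
    also have "\<dots> \<le> L / real m * lam k"
      using mult_left_mono[OF mean_x_le[OF k], of "L / real m"] L by simp
    finally show ?thesis by simp
  qed
  ultimately show ?thesis by linarith
qed

text \<open>
  The function \<open>mass\<close>, with every positive part \<open>max 0 (x k - a)\<close> smoothed.
\<close>

definition soft_mass :: "real \<Rightarrow> (nat \<Rightarrow> nat) \<Rightarrow> real" where
  "soft_mass e q = real K * a + (\<Sum>k\<in>{1..K}. huber e (real (q k) / real m - a))"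

text \<open>
  The derivative of \<open>huber 1 (soft_mass e q - l)\<close> in the direction of the \<open>k\<close>-th scaled reward.
\<close>

definition soft_test :: "real \<Rightarrow> real \<Rightarrow> nat \<Rightarrow> (nat \<Rightarrow> nat) \<Rightarrow> real" where
  "soft_test e l k q = huber' 1 (soft_mass e q - l) * huber' e (real (q k) / real m - a)"

lemma soft_mass_step:
  assumes e: "e > 0" and j: "j \<in> {1..K}"
  defines "q' \<equiv> \<lambda>q :: nat \<Rightarrow> nat. q(j := q j + 1)"
  shows "soft_mass e (q' q) - soft_mass e q \<le> huber' e (real (q' q j) / real m - a) / real m"
    and "huber' e (real (q j) / real m - a) / real m \<le> soft_mass e (q' q) - soft_mass e q"
proof -
  let ?y = "real (q j) / real m - a" and ?z = "real (q' q j) / real m - a"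
  have z: "?z - ?y = 1 / real m" by (simp add: q'_def add_divide_distrib)
  have "(\<Sum>k\<in>{1..K}. huber e (real (q' q k) / real m - a)) =
      huber e ?z + (\<Sum>k\<in>{1..K} - {j}. huber e (real (q k) / real m - a))"
    by (subst sum.remove[OF _ j]) (auto simp: q'_def)
  moreover have "(\<Sum>k\<in>{1..K}. huber e (real (q k) / real m - a)) =
      huber e ?y + (\<Sum>k\<in>{1..K} - {j}. huber e (real (q k) / real m - a))"
    by (rule sum.remove[OF _ j]) simp
  ultimately have d: "soft_mass e (q' q) - soft_mass e q = huber e ?z - huber e ?y"
    unfolding soft_mass_def by linarith
  have "huber e ?z + huber' e ?z * (?y - ?z) \<le> huber e ?y" by (rule huber_convex[OF e])
  moreover have "?y - ?z = - (1 / real m)" using z by linarith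
  ultimately show "soft_mass e (q' q) - soft_mass e q \<le> huber' e ?z / real m" unfolding d by simp
  have "huber e ?y + huber' e ?y * (?z - ?y) \<le> huber e ?z" by (rule huber_convex[OF e])
  then show "huber' e ?y / real m \<le> soft_mass e (q' q) - soft_mass e q" unfolding d z by simp
qed

lemma soft_mass_step_bounds:
  assumes e: "e > 0" and j: "j \<in> {1..K}"
  shows "0 \<le> soft_mass e (q(j := q j + 1)) - soft_mass e q"
    and "soft_mass e (q(j := q j + 1)) - soft_mass e q \<le> 1 / real m"
proof -
  have "0 \<le> huber' e (real (q j) / real m - a) / real m" by (simp add: huber'_bounds)
  then show "0 \<le> soft_mass e (q(j := q j + 1)) - soft_mass e q"
    using soft_mass_step(2)[OF assms, of q] by linarith
  have "huber' e (real ((q(j := q j + 1)) j) / real m - a) / real m \<le> 1 / real m"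
    by (intro divide_right_mono huber'_bounds) simp
  then show "soft_mass e (q(j := q j + 1)) - soft_mass e q \<le> 1 / real m"
    using soft_mass_step(1)[OF assms, of q] by linarith
qed

lemma soft_test_bounds: "0 \<le> soft_test e l k q" "soft_test e l k q \<le> 1"
  unfolding soft_test_def by (auto intro!: mult_nonneg_nonneg mult_le_one huber'_bounds)

lemma abs_soft_test: "\<bar>soft_test e l k q\<bar> \<le> 1"
  using soft_test_bounds[where e = e and l = l and k = k and q = q] by simp

lemma soft_test_lipschitz:
  assumes e: "e > 0" and j: "j \<in> {1..K}"
  shows "\<bar>soft_test e l k (q(j := q j + 1)) - soft_test e l k q\<bar> \<le> (1 + 1 / e) / real m"
proof -
  let ?q = "q(j := q j + 1)"
  let ?A = "\<lambda>q. huber' 1 (soft_mass e q - l)" and ?B = "\<lambda>q. huber' e (real (q k) / real m - a)"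
  have A: "\<bar>?A ?q - ?A q\<bar> \<le> 1 / real m"
    using huber'_lipschitz[of 1 "soft_mass e ?q - l" "soft_mass e q - l"] soft_mass_step_bounds[OF e j, of q] by simp
  have "\<bar>(real (?q k) / real m - a) - (real (q k) / real m - a)\<bar> \<le> 1 / real m"
    by (auto simp: diff_divide_distrib[symmetric])
  then have "\<bar>(real (?q k) / real m - a) - (real (q k) / real m - a)\<bar> / e \<le> 1 / real m / e"
    using e by (intro divide_right_mono) auto
  then have B: "\<bar>?B ?q - ?B q\<bar> \<le> 1 / real m / e"
    using huber'_lipschitz[OF e, of "real (?q k) / real m - a" "real (q k) / real m - a"] by linarith
  have eq: "soft_test e l k ?q - soft_test e l k q = (?A ?q - ?A q) * ?B ?q + ?A q * (?B ?q - ?B q)"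
    unfolding soft_test_def by (simp only: left_diff_distrib right_diff_distrib)
  have "\<bar>soft_test e l k ?q - soft_test e l k q\<bar>
      \<le> \<bar>?A ?q - ?A q\<bar> * \<bar>?B ?q\<bar> + \<bar>?A q\<bar> * \<bar>?B ?q - ?B q\<bar>"
    unfolding eq abs_mult[symmetric] by (rule abs_triangle_ineq)
  also have "\<dots> \<le> 1 / real m * 1 + 1 * (1 / real m / e)"
    using A B by (intro add_mono mult_mono) (auto simp: abs_of_nonneg huber'_bounds)
  also have "\<dots> = (1 + 1 / e) / real m" by (simp add: add_divide_distrib mult.commute)
  finally show ?thesis .
qed

lemma soft_potential_step:
  fixes l :: real
  assumes e: "e > 0" and j: "j \<in> {1..K}"
  defines "F \<equiv> \<lambda>q. huber 1 (soft_mass e q - l)"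
  shows "F (q(j := q j + 1)) - F q \<le> soft_test e l j (q(j := q j + 1)) / real m"
    and "soft_test e l j q / real m \<le> F (q(j := q j + 1)) - F q"
proof -
  let ?q = "q(j := q j + 1)"
  let ?y = "soft_mass e q - l" and ?z = "soft_mass e ?q - l"
  have "huber 1 ?z + huber' 1 ?z * (?y - ?z) \<le> huber 1 ?y" by (rule huber_convex) simp
  then have "F ?q - F q \<le> huber' 1 ?z * (soft_mass e ?q - soft_mass e q)"
    unfolding F_def by (simp add: algebra_simps)
  also have "\<dots> \<le> huber' 1 ?z * (huber' e (real (?q j) / real m - a) / real m)"
    by (intro mult_left_mono soft_mass_step(1)[OF e j] huber'_bounds)
  finally show "F ?q - F q \<le> soft_test e l j ?q / real m" by (simp add: soft_test_def)
  have "soft_test e l j q / real m \<le> huber' 1 ?y * (soft_mass e ?q - soft_mass e q)"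
    using mult_left_mono[OF soft_mass_step(2)[OF e j, of q] huber'_bounds(1)[of 1 ?y]] by (simp add: soft_test_def)
  also have "\<dots> = huber' 1 ?y * (?z - ?y)" by simp
  also have "\<dots> \<le> F ?q - F q" unfolding F_def using huber_convex[of 1 ?y ?z] by simp
  finally show "soft_test e l j q / real m \<le> F ?q - F q" .
qed

text \<open>
  The balance equation for the potential \<open>huber 1 (soft_mass e q - l)\<close>.  By convexity each increment
  is bounded by the derivative at one end of the jump, in the direction that is needed, so that no
  second-order expansion is required.
\<close>

lemma overshoot_drift:
  assumes e: "e > 0"
  defines "L \<equiv> 1 + 1 / e"
  shows "E (\<lambda>w. \<Sum>k\<in>{1..K}. (x k w - lam k * pr k w) * soft_test e l k (fst w))
    \<le> 2 * L * Lam / real m + Lam * (2 * L * Lam / b)"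
proof -
  define F where "F q = huber 1 (soft_mass e q - l)" for q
  let ?t = "\<lambda>k w. soft_test e l k (fst w)"
  let ?I = "\<lambda>w. real m * lam (snd w) * (F (fst (arrive w)) - F (fst w)) +
      (\<Sum>j\<in>{1..K}. real (fst w j) * (F (fst (depart j w)) - F (fst w)))"
  let ?J = "\<lambda>w. (\<Sum>k\<in>{1..K}. lam k * (active k w * ?t k w)) + L / real m * Lam
      - (\<Sum>j\<in>{1..K}. x j w * ?t j w) + L / real m * (\<Sum>j\<in>{1..K}. x j w)"
  have L: "L \<ge> 0" using e by (simp add: L_def)
  have lam_le: "lam (snd w) \<le> Lam" "lam (snd w) > 0" if w: "w \<in> states K" for w
    using snd_in[OF w] lam by (auto intro!: member_le_sum simp: less_imp_le)
  have up: "soft_test e l j q / real m \<le> F (q(j := q j + 1)) - F q"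
    "F (q(j := q j + 1)) - F q \<le> soft_test e l j (q(j := q j + 1)) / real m" if "j \<in> {1..K}" for j q
    using soft_potential_step[OF e that, where l = l and q = q] unfolding F_def by blast+
  have lipt: "\<bar>soft_test e l k (q(j := q j + 1)) - soft_test e l k q\<bar> \<le> L / real m" if "j \<in> {1..K}" for j k q
    unfolding L_def by (rule soft_test_lipschitz[OF e that])
  have arr: "0 \<le> F (fst (arrive w)) - F (fst w)"
    "F (fst (arrive w)) - F (fst w) \<le> (?t (snd w) w + L / real m) / real m"
    "F (fst (arrive w)) - F (fst w) \<le> 1 / real m"
    if w: "w \<in> states K" for w
  proof -
    let ?c = "snd w"
    let ?q = "(fst w)(?c := fst w ?c + 1)"
    have 0: "0 \<le> ?t ?c w / real m" by (simp add: soft_test_bounds)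
    show "0 \<le> F (fst (arrive w)) - F (fst w)"
      using up(1)[OF snd_in[OF w], of "fst w"] 0 by (simp add: arrive_def)
    have "soft_test e l ?c ?q / real m \<le> (?t ?c w + L / real m) / real m"
      using lipt[OF snd_in[OF w], of ?c "fst w"] by (intro divide_right_mono) auto
    then show "F (fst (arrive w)) - F (fst w) \<le> (?t (snd w) w + L / real m) / real m"
      using up(2)[OF snd_in[OF w], of "fst w"] by (simp add: arrive_def)
    have "soft_test e l ?c ?q / real m \<le> 1 / real m" by (intro divide_right_mono soft_test_bounds) simp
    then show "F (fst (arrive w)) - F (fst w) \<le> 1 / real m"
      using up(2)[OF snd_in[OF w], of "fst w"] by (simp add: arrive_def)
  qed
  have dep: "real (fst w j) * (F (fst (depart j w)) - F (fst w)) \<le> - (x j w * ?t j w) + L / real m * x j w"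
    "\<bar>real (fst w j) * (F (fst (depart j w)) - F (fst w))\<bar> \<le> x j w"
    if j: "j \<in> {1..K}" for j and w :: state
  proof -
    have "real (fst w j) * (F (fst (depart j w)) - F (fst w)) \<le> - (x j w * ?t j w) + L / real m * x j w \<and>
      \<bar>real (fst w j) * (F (fst (depart j w)) - F (fst w))\<bar> \<le> x j w"
    proof (cases "fst w j = 0")
      case True
      then show ?thesis by (simp add: scaled_def)
    next
      case False
      let ?q = "(fst w)(j := fst w j - 1)"
      have q: "?q(j := ?q j + 1) = fst w" using False by auto
      have d: "fst (depart j w) = ?q" by (simp add: depart_def)
      have s1: "soft_test e l j ?q / real m \<le> F (fst w) - F ?q"
        and s2: "F (fst w) - F ?q \<le> ?t j w / real m" using up[OF j, of ?q] unfolding q by blast+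
      have "?t j w - L / real m \<le> soft_test e l j ?q" using lipt[OF j, of j ?q] unfolding q by linarith
      then have "(?t j w - L / real m) / real m \<le> soft_test e l j ?q / real m" by (intro divide_right_mono) auto
      then have "F ?q - F (fst w) \<le> - ((?t j w - L / real m) / real m)" using s1 by linarith
      then have "real (fst w j) * (F ?q - F (fst w)) \<le> real (fst w j) * (- ((?t j w - L / real m) / real m))"
        by (intro mult_left_mono) auto
      also have "\<dots> = - (x j w * ?t j w) + L / real m * x j w"
        by (simp add: scaled_def diff_divide_distrib algebra_simps)
      finally have 1: "real (fst w j) * (F ?q - F (fst w)) \<le> - (x j w * ?t j w) + L / real m * x j w" .
      have "0 \<le> soft_test e l j ?q / real m" by (simp add: soft_test_bounds)
      moreover have "?t j w / real m \<le> 1 / real m" by (intro divide_right_mono soft_test_bounds) simp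
      ultimately have "\<bar>F ?q - F (fst w)\<bar> \<le> 1 / real m" using s1 s2 by linarith
      then have "real (fst w j) * \<bar>F ?q - F (fst w)\<bar> \<le> real (fst w j) * (1 / real m)"
        by (intro mult_left_mono) auto
      then have 2: "\<bar>real (fst w j) * (F ?q - F (fst w))\<bar> \<le> x j w" by (simp add: abs_mult scaled_def)
      show ?thesis unfolding d using 1 2 by blast
    qed
    then show "real (fst w j) * (F (fst (depart j w)) - F (fst w)) \<le> - (x j w * ?t j w) + L / real m * x j w"
      "\<bar>real (fst w j) * (F (fst (depart j w)) - F (fst w))\<bar> \<le> x j w" by blast+
  qed
  \<comment> \<open>each increment of the potential is replaced by its derivative at \<open>w\<close>, with an error of at most \<open>L / m\<close>\<close>
  have IJ: "?I w \<le> ?J w" if w: "w \<in> states K" for w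
  proof -
    have "real m * lam (snd w) * (F (fst (arrive w)) - F (fst w))
        \<le> real m * lam (snd w) * ((?t (snd w) w + L / real m) / real m)"
      using lam_le[OF w] by (intro mult_left_mono arr w) auto
    also have "\<dots> = lam (snd w) * ?t (snd w) w + L / real m * lam (snd w)"
      using m by (simp add: field_simps)
    also have "\<dots> \<le> lam (snd w) * ?t (snd w) w + L / real m * Lam"
      using lam_le[OF w] L by (intro add_left_mono mult_left_mono) auto
    also have "lam (snd w) * ?t (snd w) w = (\<Sum>k\<in>{1..K}. if snd w = k then lam k * ?t k w else 0)"
      using snd_in[OF w] by (simp del: One_nat_def)
    also have "\<dots> = (\<Sum>k\<in>{1..K}. lam k * (active k w * ?t k w))"
      by (intro sum.cong) (auto simp: active_def)
    finally have 1: "real m * lam (snd w) * (F (fst (arrive w)) - F (fst w)) \<le>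
      (\<Sum>k\<in>{1..K}. lam k * (active k w * ?t k w)) + L / real m * Lam" .
    have "(\<Sum>j\<in>{1..K}. real (fst w j) * (F (fst (depart j w)) - F (fst w)))
        \<le> (\<Sum>j\<in>{1..K}. - (x j w * ?t j w) + L / real m * x j w)" by (intro sum_mono dep)
    also have "\<dots> = - (\<Sum>j\<in>{1..K}. x j w * ?t j w) + L / real m * (\<Sum>j\<in>{1..K}. x j w)"
      by (simp only: sum.distrib sum_negf sum_distrib_left)
    finally show ?thesis using 1 by linarith
  qed
  have iI: "integrable (measure_pmf \<pi>) ?I"
  proof (rule Bochner_Integration.integrable_bound)
    show "integrable (measure_pmf \<pi>) (\<lambda>w. Lam + (\<Sum>j\<in>{1..K}. x j w))"
      by (intro Bochner_Integration.integrable_add Bochner_Integration.integrable_sum integrable_x) auto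
    have "norm (?I w) \<le> norm (Lam + (\<Sum>j\<in>{1..K}. x j w))" if w: "w \<in> states K" for w
    proof -
      have "\<bar>?I w\<bar> \<le> \<bar>real m * lam (snd w) * (F (fst (arrive w)) - F (fst w))\<bar> +
          (\<Sum>j\<in>{1..K}. \<bar>real (fst w j) * (F (fst (depart j w)) - F (fst w))\<bar>)"
        by (intro order_trans[OF abs_triangle_ineq] add_mono order_refl sum_abs)
      also have "\<dots> \<le> Lam + (\<Sum>j\<in>{1..K}. x j w)"
      proof (intro add_mono sum_mono dep)
        have "\<bar>real m * lam (snd w) * (F (fst (arrive w)) - F (fst w))\<bar> \<le> real m * lam (snd w) * (1 / real m)"
          unfolding abs_mult using arr[OF w] lam_le[OF w] by (intro mult_mono) auto
        then show "\<bar>real m * lam (snd w) * (F (fst (arrive w)) - F (fst w))\<bar> \<le> Lam"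
          using lam_le[OF w] m by simp
      qed auto
      also have "\<dots> \<le> \<bar>Lam + (\<Sum>j\<in>{1..K}. x j w)\<bar>" by (rule abs_ge_self)
      finally show ?thesis by (simp only: real_norm_def)
    qed
    then show "AE w in \<pi>. norm (?I w) \<le> norm (Lam + (\<Sum>j\<in>{1..K}. x j w))"
      using supp by (auto simp only: AE_measure_pmf_iff)
  qed simp
  have it: "integrable (measure_pmf \<pi>) (\<lambda>w. active k w * ?t k w)"
    "k \<in> {1..K} \<Longrightarrow> integrable (measure_pmf \<pi>) (\<lambda>w. x k w * ?t k w)"
    "k \<in> {1..K} \<Longrightarrow> integrable (measure_pmf \<pi>) (\<lambda>w. pr k w * ?t k w)" for k
    by (intro integrable_mult_bounded[where B = 1] integrable_active integrable_x integrable_pr abs_soft_test; assumption)+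
  have iJ1: "integrable (measure_pmf \<pi>) (\<lambda>w. \<Sum>k\<in>{1..K}. lam k * (active k w * ?t k w))"
    and iJ2: "integrable (measure_pmf \<pi>) (\<lambda>w. \<Sum>j\<in>{1..K}. x j w * ?t j w)"
    and iJ3: "integrable (measure_pmf \<pi>) (\<lambda>w. L / real m * (\<Sum>j\<in>{1..K}. x j w))"
    by (intro Bochner_Integration.integrable_sum Bochner_Integration.integrable_mult_right it integrable_x; simp)+
  have iJ: "integrable (measure_pmf \<pi>) ?J"
    by (intro Bochner_Integration.integrable_add Bochner_Integration.integrable_diff iJ1 iJ2 iJ3) auto
  have "E ?I = E (scaled_gen (\<lambda>w. F (fst w)))"
    by (simp add: scaled_gen_def[abs_def])
  also have "\<dots> = 0"
  proof (rule scaled_balance[of _ "1 + real K * a + \<bar>l\<bar>"])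
    fix w :: state
    have "0 \<le> F (fst w)" unfolding F_def by (rule huber_bounds) simp
    moreover have "F (fst w) \<le> max 0 (soft_mass e (fst w) - l)" unfolding F_def by (rule huber_bounds) simp
    moreover have "soft_mass e (fst w) \<le> real K * a + (\<Sum>k\<in>{1..K}. x k w)"
      unfolding soft_mass_def
    proof (intro add_left_mono sum_mono)
      fix k
      have "huber e (x k w - a) \<le> max 0 (x k w - a)" by (rule huber_bounds[OF e])
      also have "\<dots> \<le> x k w" using x_nonneg[of k w] a by simp
      finally show "huber e (real (fst w k) / real m - a) \<le> x k w" by (simp add: scaled_def)
    qed
    moreover have "real K * a \<ge> 0" using Ka_pos by simp
    ultimately have "\<bar>F (fst w)\<bar> \<le> real (total_reward K w) + (real K * a + \<bar>l\<bar>)"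
      using sum_x_le[of w] by linarith
    also have "\<dots> \<le> (1 + real (total_reward K w))\<^sup>2 + (real K * a + \<bar>l\<bar>) * (1 + real (total_reward K w))\<^sup>2"
      using power_growth(1)[of "total_reward K w"]
        mult_left_mono[OF power_growth(2)[of "total_reward K w"], of "real K * a + \<bar>l\<bar>"] Ka_pos
      by (intro add_mono) auto
    also have "\<dots> = (1 + real K * a + \<bar>l\<bar>) * (1 + real (total_reward K w))\<^sup>2" by (simp add: algebra_simps)
    finally show "\<bar>F (fst w)\<bar> \<le> (1 + real K * a + \<bar>l\<bar>) * (1 + real (total_reward K w))\<^sup>2" .
  qed
  finally have "0 \<le> E ?J" using E_mono[OF iI iJ IJ] by simp
  also have "E ?J = (\<Sum>k\<in>{1..K}. lam k * E (\<lambda>w. active k w * ?t k w)) + L / real m * Lam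
      - (\<Sum>j\<in>{1..K}. E (\<lambda>w. x j w * ?t j w)) + L / real m * (\<Sum>j\<in>{1..K}. E (x j))"
    using iJ1 iJ2 iJ3 it
    by (simp add: Bochner_Integration.integral_sum integrable_x del: One_nat_def)
  also have "\<dots> \<le> (\<Sum>k\<in>{1..K}. lam k * (E (\<lambda>w. pr k w * ?t k w) + 2 * L * Lam / b)) + L / real m * Lam
      - (\<Sum>j\<in>{1..K}. E (\<lambda>w. x j w * ?t j w)) + L / real m * Lam"
  proof (intro add_mono diff_mono order_refl sum_mono mult_left_mono mean_x_le)
    fix k assume k: "k \<in> {1..K}"
    have "\<bar>E (\<lambda>w. (active k w - pr k w) * ?t k w)\<bar> \<le> 2 * L * Lam / b"
      by (rule averaging[where g = "soft_test e l k" and B = 1, OF k L abs_soft_test lipt])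
    then show "E (\<lambda>w. active k w * ?t k w) \<le> E (\<lambda>w. pr k w * ?t k w) + 2 * L * Lam / b"
      using it(1)[of k] it(3)[OF k] by (simp add: left_diff_distrib)
    show "0 \<le> lam k" using lam[OF k] by simp
  qed (use L in auto)
  also have "\<dots> = (\<Sum>k\<in>{1..K}. lam k * E (\<lambda>w. pr k w * ?t k w)) - (\<Sum>j\<in>{1..K}. E (\<lambda>w. x j w * ?t j w))
      + (2 * L * Lam / real m + Lam * (2 * L * Lam / b))"
    unfolding distrib_left sum.distrib sum_distrib_right[symmetric] by simp
  also have "(\<Sum>k\<in>{1..K}. lam k * E (\<lambda>w. pr k w * ?t k w)) - (\<Sum>j\<in>{1..K}. E (\<lambda>w. x j w * ?t j w)) =
      - E (\<lambda>w. \<Sum>k\<in>{1..K}. (x k w - lam k * pr k w) * ?t k w)"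
  proof -
    have "integrable (measure_pmf \<pi>) (\<lambda>w. (x k w - lam k * pr k w) * ?t k w)"
      "E (\<lambda>w. (x k w - lam k * pr k w) * ?t k w) = E (\<lambda>w. x k w * ?t k w) - lam k * E (\<lambda>w. pr k w * ?t k w)"
      if k: "k \<in> {1..K}" for k
      using it(2,3)[OF k] by (simp_all add: left_diff_distrib mult.assoc)
    then have "E (\<lambda>w. \<Sum>k\<in>{1..K}. (x k w - lam k * pr k w) * ?t k w) =
        (\<Sum>k\<in>{1..K}. E (\<lambda>w. x k w * ?t k w) - lam k * E (\<lambda>w. pr k w * ?t k w))"
      by (subst Bochner_Integration.integral_sum) (auto intro: sum.cong simp del: One_nat_def)
    then show ?thesis by (simp add: sum_subtractf)
  qed
  finally show ?thesis by linarith
qed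

text \<open>
  Where \<open>D\<close> exceeds \<open>l\<close>, and hence every rate, each action above the threshold loses reward: its drift
  is \<open>x k * (lam k / D - 1)\<close>.  All terms in \<open>overshoot_drift\<close> are therefore nonnegative.  If moreover \<open>D\<close>
  exceeds \<open>l + 2 * \<delta>\<close>, then, as \<open>l \<ge> K * a\<close>, some action lies above the threshold by at least \<open>\<delta> / K\<close>,
  and its term is at least the constant on the left.
\<close>

lemma overshoot_rare:
  assumes l: "l \<ge> real K * a" and lam_l: "\<And>k. k \<in> {1..K} \<Longrightarrow> lam k \<le> l" and \<delta>: "\<delta> > 0"
  defines "L \<equiv> 1 + real K / \<delta>"
  shows "a * (\<delta> / (l + \<delta>)) * min 1 \<delta> * E (\<lambda>w. if D w \<ge> l + 2 * \<delta> then 1 else 0)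
    \<le> 2 * L * Lam / real m + Lam * (2 * L * Lam / b)"
proof -
  \<comment> \<open>small enough that smoothing changes \<open>D\<close> by at most \<open>\<delta> / 2\<close> in total\<close>
  define e where "e = \<delta> / real K"
  have e: "e > 0" using \<delta> K by (simp add: e_def)
  have Ke: "real K * e = \<delta>" using K by (simp add: e_def)
  have L: "L = 1 + 1 / e" by (simp add: L_def e_def)
  have l0: "l > 0" using l Ka_pos by linarith
  define c where "c = a * (\<delta> / (l + \<delta>)) * min 1 \<delta>"
  let ?t = "\<lambda>k w. (x k w - lam k * pr k w) * soft_test e l k (fst w)"
  have lower: "soft_mass e (fst w) \<le> D w" "D w - \<delta> / 2 \<le> soft_mass e (fst w)" for w :: state
  proof -
    have D_eq: "D w = real K * a + (\<Sum>k\<in>{1..K}. max 0 (x k w - a))"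
    proof -
      have "u k w = a + max 0 (x k w - a)" for k by (simp add: weight_def max_def)
      then show ?thesis by (simp add: mass_def sum.distrib)
    qed
    have "(\<Sum>k\<in>{1..K}. huber e (x k w - a)) \<le> (\<Sum>k\<in>{1..K}. max 0 (x k w - a))"
      by (intro sum_mono huber_bounds e)
    then show "soft_mass e (fst w) \<le> D w" unfolding D_eq soft_mass_def by (simp add: scaled_def)
    have "(\<Sum>k\<in>{1..K}. max 0 (x k w - a) - e / 2) \<le> (\<Sum>k\<in>{1..K}. huber e (x k w - a))"
      by (intro sum_mono huber_bounds e)
    moreover have "(\<Sum>k\<in>{1..K}. max 0 (x k w - a) - e / 2) = (\<Sum>k\<in>{1..K}. max 0 (x k w - a)) - \<delta> / 2"
      using Ke by (simp add: sum_subtractf)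
    ultimately show "D w - \<delta> / 2 \<le> soft_mass e (fst w)" unfolding D_eq soft_mass_def by (simp add: scaled_def)
  qed
  have fac: "x k w - lam k * pr k w = x k w * (1 - lam k / D w)" if "x k w > a" for k w
    using that by (simp add: share_def weight_def algebra_simps)
  have nonneg: "?t k w \<ge> 0" if k: "k \<in> {1..K}" for k w
  proof (cases "soft_test e l k (fst w) = 0")
    case False
    then have "soft_mass e (fst w) - l > 0" "x k w - a > 0"
      using huber'_eq_0[of 1 "soft_mass e (fst w) - l"] huber'_eq_0[OF e, of "x k w - a"]
      by (auto simp: soft_test_def scaled_def not_le[symmetric])
    then have "lam k \<le> D w" "x k w > a" using lower(1)[of w] lam_l[OF k] by linarith+
    then have "x k w - lam k * pr k w \<ge> 0" using fac[of k w] x_nonneg[of k w] D_pos[of w] by simp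
    then show ?thesis using soft_test_bounds(1)[of e l k "fst w"] by simp
  qed simp
  \<comment> \<open>the right-hand side is the integrand of \<open>overshoot_drift\<close>\<close>
  have pw: "c * (if D w \<ge> l + 2 * \<delta> then 1 else 0) \<le> (\<Sum>k\<in>{1..K}. ?t k w)" for w
  proof (cases "D w \<ge> l + 2 * \<delta>")
    case False
    have "0 \<le> (\<Sum>k\<in>{1..K}. ?t k w)" by (intro sum_nonneg nonneg)
    then show ?thesis using False by simp
  next
    case True
    then have sm: "soft_mass e (fst w) \<ge> l + \<delta>" using lower(2)[of w] \<delta> by linarith
    have "\<exists>k\<in>{1..K}. huber e (x k w - a) \<ge> e"
    proof (rule ccontr)
      assume "\<not> ?thesis"
      then have "(\<Sum>k\<in>{1..K}. huber e (x k w - a)) < (\<Sum>k\<in>{1..K}. e)"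
        using K by (intro sum_strict_mono) (auto simp: not_le)
      then have "soft_mass e (fst w) < real K * a + \<delta>" using Ke by (simp add: soft_mass_def scaled_def)
      then show False using sm l by linarith
    qed
    then obtain k where k: "k \<in> {1..K}" "huber e (x k w - a) \<ge> e" by blast
    have xk: "x k w - a \<ge> e" using huber_bounds(2)[OF e, of "x k w - a"] k(2) e by linarith
    have "soft_test e l k (fst w) = huber' 1 (soft_mass e (fst w) - l)"
      using huber'_eq_1[OF e xk] by (simp add: soft_test_def scaled_def)
    moreover have "huber' 1 (soft_mass e (fst w) - l) \<ge> min 1 \<delta>" using sm by (simp add: huber'_def)
    ultimately have t: "soft_test e l k (fst w) \<ge> min 1 \<delta>" by simp
    have "lam k / D w \<le> l / (l + \<delta>)"
      using lam_l[OF k(1)] lam[OF k(1)] True \<delta> l0 by (intro frac_le) auto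
    also have "\<dots> = 1 - \<delta> / (l + \<delta>)" using l0 \<delta> by (simp add: field_simps)
    finally have "1 - lam k / D w \<ge> \<delta> / (l + \<delta>)" by linarith
    then have A: "a * (\<delta> / (l + \<delta>)) \<le> x k w * (1 - lam k / D w)"
      using xk e a l0 \<delta> by (intro mult_mono) auto
    have A0: "0 \<le> a * (\<delta> / (l + \<delta>))" using a l0 \<delta> by simp
    have "c \<le> x k w * (1 - lam k / D w) * soft_test e l k (fst w)"
      unfolding c_def
    proof (rule mult_mono[OF A t])
      show "0 \<le> x k w * (1 - lam k / D w)" using A A0 by linarith
      show "0 \<le> min 1 \<delta>" using \<delta> by simp
    qed
    also have "x k w * (1 - lam k / D w) = x k w - lam k * pr k w" using xk e by (intro fac[symmetric]) simp
    also have "?t k w \<le> (\<Sum>k\<in>{1..K}. ?t k w)" by (rule member_le_sum[OF k(1)]) (use nonneg in auto)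
    finally show ?thesis using True by simp
  qed
  have "c * E (\<lambda>w. if D w \<ge> l + 2 * \<delta> then 1 else 0) = E (\<lambda>w. c * (if D w \<ge> l + 2 * \<delta> then 1 else 0))"
    by simp
  also have "\<dots> \<le> E (\<lambda>w. \<Sum>k\<in>{1..K}. ?t k w)"
  proof (rule E_mono[OF _ _ pw])
    show "integrable (measure_pmf \<pi>) (\<lambda>w. c * (if D w \<ge> l + 2 * \<delta> then 1 else 0))"
      by (rule integrable_pmf_bounded[where B = "\<bar>c\<bar>"]) auto
    show "integrable (measure_pmf \<pi>) (\<lambda>w. \<Sum>k\<in>{1..K}. ?t k w)"
      by (intro Bochner_Integration.integrable_sum integrable_mult_bounded[where B = 1] abs_soft_test
          Bochner_Integration.integrable_diff Bochner_Integration.integrable_mult_right integrable_x integrable_pr)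
  qed
  also have "\<dots> \<le> 2 * L * Lam / real m + Lam * (2 * L * Lam / b)"
    unfolding L by (rule overshoot_drift[OF e])
  finally show ?thesis unfolding c_def .
qed

lemma excess_bounds: "0 \<le> s k w" "s k w \<le> 1" "\<bar>s k w\<bar> \<le> 1"
proof -
  have "0 < a / u k w" "a / u k w \<le> 1" using a u_pos[of k w] u_ge(1)[of k w] by auto
  then show "0 \<le> s k w" "s k w \<le> 1" "\<bar>s k w\<bar> \<le> 1" by (auto simp: excess_def)
qed

text \<open>
  This is \<open>drift_test\<close> with \<open>\<psi>(y) = (1 - a / u) / u\<close> and \<open>u = max y a\<close>, which vanishes below the threshold
  and makes the test quantity depend on \<open>D\<close> through \<open>lam k / D - 1\<close> only.
\<close>

lemma excess_test:
  assumes k: "k \<in> {1..K}"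
  shows "\<bar>E (\<lambda>w. (lam k / D w - 1) * s k w)\<bar> \<le>
    3 / a\<^sup>2 * lam k / real m + lam k * (2 * (3 / a\<^sup>2) * Lam / b)"
proof -
  define \<psi> where "\<psi> y = (1 - a / max y a) / max y a" for y
  have eq: "(lam k * pr k w - x k w) * \<psi> (x k w) = (lam k / D w - 1) * s k w" for w
  proof (cases "x k w \<le> a")
    case True
    then show ?thesis using a by (simp add: \<psi>_def excess_def weight_def max_def)
  next
    case False
    then show ?thesis using a x_nonneg[of k w]
      by (simp add: \<psi>_def excess_def weight_def share_def divide_simps) (simp add: algebra_simps)
  qed
  have bnd: "\<bar>\<psi> y\<bar> \<le> 1 / a" for y
  proof -
    have m: "max y a > 0" "max y a \<ge> a" using a by auto
    then have "\<bar>1 - a / max y a\<bar> \<le> 1" using a by (simp add: abs_le_iff)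
    then have "\<bar>1 - a / max y a\<bar> / max y a \<le> 1 / a" using m a by (intro frac_le) auto
    then show ?thesis using m by (simp add: \<psi>_def abs_divide)
  qed
  have lip: "\<bar>\<psi> y - \<psi> z\<bar> \<le> 3 / a\<^sup>2 * \<bar>y - z\<bar>" for y z
  proof -
    define M N where "M = max y a" and "N = max z a"
    have M: "M \<ge> a" "M > 0" and N: "N \<ge> a" "N > 0" using a by (auto simp: M_def N_def)
    have inv: "1 / M \<le> 1 / a" "1 / N \<le> 1 / a" "0 < 1 / M" "0 < 1 / N"
      using M N a by (auto intro: divide_left_mono)
    have "\<psi> y - \<psi> z = (1 / M - 1 / N) * (1 - a * (1 / M + 1 / N))"
    proof -
      have "\<psi> y = 1 / M - a * (1 / M) * (1 / M)" "\<psi> z = 1 / N - a * (1 / N) * (1 / N)"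
        by (simp_all add: \<psi>_def M_def N_def diff_divide_distrib)
      then show ?thesis by (simp only: left_diff_distrib right_diff_distrib distrib_left mult_1_right mult_ac)
    qed
    also have "1 / M - 1 / N = (N - M) * (1 / M) * (1 / N)" using M N by (simp add: divide_simps)
    finally have eq: "\<bar>\<psi> y - \<psi> z\<bar> = \<bar>N - M\<bar> * (1 / M) * (1 / N) * \<bar>1 - a * (1 / M + 1 / N)\<bar>"
      using inv by (simp add: abs_mult)
    have "a * (1 / M + 1 / N) \<le> a * (1 / a + 1 / a)" using inv a by (intro mult_left_mono) auto
    moreover have "0 \<le> a * (1 / M + 1 / N)" using inv a by (intro mult_nonneg_nonneg) auto
    moreover have "a * (1 / a + 1 / a) = 2" using a by simp
    ultimately have "\<bar>1 - a * (1 / M + 1 / N)\<bar> \<le> 3" by linarith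
    moreover have "\<bar>N - M\<bar> \<le> \<bar>y - z\<bar>" unfolding M_def N_def by linarith
    ultimately have "\<bar>\<psi> y - \<psi> z\<bar> \<le> \<bar>y - z\<bar> * (1 / a) * (1 / a) * 3"
      unfolding eq using inv a by (intro mult_mono) auto
    then show ?thesis by (simp add: power2_eq_square mult_ac)
  qed
  show ?thesis using drift_test[OF k _ bnd lip, unfolded eq] by simp
qed

text \<open>
  This is \<open>drift_test\<close> with \<open>\<psi>(y) = 1 / max y a\<close>, which cancels the numerator of the choice
  probability.
\<close>

lemma inverse_mass_test:
  assumes k: "k \<in> {1..K}"
  shows "\<bar>E (\<lambda>w. lam k / D w - x k w / u k w)\<bar> \<le>
    1 / a\<^sup>2 * lam k / real m + lam k * (2 * (1 / a\<^sup>2) * Lam / b)"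
proof -
  define \<psi> where "\<psi> y = 1 / max y a" for y
  have eq: "(lam k * pr k w - x k w) * \<psi> (x k w) = lam k / D w - x k w / u k w" for w
    using u_pos[of k w] D_pos[of w] by (simp add: \<psi>_def share_def weight_def[symmetric] diff_divide_distrib)
  have bnd: "\<bar>\<psi> y\<bar> \<le> 1 / a" for y
  proof -
    have "max y a \<ge> a" by simp
    then have "1 / max y a \<le> 1 / a" "0 \<le> 1 / max y a" using a by (auto intro: divide_left_mono)
    then show ?thesis by (simp add: \<psi>_def)
  qed
  have lip: "\<bar>\<psi> y - \<psi> z\<bar> \<le> 1 / a\<^sup>2 * \<bar>y - z\<bar>" for y z
  proof -
    define M N where "M = max y a" and "N = max z a"
    have M: "M \<ge> a" "M > 0" and N: "N \<ge> a" "N > 0" using a by (auto simp: M_def N_def)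
    have inv: "1 / M \<le> 1 / a" "1 / N \<le> 1 / a" "0 < 1 / M" "0 < 1 / N"
      using M N a by (auto intro: divide_left_mono)
    have "1 / M - 1 / N = (N - M) * (1 / M) * (1 / N)" using M N by (simp add: divide_simps)
    then have "\<bar>\<psi> y - \<psi> z\<bar> = \<bar>N - M\<bar> * (1 / M) * (1 / N)"
      using inv by (simp add: \<psi>_def M_def[symmetric] N_def[symmetric] abs_mult)
    also have "\<dots> \<le> \<bar>y - z\<bar> * (1 / a) * (1 / a)"
    proof -
      have "\<bar>N - M\<bar> \<le> \<bar>y - z\<bar>" unfolding M_def N_def by linarith
      then show ?thesis using inv a by (intro mult_mono) auto
    qed
    finally show ?thesis by (simp add: power2_eq_square mult_ac)
  qed
  show ?thesis using drift_test[OF k _ bnd lip, unfolded eq] by simp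
qed

lemma share_near:
  assumes k: "k \<in> {1..K}"
  shows "\<bar>pr k w - a / D w\<bar> \<le> s k w"
proof -
  have "pr k w - a / D w = (u k w - a) / D w" by (simp add: share_def diff_divide_distrib)
  moreover have "(u k w - a) / D w \<ge> 0" using u_ge(1)[of k w] D_pos[of w] by simp
  moreover have "(u k w - a) / D w \<le> (u k w - a) / u k w"
    using u_ge(1)[of k w] u_le_D[OF k, of w] u_pos[of k w] by (intro divide_left_mono) (auto intro: mult_pos_pos D_pos)
  moreover have "(u k w - a) / u k w = s k w"
    using u_pos[of k w] by (simp add: excess_def diff_divide_distrib)
  ultimately show ?thesis by linarith
qed

text \<open>
  If \<open>D\<close> always exceeds \<open>lam k\<close>, the factor \<open>1 - lam k / D\<close> in \<open>excess_test\<close> is bounded below.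
\<close>

lemma expectation_excess_high:
  assumes high: "lam k < real K * a" and k: "k \<in> {1..K}"
  shows "(1 - lam k / (real K * a)) * E (s k) \<le>
    3 / a\<^sup>2 * lam k / real m + lam k * (2 * (3 / a\<^sup>2) * Lam / b)"
proof -
  have i: "integrable (measure_pmf \<pi>) (\<lambda>w. c * s k w)" for c
    by (intro Bochner_Integration.integrable_mult_right integrable_pmf_bounded[OF excess_bounds(3)])
  have bD: "\<bar>(1 - lam k / D w) * s k w\<bar> \<le> 1 * 1" for w
  proof -
    have "lam k / D w \<le> 1" "lam k / D w \<ge> 0"
      using high D_ge[of w] D_pos[of w] lam[OF k] by (auto simp: divide_le_eq)
    then show ?thesis unfolding abs_mult by (intro mult_mono excess_bounds) auto
  qed
  have "(1 - lam k / (real K * a)) * E (s k) = E (\<lambda>w. (1 - lam k / (real K * a)) * s k w)" by simp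
  also have "\<dots> \<le> E (\<lambda>w. (1 - lam k / D w) * s k w)"
  proof (intro E_mono mult_right_mono i)
    show "integrable (measure_pmf \<pi>) (\<lambda>w. (1 - lam k / D w) * s k w)"
      by (rule integrable_pmf_bounded[OF bD])
    fix w
    have "lam k / D w \<le> lam k / (real K * a)"
      by (rule frac_le) (use lam[OF k] Ka_pos D_ge[of w] in auto)
    then show "1 - lam k / (real K * a) \<le> 1 - lam k / D w" by simp
  qed (rule excess_bounds)
  also have "\<dots> = - E (\<lambda>w. (lam k / D w - 1) * s k w)"
    unfolding Bochner_Integration.integral_minus[symmetric]
    by (intro Bochner_Integration.integral_cong refl) (simp add: algebra_simps)
  also have "\<dots> \<le> 3 / a\<^sup>2 * lam k / real m + lam k * (2 * (3 / a\<^sup>2) * Lam / b)"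
    using excess_test[OF k] by linarith
  finally show ?thesis .
qed

lemma share_near_uniform:
  assumes k: "k \<in> {1..K}"
  shows "\<bar>E (pr k) - 1 / real K\<bar> \<le> E (s k) + (\<Sum>i\<in>{1..K}. E (s i))"
proof -
  have ie: "integrable (measure_pmf \<pi>) (s i)" for i by (rule integrable_pmf_bounded[OF excess_bounds(3)])
  have pw: "\<bar>pr k w - 1 / real K\<bar> \<le> s k w + (\<Sum>i\<in>{1..K}. s i w)" for w
  proof -
    have eq: "1 / real K - a / D w = (D w - real K * a) / (real K * D w)"
      using K D_pos[of w] by (simp add: divide_simps)
    have "0 \<le> (D w - real K * a) / (real K * D w)"
      using D_ge[of w] D_pos[of w] by (intro divide_nonneg_nonneg mult_nonneg_nonneg) auto
    then have r0: "0 \<le> 1 / real K - a / D w" unfolding eq .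
    have "1 / real K - a / D w \<le> (D w - real K * a) / D w"
      unfolding eq
    proof -
      have "1 * D w \<le> real K * D w" using K D_pos[of w] by (intro mult_right_mono) auto
      then show "(D w - real K * a) / (real K * D w) \<le> (D w - real K * a) / D w"
        using D_ge[of w] D_pos[of w] K by (intro divide_left_mono mult_pos_pos) auto
    qed
    also have "(D w - real K * a) / D w = (\<Sum>i\<in>{1..K}. pr i w - a / D w)"
      unfolding sum_subtractf sum_pr using D_pos[of w] by (simp add: diff_divide_distrib)
    also have "\<dots> \<le> (\<Sum>i\<in>{1..K}. s i w)"
      using share_near by (intro sum_mono) (simp add: abs_le_iff)
    finally show ?thesis using r0 using share_near[OF k, of w] by linarith
  qed
  have "\<bar>E (pr k) - 1 / real K\<bar> = \<bar>E (\<lambda>w. pr k w - 1 / real K)\<bar>" using integrable_pr[OF k] by simp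
  also have "\<dots> \<le> E (\<lambda>w. \<bar>pr k w - 1 / real K\<bar>)" by (rule integral_abs_bound)
  also have "\<dots> \<le> E (\<lambda>w. s k w + (\<Sum>i\<in>{1..K}. s i w))"
    using integrable_pr[OF k] ie pw by (intro E_mono) auto
  also have "\<dots> = E (s k) + (\<Sum>i\<in>{1..K}. E (s i))" using ie by simp
  finally show ?thesis .
qed

text \<open>
  Since \<open>x k \<le> u k\<close>, the test \<open>inverse_mass_test\<close> for an action with the maximal rate \<open>l\<close> bounds the mean
  of \<open>1 - l / D\<close> from below by nearly \<open>0\<close>.  Its positive part is small unless \<open>D\<close> overshoots \<open>l\<close>, and
  \<open>\<bar>z\<bar> = 2 * max 0 z - z\<close>.
\<close>

lemma mass_concentration:
  assumes l: "l \<ge> real K * a" and lam_l: "\<And>k. k \<in> {1..K} \<Longrightarrow> lam k \<le> l"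
    and k: "k \<in> {1..K}" "lam k = l" and \<delta>: "\<delta> > 0"
  shows "E (\<lambda>w. \<bar>1 - l / D w\<bar>) \<le> 4 * \<delta> / l + 2 * E (\<lambda>w. if D w \<ge> l + 2 * \<delta> then 1 else 0)
    + (1 / a\<^sup>2 * l / real m + l * (2 * (1 / a\<^sup>2) * Lam / b))"
proof -
  have l0: "l > 0" using l Ka_pos by linarith
  let ?z = "\<lambda>w. 1 - l / D w"
  let ?i = "\<lambda>w. if D w \<ge> l + 2 * \<delta> then 1 else 0 :: real"
  have lD: "0 \<le> l / D w" "l / D w \<le> l / (real K * a)" for w
    using l0 D_pos[of w] D_ge[of w] Ka_pos by (auto intro!: divide_left_mono mult_pos_pos)
  have zb: "\<bar>?z w\<bar> \<le> 1 + l / (real K * a)" for w using lD[of w] by linarith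
  have iz: "integrable (measure_pmf \<pi>) ?z" by (rule integrable_pmf_bounded[OF zb])
  have ii: "integrable (measure_pmf \<pi>) ?i" by (rule integrable_pmf_bounded[where B = 1]) auto
  have pw: "\<bar>?z w\<bar> \<le> 4 * \<delta> / l + 2 * ?i w - ?z w" for w
  proof -
    have "max 0 (?z w) \<le> 2 * \<delta> / l + ?i w"
    proof (cases "D w \<ge> l + 2 * \<delta>")
      case True
      moreover have "0 \<le> 2 * \<delta> / l" using l0 \<delta> by simp
      ultimately show ?thesis using lD(1)[of w] by simp
    next
      case False
      have "l / (l + 2 * \<delta>) \<le> l / D w"
        using False D_pos[of w] l0 \<delta> by (intro divide_left_mono mult_pos_pos) auto
      moreover have "1 - l / (l + 2 * \<delta>) = 2 * \<delta> / (l + 2 * \<delta>)" using l0 \<delta> by (simp add: field_simps)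
      moreover have "2 * \<delta> / (l + 2 * \<delta>) \<le> 2 * \<delta> / l"
        using l0 \<delta> by (intro divide_left_mono mult_pos_pos) auto
      moreover have "0 \<le> 2 * \<delta> / l" using l0 \<delta> by simp
      ultimately have "max 0 (?z w) \<le> 2 * \<delta> / l" by linarith
      then show ?thesis using False by simp
    qed
    then show ?thesis by (simp add: max_def abs_if split: if_splits)
  qed
  have "- E ?z \<le> 1 / a\<^sup>2 * l / real m + l * (2 * (1 / a\<^sup>2) * Lam / b)"
  proof -
    have xu: "0 \<le> x k w / u k w" "x k w / u k w \<le> 1" for w
      using x_nonneg[of k w] u_pos[of k w] u_ge(2)[of k w] by auto
    have ixu: "integrable (measure_pmf \<pi>) (\<lambda>w. l / D w - x k w / u k w)"
    proof (rule integrable_pmf_bounded)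
      show "\<bar>l / D w - x k w / u k w\<bar> \<le> 1 + l / (real K * a)" for w
        using lD[of w] xu[of w] by linarith
    qed
    have "- E ?z = E (\<lambda>w. - ?z w)" by (simp only: Bochner_Integration.integral_minus)
    also have "\<dots> \<le> E (\<lambda>w. l / D w - x k w / u k w)"
    proof (rule E_mono[OF _ ixu])
      show "integrable (measure_pmf \<pi>) (\<lambda>w. - ?z w)" using iz by (rule Bochner_Integration.integrable_minus)
      show "- ?z w \<le> l / D w - x k w / u k w" for w using xu(2)[of w] by linarith
    qed
    also have "\<dots> \<le> 1 / a\<^sup>2 * l / real m + l * (2 * (1 / a\<^sup>2) * Lam / b)"
      using inverse_mass_test[OF k(1)] unfolding k(2) by linarith
    finally show ?thesis .
  qed
  moreover have "E (\<lambda>w. \<bar>?z w\<bar>) \<le> E (\<lambda>w. 4 * \<delta> / l + 2 * ?i w - ?z w)"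
    using iz ii pw by (intro E_mono) auto
  moreover have "E (\<lambda>w. 4 * \<delta> / l + 2 * ?i w - ?z w) = 4 * \<delta> / l + 2 * E ?i - E ?z"
  proof -
    have "E (\<lambda>w. 4 * \<delta> / l + 2 * ?i w - ?z w) = E (\<lambda>w. 4 * \<delta> / l + 2 * ?i w) - E ?z"
      by (intro Bochner_Integration.integral_diff iz Bochner_Integration.integrable_add
          Bochner_Integration.integrable_mult_right ii) simp
    also have "E (\<lambda>w. 4 * \<delta> / l + 2 * ?i w) = 4 * \<delta> / l + 2 * E ?i"
      by (subst Bochner_Integration.integral_add) (simp_all add: ii)
    finally show ?thesis .
  qed
  ultimately show ?thesis by linarith
qed

text \<open>
  If \<open>D\<close> is close to \<open>l\<close>, the factor \<open>1 - lam k / D\<close> in \<open>excess_test\<close> is close to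
  \<open>1 - lam k / l\<close>.
\<close>

lemma expectation_excess_low:
  assumes k: "k \<in> {1..K}" and l: "l > 0" "lam k \<le> l"
  shows "(1 - lam k / l) * E (s k) \<le> E (\<lambda>w. \<bar>1 - l / D w\<bar>) +
    (3 / a\<^sup>2 * lam k / real m + lam k * (2 * (3 / a\<^sup>2) * Lam / b))"
proof -
  have ie: "integrable (measure_pmf \<pi>) (s k)" by (rule integrable_pmf_bounded[OF excess_bounds(3)])
  have cD: "0 \<le> c / D w" "c / D w \<le> c / (real K * a)" if "c > 0" for c w
    using that D_pos[of w] D_ge[of w] Ka_pos by (auto intro!: divide_left_mono mult_pos_pos)
  have iz: "integrable (measure_pmf \<pi>) (\<lambda>w. \<bar>1 - l / D w\<bar>)"
  proof (rule integrable_pmf_bounded)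
    show "\<bar>\<bar>1 - l / D w\<bar>\<bar> \<le> 1 + l / (real K * a)" for w using cD[OF l(1), of w] by linarith
  qed
  have it: "integrable (measure_pmf \<pi>) (\<lambda>w. (lam k / D w - 1) * s k w)"
  proof (rule integrable_pmf_bounded)
    fix w
    have "\<bar>lam k / D w - 1\<bar> \<le> 1 + lam k / (real K * a)" using cD[OF lam[OF k], of w] by linarith
    then show "\<bar>(lam k / D w - 1) * s k w\<bar> \<le> (1 + lam k / (real K * a)) * 1"
      unfolding abs_mult using excess_bounds[of k w] lam[OF k] Ka_pos by (intro mult_mono) auto
  qed
  have pw: "(1 - lam k / l) * s k w \<le> \<bar>1 - l / D w\<bar> - (lam k / D w - 1) * s k w" for w
  proof -
    have "(1 - lam k / l) + (lam k / D w - 1) = - (lam k / l) * (1 - l / D w)"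
      using l D_pos[of w] by (simp add: field_simps)
    then have "(1 - lam k / l) * s k w + (lam k / D w - 1) * s k w
        = - (lam k / l) * (1 - l / D w) * s k w"
      by (simp only: distrib_right[symmetric])
    also have "\<dots> \<le> \<bar>- (lam k / l) * (1 - l / D w) * s k w\<bar>" by (rule abs_ge_self)
    also have "\<dots> \<le> 1 * \<bar>1 - l / D w\<bar> * 1"
      unfolding abs_mult using l lam[OF k] excess_bounds[of k w] by (intro mult_mono) auto
    finally show ?thesis by simp
  qed
  have "(1 - lam k / l) * E (s k) = E (\<lambda>w. (1 - lam k / l) * s k w)" by simp
  also have "\<dots> \<le> E (\<lambda>w. \<bar>1 - l / D w\<bar> - (lam k / D w - 1) * s k w)"
    by (intro E_mono Bochner_Integration.integrable_mult_right ie Bochner_Integration.integrable_diff iz it pw)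
  also have "\<dots> = E (\<lambda>w. \<bar>1 - l / D w\<bar>) - E (\<lambda>w. (lam k / D w - 1) * s k w)"
    by (rule Bochner_Integration.integral_diff[OF iz it])
  finally show ?thesis using excess_test[OF k] by linarith
qed

lemma share_near_ratio:
  assumes k: "k \<in> {1..K}" and l: "l > 0"
  shows "\<bar>E (pr k) - a / l\<bar> \<le> E (s k) + a / l * E (\<lambda>w. \<bar>1 - l / D w\<bar>)"
proof -
  have ie: "integrable (measure_pmf \<pi>) (s k)" by (rule integrable_pmf_bounded[OF excess_bounds(3)])
  have iz: "integrable (measure_pmf \<pi>) (\<lambda>w. \<bar>1 - l / D w\<bar>)"
  proof (rule integrable_pmf_bounded)
    fix w
    have "0 \<le> l / D w" "l / D w \<le> l / (real K * a)"
      using l D_pos[of w] D_ge[of w] Ka_pos by (auto intro!: divide_left_mono mult_pos_pos)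
    then show "\<bar>\<bar>1 - l / D w\<bar>\<bar> \<le> 1 + l / (real K * a)" by linarith
  qed
  have pw: "\<bar>pr k w - a / l\<bar> \<le> s k w + a / l * \<bar>1 - l / D w\<bar>" for w
  proof -
    have "a / D w - a / l = - (a / l) * (1 - l / D w)" using l D_pos[of w] by (simp add: field_simps)
    then have "\<bar>a / D w - a / l\<bar> = a / l * \<bar>1 - l / D w\<bar>" using a l by (simp add: abs_mult)
    then show ?thesis using share_near[OF k, of w] by linarith
  qed
  have "\<bar>E (pr k) - a / l\<bar> = \<bar>E (\<lambda>w. pr k w - a / l)\<bar>" using integrable_pr[OF k] by simp
  also have "\<dots> \<le> E (\<lambda>w. \<bar>pr k w - a / l\<bar>)" by (rule integral_abs_bound)
  also have "\<dots> \<le> E (\<lambda>w. s k w + a / l * \<bar>1 - l / D w\<bar>)"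
    using integrable_pr[OF k] ie iz pw by (intro E_mono) auto
  also have "\<dots> = E (s k) + a / l * E (\<lambda>w. \<bar>1 - l / D w\<bar>)" using ie iz by simp
  finally show ?thesis .
qed

lemma inert_weight_pos: "wt k > 0"
proof -
  have "max (lam k) a > 0" using a by auto
  moreover have "(real K - 1) * a \<ge> 0" using K a by simp
  ultimately show ?thesis by (simp add: inert_weight_def)
qed

text \<open>
  The choice probabilities are Lipschitz functions of the scaled rewards.  Compared with them is their
  value at the point whose only nonzero coordinate is \<open>lam c\<close> for the current choice \<open>c\<close>: it is
  \<open>a / wt c\<close> for each action, plus \<open>(wt c - K * a) / wt c\<close> for \<open>c\<close> itself.
\<close>

lemma share_near_inert:
  assumes w: "w \<in> states K" and k: "k \<in> {1..K}"
  shows "\<bar>pr k w - ((\<Sum>c\<in>{1..K}. active c w * (a / wt c)) +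
      active k w * ((wt k - real K * a) / wt k))\<bar>
    \<le> 2 / (real K * a) * (\<Sum>i\<in>{1..K}. \<bar>x i w - lam i * active i w\<bar>)"
proof -
  let ?c = "snd w"
  let ?v = "\<lambda>i. max (lam i * active i w) a"
  let ?s = "\<Sum>i\<in>{1..K}. \<bar>x i w - lam i * active i w\<bar>"
  have c: "?c \<in> {1..K}" by (rule snd_in[OF w])
  have v: "?v i = (if i = ?c then max (lam ?c) a else a)" for i using a by (simp add: active_def)
  have sv: "(\<Sum>i\<in>{1..K}. ?v i) = wt ?c"
  proof -
    have "(\<Sum>i\<in>{1..K}. ?v i) = ?v ?c + (\<Sum>i\<in>{1..K} - {?c}. ?v i)" by (rule sum.remove[OF _ c]) simp
    also have "(\<Sum>i\<in>{1..K} - {?c}. ?v i) = (\<Sum>i\<in>{1..K} - {?c}. a)" by (intro sum.cong) (auto simp: v)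
    also have "\<dots> = (real K - 1) * a" using c K by (simp add: of_nat_diff)
    finally show ?thesis by (simp add: v inert_weight_def)
  qed
  have "(\<Sum>d\<in>{1..K}. active d w * (a / wt d)) = (\<Sum>d\<in>{1..K}. if ?c = d then a / wt d else 0)"
    by (intro sum.cong) (auto simp: active_def)
  also have "\<dots> = a / wt ?c" using c by (simp del: One_nat_def)
  finally have sumc: "(\<Sum>d\<in>{1..K}. active d w * (a / wt d)) = a / wt ?c" .
  have "(\<Sum>d\<in>{1..K}. active d w * (a / wt d)) +
      active k w * ((wt k - real K * a) / wt k) = ?v k / wt ?c"
  proof (cases "k = ?c")
    case True
    have "a + (wt k - real K * a) = max (lam k) a"
      by (simp add: inert_weight_def algebra_simps)
    then show ?thesis unfolding sumc using True by (simp add: v active_def add_divide_distrib[symmetric])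
  next
    case False
    then show ?thesis unfolding sumc using a by (auto simp: v active_def max_def)
  qed
  moreover have "\<bar>pr k w - ?v k / wt ?c\<bar> \<le> 2 / (real K * a) * ?s"
  proof -
    have vpos: "wt ?c > 0" by (rule inert_weight_pos)
    have uv: "\<bar>u i w - ?v i\<bar> \<le> \<bar>x i w - lam i * active i w\<bar>" for i unfolding weight_def by linarith
    have 1: "\<bar>u k w - ?v k\<bar> \<le> ?s"
      using uv[of k] member_le_sum[OF k, of "\<lambda>i. \<bar>x i w - lam i * active i w\<bar>"] by force
    have "\<bar>wt ?c - D w\<bar> = \<bar>\<Sum>i\<in>{1..K}. ?v i - u i w\<bar>"
      unfolding sv[symmetric] mass_def by (simp only: sum_subtractf)
    also have "\<dots> \<le> (\<Sum>i\<in>{1..K}. \<bar>?v i - u i w\<bar>)" by (rule sum_abs)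
    also have "\<dots> \<le> ?s" using uv by (intro sum_mono) (simp add: abs_minus_commute)
    finally have 2: "\<bar>wt ?c - D w\<bar> \<le> ?s" .
    have s0: "?s \<ge> 0" by (intro sum_nonneg) auto
    have v01: "0 \<le> ?v k / wt ?c" "?v k / wt ?c \<le> 1"
    proof -
      have v0: "0 \<le> ?v i" for i using a by (simp add: le_max_iff_disj)
      show "0 \<le> ?v k / wt ?c" using v0 vpos by simp
      have "?v k \<le> wt ?c" unfolding sv[symmetric] by (rule member_le_sum[OF k]) (use v0 in auto)
      then show "?v k / wt ?c \<le> 1" using vpos by simp
    qed
    have "pr k w - ?v k / wt ?c = (u k w - ?v k) / D w + ?v k / wt ?c * ((wt ?c - D w) / D w)"
      using vpos D_pos[of w] by (simp add: share_def field_simps)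
    then have "\<bar>pr k w - ?v k / wt ?c\<bar> \<le> \<bar>(u k w - ?v k) / D w\<bar> +
        \<bar>?v k / wt ?c * ((wt ?c - D w) / D w)\<bar>" by (metis abs_triangle_ineq)
    also have "\<dots> \<le> ?s / D w + 1 * (?s / D w)"
    proof (intro add_mono)
      show "\<bar>(u k w - ?v k) / D w\<bar> \<le> ?s / D w" using 1 D_pos[of w] by (simp add: abs_divide divide_right_mono)
      have "\<bar>(wt ?c - D w) / D w\<bar> \<le> ?s / D w" using 2 D_pos[of w] by (simp add: abs_divide divide_right_mono)
      then show "\<bar>?v k / wt ?c * ((wt ?c - D w) / D w)\<bar> \<le> 1 * (?s / D w)"
        unfolding abs_mult[of "?v k / wt ?c"] using v01 by (intro mult_mono) auto
    qed
    also have "\<dots> = 2 * ?s / D w" by simp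
    also have "\<dots> \<le> 2 * ?s / (real K * a)"
      by (rule frac_le) (use s0 D_ge[of w] Ka_pos in auto)
    finally show ?thesis by (simp only: times_divide_eq_left)
  qed
  ultimately show ?thesis by (simp only:)
qed

text \<open>
  Taking expectations in \<open>share_near_inert\<close> gives, up to an error,
  \<open>P\<^sub>k = a * Z + P\<^sub>k * (1 - K * a / wt k)\<close> for \<open>P\<^sub>k = E (active k)\<close> and \<open>Z = (\<Sum>c. P\<^sub>c / wt c)\<close>.  Hence
  \<open>P\<^sub>k / wt k\<close> hardly depends on \<open>k\<close>.
\<close>

lemma inert_balance:
  assumes k: "k \<in> {1..K}"
  shows "\<bar>E (active k) / wt k - (\<Sum>c\<in>{1..K}. E (active c) / wt c) / real K\<bar>
    \<le> 2 / (real K * a)\<^sup>2 * (\<Sum>i\<in>{1..K}. sqrt ((lam i)\<^sup>2 * b + lam i / real m))"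
proof -
  let ?T = "\<lambda>w. (\<Sum>c\<in>{1..K}. active c w * (a / wt c)) +
      active k w * ((wt k - real K * a) / wt k)"
  let ?Z = "\<Sum>c\<in>{1..K}. E (active c) / wt c"
  let ?s = "\<lambda>w. \<Sum>i\<in>{1..K}. \<bar>x i w - lam i * active i w\<bar>"
  let ?R = "\<Sum>i\<in>{1..K}. sqrt ((lam i)\<^sup>2 * b + lam i / real m)"
  have iT: "integrable (measure_pmf \<pi>) ?T"
    by (intro Bochner_Integration.integrable_add Bochner_Integration.integrable_sum
        Bochner_Integration.integrable_mult_left integrable_active)
  have is1: "integrable (measure_pmf \<pi>) (\<lambda>w. \<bar>x i w - lam i * active i w\<bar>)" if "i \<in> {1..K}" for i
    using integrable_x[OF that] integrable_active[of i] by simp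
  have "\<bar>E (pr k) - E ?T\<bar> = \<bar>E (\<lambda>w. pr k w - ?T w)\<bar>"
    by (simp only: Bochner_Integration.integral_diff[OF integrable_pr[OF k] iT])
  also have "\<dots> \<le> E (\<lambda>w. \<bar>pr k w - ?T w\<bar>)" by (rule integral_abs_bound)
  also have "\<dots> \<le> E (\<lambda>w. 2 / (real K * a) * ?s w)"
    by (intro E_mono share_near_inert k integrable_abs Bochner_Integration.integrable_diff integrable_pr iT
        Bochner_Integration.integrable_mult_right Bochner_Integration.integrable_sum is1)
  also have "\<dots> = 2 / (real K * a) * (\<Sum>i\<in>{1..K}. E (\<lambda>w. \<bar>x i w - lam i * active i w\<bar>))"
    by (subst integral_mult_right_zero, subst Bochner_Integration.integral_sum) (simp_all only: is1)
  also have "\<dots> \<le> 2 / (real K * a) * ?R"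
    using Ka_pos by (intro mult_left_mono sum_mono abs_deviation) auto
  finally have main: "\<bar>E (pr k) - E ?T\<bar> \<le> 2 / (real K * a) * ?R" .
  have "E ?T = (\<Sum>c\<in>{1..K}. E (\<lambda>w. active c w * (a / wt c))) +
      E (\<lambda>w. active k w * ((wt k - real K * a) / wt k))"
    by (subst Bochner_Integration.integral_add; (subst Bochner_Integration.integral_sum)?)
      (intro Bochner_Integration.integrable_sum Bochner_Integration.integrable_mult_left integrable_active refl)+
  also have "\<dots> = a * ?Z + E (active k) * ((wt k - real K * a) / wt k)"
    by (simp add: sum_distrib_left mult.commute)
  finally have ET: "E ?T = a * ?Z + E (active k) * ((wt k - real K * a) / wt k)" .
  have eq: "(wt k - real K * a) / wt k = 1 - real K * a / wt k"
    using inert_weight_pos[of k] by (simp add: diff_divide_distrib)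
  have "E (pr k) - E ?T = real K * a * (E (active k) / wt k - ?Z / real K)"
    unfolding ET unfolding eq mean_active[OF k, symmetric] using K by (simp add: algebra_simps)
  then have "real K * a * \<bar>E (active k) / wt k - ?Z / real K\<bar> \<le> 2 / (real K * a) * ?R"
    using main a by (simp add: abs_mult)
  then have "\<bar>E (active k) / wt k - ?Z / real K\<bar> \<le> 2 / (real K * a) * ?R / (real K * a)"
    using Ka_pos by (simp add: pos_le_divide_eq mult.commute)
  then show ?thesis by (simp add: power2_eq_square)
qed

end

section \<open>Limits of the stationary distributions\<close>

context reward_process
begin

text \<open>
  This collects what the limits require of the process: the distribution \<open>\<pi>\<close> and its balance equation.
\<close>

lemma stationary_summary:
  "\<exists>\<pi>. (\<forall>\<sigma>. stationary_distribution (states K) P W \<sigma> \<longleftrightarrow> \<sigma> = \<pi>) \<and>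
    (\<forall>\<mu>. steady_state_distribution K m P W \<mu> \<longleftrightarrow> \<mu> = map_pmf (\<lambda>w k. scaled m k w) \<pi>) \<and>
    (\<forall>a. \<alpha> = a * real m \<longrightarrow> stationary_reward K m lam \<beta> a \<pi>)"
proof -
  obtain \<pi> where \<pi>: "invariant \<pi>" using unique_invariant by blast
  have "stationary_reward K m lam \<beta> a \<pi>" if a: "\<alpha> = a * real m" for a
  proof
    show "K \<ge> 1" "m \<ge> 1" "\<beta> > 0" by (fact K m \<beta>)+
    show "lam k > 0" if "k \<in> {1..K}" for k using lam that .
    show "a > 0" using \<alpha> m unfolding a by (simp add: zero_less_mult_iff)
    show "set_pmf \<pi> \<subseteq> states K" using \<pi> by (simp add: invariant_def)
    show "integrable (measure_pmf \<pi>) f"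
      if "\<And>w. w \<in> states K \<Longrightarrow> \<bar>f w\<bar> \<le> L * (1 + real (total_reward K w)) ^ 3" for f L
      by (rule integrable_polynomial[OF \<pi> that])
    show "measure_pmf.expectation \<pi> (reward_gen K lam \<beta> (a * real m) m f) = 0"
      if "\<And>w. w \<in> states K \<Longrightarrow> \<bar>f w\<bar> \<le> L * (1 + real (total_reward K w))\<^sup>2" for f L
      using expectation_reward_gen[OF \<pi> that] unfolding a .
  qed
  moreover have "stationary_distribution (states K) P W \<sigma> \<longleftrightarrow> \<sigma> = \<pi>" for \<sigma>
    using unique_invariant \<pi> by (auto simp: stationary_iff_invariant)
  moreover have "steady_state_distribution K m P W \<mu> \<longleftrightarrow> \<mu> = map_pmf (\<lambda>w k. scaled m k w) \<pi>" for \<mu>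
    unfolding scaled_def by (rule steady_state_iff[OF \<pi>])
  ultimately show ?thesis by blast
qed

end

lemma err_tendsto_0:
  assumes "filterlim (\<lambda>m. real m * \<beta> m) at_top sequentially"
  shows "(\<lambda>m. C / real m + c * (C' / (real m * \<beta> m))) \<longlonglongrightarrow> 0"
proof -
  have "(\<lambda>m. C / real m + c * (C' / (real m * \<beta> m))) \<longlonglongrightarrow> 0 + c * 0"
    by (intro tendsto_intros tendsto_divide_0[OF tendsto_const] filterlim_at_top_imp_at_infinity
        filterlim_real_sequentially assms)
  then show ?thesis by simp
qed

locale reward_limit =
  fixes K :: nat and lam \<beta> :: "nat \<Rightarrow> real" and a :: real and \<pi> :: "nat \<Rightarrow> state pmf"
  assumes equilibrium: "\<And>m. m \<ge> 1 \<Longrightarrow> stationary_reward K m lam (\<beta> m) a (\<pi> m)"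
begin

abbreviation E :: "nat \<Rightarrow> (state \<Rightarrow> real) \<Rightarrow> real" where
  "E m f \<equiv> measure_pmf.expectation (\<pi> m) f"

abbreviation Lam :: real where "Lam \<equiv> \<Sum>k\<in>{1..K}. lam k"

lemma K: "K \<ge> 1" and lam: "k \<in> {1..K} \<Longrightarrow> lam k > 0" and a: "a > 0"
  using equilibrium[of 1] unfolding stationary_reward_def by simp_all

lemma Ka_pos: "real K * a > 0" using K a by simp

lemma mean_scaled: "m \<ge> 1 \<Longrightarrow> k \<in> {1..K} \<Longrightarrow> E m (scaled m k) = lam k * E m (active k)"
  by (rule stationary_reward.mean_x[OF equilibrium])

lemma mean_share: "m \<ge> 1 \<Longrightarrow> k \<in> {1..K} \<Longrightarrow> E m (active k) = E m (share K m a k)"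
  by (rule stationary_reward.mean_active[OF equilibrium])

lemma mean_scaled_tendsto:
  assumes "(\<lambda>m. E m (active k)) \<longlonglongrightarrow> c" "k \<in> {1..K}"
  shows "(\<lambda>m. E m (scaled m k)) \<longlonglongrightarrow> lam k * c"
proof (rule Lim_transform_eventually[OF tendsto_mult_left[OF assms(1)]])
  show "\<forall>\<^sub>F m in sequentially. lam k * E m (active k) = E m (scaled m k)"
    using eventually_ge_at_top[of 1] by eventually_elim (rule mean_scaled[symmetric, OF _ assms(2)])
qed

lemma active_tendstoI:
  assumes k: "k \<in> {1..K}" and R: "R \<longlonglongrightarrow> 0"
    and le: "\<And>m. m \<ge> 1 \<Longrightarrow> \<bar>E m (share K m a k) - c\<bar> \<le> R m"
  shows "(\<lambda>m. E m (active k)) \<longlonglongrightarrow> c"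
proof -
  have "(\<lambda>m. E m (active k) - c) \<longlonglongrightarrow> 0"
  proof (rule Lim_null_comparison[OF _ R])
    show "\<forall>\<^sub>F m in sequentially. norm (E m (active k) - c) \<le> R m"
      using eventually_ge_at_top[of 1] by eventually_elim (use le mean_share k in simp)
  qed
  then show ?thesis by (simp add: LIM_zero_iff)
qed

text \<open>
  By \<open>inert_balance\<close> the probabilities are asymptotically proportional to \<open>inert_weight\<close>, and they sum
  to \<open>1\<close>.
\<close>

lemma deficient_limit:
  assumes b0: "(\<lambda>m. real m * \<beta> m) \<longlonglongrightarrow> 0" and k: "k \<in> {1..K}"
  shows "(\<lambda>m. E m (active k)) \<longlonglongrightarrow> inert_weight K lam a k / (\<Sum>i\<in>{1..K}. inert_weight K lam a i)"
proof -
  let ?wt = "inert_weight K lam a"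
  define Z where "Z m = (\<Sum>c\<in>{1..K}. E m (active c) / ?wt c) / real K" for m
  define R where "R m = 2 / (real K * a)\<^sup>2 * (\<Sum>i\<in>{1..K}. sqrt ((lam i)\<^sup>2 * (real m * \<beta> m) + lam i / real m))" for m
  have wt: "?wt i > 0" for i by (rule stationary_reward.inert_weight_pos[OF equilibrium[OF order_refl]])
  have "R \<longlonglongrightarrow> 2 / (real K * a)\<^sup>2 * (\<Sum>i\<in>{1..K}. sqrt ((lam i)\<^sup>2 * 0 + 0))"
    unfolding R_def by (intro tendsto_intros b0 lim_const_over_n)
  then have R0: "R \<longlonglongrightarrow> 0" by simp
  have dev: "(\<lambda>m. E m (active i) / ?wt i - Z m) \<longlonglongrightarrow> 0" if i: "i \<in> {1..K}" for i
  proof (rule Lim_null_comparison[OF _ R0])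
    show "\<forall>\<^sub>F m in sequentially. norm (E m (active i) / ?wt i - Z m) \<le> R m"
      using eventually_ge_at_top[of 1]
    proof eventually_elim
      case (elim m)
      show ?case unfolding Z_def R_def real_norm_def
        by (rule stationary_reward.inert_balance[OF equilibrium[OF elim] i])
    qed
  qed
  have S: "(\<Sum>i\<in>{1..K}. ?wt i) > 0" using wt K by (intro sum_pos) auto
  have "(\<lambda>m. \<Sum>i\<in>{1..K}. ?wt i * (E m (active i) / ?wt i - Z m)) \<longlonglongrightarrow> (\<Sum>i\<in>{1..K}. ?wt i * 0)"
    by (intro tendsto_intros dev)
  then have lim0: "(\<lambda>m. \<Sum>i\<in>{1..K}. ?wt i * (E m (active i) / ?wt i - Z m)) \<longlonglongrightarrow> 0" by simp
  have "(\<lambda>m. 1 - (\<Sum>i\<in>{1..K}. ?wt i) * Z m) \<longlonglongrightarrow> 0"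
  proof (rule Lim_transform_eventually[OF lim0])
    show "\<forall>\<^sub>F m in sequentially. (\<Sum>i\<in>{1..K}. ?wt i * (E m (active i) / ?wt i - Z m)) =
        1 - (\<Sum>i\<in>{1..K}. ?wt i) * Z m"
      using eventually_ge_at_top[of 1]
    proof eventually_elim
      case (elim m)
      have "?wt i * (E m (active i) / ?wt i - Z m) = E m (active i) - ?wt i * Z m" for i
        using wt[of i] by (simp add: right_diff_distrib)
      then have "(\<Sum>i\<in>{1..K}. ?wt i * (E m (active i) / ?wt i - Z m)) =
          (\<Sum>i\<in>{1..K}. E m (active i)) - (\<Sum>i\<in>{1..K}. ?wt i) * Z m"
        by (simp add: sum_subtractf sum_distrib_right)
      also have "(\<Sum>i\<in>{1..K}. E m (active i)) = 1"
        by (rule stationary_reward.sum_mean_active[OF equilibrium[OF elim]])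
      finally show ?case by simp
    qed
  qed
  then have "(\<lambda>m. (1 - (1 - (\<Sum>i\<in>{1..K}. ?wt i) * Z m)) / (\<Sum>i\<in>{1..K}. ?wt i)) \<longlonglongrightarrow>
      (1 - 0) / (\<Sum>i\<in>{1..K}. ?wt i)"
    using S by (intro tendsto_intros) auto
  then have Z: "Z \<longlonglongrightarrow> 1 / (\<Sum>i\<in>{1..K}. ?wt i)" using S by (simp del: One_nat_def)
  have "(\<lambda>m. ?wt k * (E m (active k) / ?wt k - Z m + Z m)) \<longlonglongrightarrow> ?wt k * (0 + 1 / (\<Sum>i\<in>{1..K}. ?wt i))"
    by (intro tendsto_intros dev[OF k] Z)
  then show ?thesis using wt[of k] by simp
qed

lemma excess_tendsto_0:
  assumes R: "R \<longlonglongrightarrow> 0" and c: "c > 0" and le: "\<And>m. m \<ge> 1 \<Longrightarrow> c * E m (excess m a k) \<le> R m"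
  shows "(\<lambda>m. E m (excess m a k)) \<longlonglongrightarrow> 0"
proof (rule Lim_null_comparison)
  show "(\<lambda>m. R m / c) \<longlonglongrightarrow> 0" using tendsto_divide[OF R tendsto_const[of c]] c by simp
  show "\<forall>\<^sub>F m in sequentially. norm (E m (excess m a k)) \<le> R m / c"
    using eventually_ge_at_top[of 1]
  proof eventually_elim
    case (elim m)
    have "E m (excess m a k) \<ge> 0"
      using stationary_reward.excess_bounds(1)[OF equilibrium[OF elim]] by (intro integral_nonneg_AE) auto
    then show ?case using le[OF elim] c by (simp add: pos_le_divide_eq mult.commute)
  qed
qed

lemma high_threshold_limit:
  assumes binf: "filterlim (\<lambda>m. real m * \<beta> m) at_top sequentially"
    and high: "\<And>k. k \<in> {1..K} \<Longrightarrow> lam k < real K * a" and k: "k \<in> {1..K}"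
  shows "(\<lambda>m. E m (active k)) \<longlonglongrightarrow> 1 / real K"
proof -
  have ex: "(\<lambda>m. E m (excess m a i)) \<longlonglongrightarrow> 0" if i: "i \<in> {1..K}" for i
  proof (rule excess_tendsto_0[OF err_tendsto_0[OF binf]])
    show "1 - lam i / (real K * a) > 0" using high[OF i] Ka_pos by simp
    show "(1 - lam i / (real K * a)) * E m (excess m a i) \<le>
        3 / a\<^sup>2 * lam i / real m + lam i * (2 * (3 / a\<^sup>2) * Lam / (real m * \<beta> m))" if "m \<ge> 1" for m
      by (rule stationary_reward.expectation_excess_high[OF equilibrium[OF that] high[OF i] i])
  qed
  show ?thesis
  proof (rule active_tendstoI[OF k])
    have "(\<lambda>m. E m (excess m a k) + (\<Sum>i\<in>{1..K}. E m (excess m a i))) \<longlonglongrightarrow> 0 + (\<Sum>i\<in>{1..K}. 0)"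
      by (intro tendsto_intros ex k)
    then show "(\<lambda>m. E m (excess m a k) + (\<Sum>i\<in>{1..K}. E m (excess m a i))) \<longlonglongrightarrow> 0" by simp
    show "\<bar>E m (share K m a k) - 1 / real K\<bar> \<le> E m (excess m a k) + (\<Sum>i\<in>{1..K}. E m (excess m a i))"
      if "m \<ge> 1" for m
      by (rule stationary_reward.share_near_uniform[OF equilibrium[OF that] k])
  qed
qed

lemma mass_tendsto:
  assumes binf: "filterlim (\<lambda>m. real m * \<beta> m) at_top sequentially"
    and l: "l \<ge> real K * a" and lam_l: "\<And>k. k \<in> {1..K} \<Longrightarrow> lam k \<le> l"
    and k: "k \<in> {1..K}" "lam k = l"
  shows "(\<lambda>m. E m (\<lambda>w. \<bar>1 - l / mass K m a w\<bar>)) \<longlonglongrightarrow> 0"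
proof (rule LIMSEQ_I)
  have l0: "l > 0" using l Ka_pos by linarith
  fix \<epsilon> :: real assume \<epsilon>: "\<epsilon> > 0"
  \<comment> \<open>makes the first term \<open>4 * \<delta> / l\<close> of \<open>mass_concentration\<close> equal to \<open>\<epsilon> / 2\<close>\<close>
  define \<delta> where "\<delta> = \<epsilon> * l / 8"
  have \<delta>: "\<delta> > 0" using \<epsilon> l0 by (simp add: \<delta>_def)
  let ?p = "\<lambda>m. E m (\<lambda>w. if mass K m a w \<ge> l + 2 * \<delta> then 1 else 0)"
  define c where "c = a * (\<delta> / (l + \<delta>)) * min 1 \<delta>"
  have c: "c > 0" using a \<delta> l0 by (simp add: c_def)
  define B where "B m = 2 * (1 + real K / \<delta>) * Lam / real m + Lam * (2 * (1 + real K / \<delta>) * Lam / (real m * \<beta> m))" for m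
  define R where "R m = 1 / a\<^sup>2 * l / real m + l * (2 * (1 / a\<^sup>2) * Lam / (real m * \<beta> m))" for m
  have B0: "B \<longlonglongrightarrow> 0" and R0: "R \<longlonglongrightarrow> 0" unfolding B_def R_def by (rule err_tendsto_0[OF binf])+
  have "(\<lambda>m. 4 * \<delta> / l + 2 * (B m / c) + R m) \<longlonglongrightarrow> 4 * \<delta> / l + 2 * (0 / c) + 0"
    using c by (intro tendsto_intros B0 R0) auto
  moreover have "4 * \<delta> / l + 2 * (0 / c) + 0 < \<epsilon>" using l0 \<epsilon> by (simp add: \<delta>_def)
  ultimately have "\<forall>\<^sub>F m in sequentially. 4 * \<delta> / l + 2 * (B m / c) + R m < \<epsilon>"
    by (rule order_tendstoD(2))
  then have "\<forall>\<^sub>F m in sequentially. norm (E m (\<lambda>w. \<bar>1 - l / mass K m a w\<bar>) - 0) < \<epsilon>"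
    using eventually_ge_at_top[of 1]
  proof eventually_elim
    case (elim m)
    have "c * ?p m \<le> B m"
      unfolding c_def B_def by (rule stationary_reward.overshoot_rare[OF equilibrium[OF elim(2)] l lam_l \<delta>])
    then have "?p m \<le> B m / c" using c by (simp add: pos_le_divide_eq mult.commute)
    moreover have "E m (\<lambda>w. \<bar>1 - l / mass K m a w\<bar>) \<le> 4 * \<delta> / l + 2 * ?p m + R m"
      unfolding R_def by (rule stationary_reward.mass_concentration[OF equilibrium[OF elim(2)] l lam_l k \<delta>])
    moreover have "0 \<le> E m (\<lambda>w. \<bar>1 - l / mass K m a w\<bar>)" by (intro integral_nonneg_AE) auto
    ultimately show ?case using elim(1) by simp
  qed
  then show "\<exists>no. \<forall>m\<ge>no. norm (E m (\<lambda>w. \<bar>1 - l / mass K m a w\<bar>) - 0) < \<epsilon>"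
    by (simp only: eventually_sequentially)
qed

lemma low_threshold_limit:
  assumes binf: "filterlim (\<lambda>m. real m * \<beta> m) at_top sequentially"
    and l: "lam 1 \<ge> real K * a" and lam_less: "\<And>k. k \<in> {2..K} \<Longrightarrow> lam k < lam 1" and k: "k \<in> {2..K}"
  shows "(\<lambda>m. E m (active k)) \<longlonglongrightarrow> a / lam 1"
proof -
  have one: "1 \<in> {1..K}" using K by simp
  have k1: "k \<in> {1..K}" using k by simp
  have l0: "lam 1 > 0" by (rule lam[OF one])
  have lam_le: "lam i \<le> lam 1" if "i \<in> {1..K}" for i
    using lam_less[of i] that by (cases "i = 1") (auto simp: less_imp_le)
  have M: "(\<lambda>m. E m (\<lambda>w. \<bar>1 - lam 1 / mass K m a w\<bar>)) \<longlonglongrightarrow> 0"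
    by (rule mass_tendsto[OF binf l lam_le one refl])
  have ex: "(\<lambda>m. E m (excess m a k)) \<longlonglongrightarrow> 0"
  proof (rule excess_tendsto_0)
    have "(\<lambda>m. E m (\<lambda>w. \<bar>1 - lam 1 / mass K m a w\<bar>) +
        (3 / a\<^sup>2 * lam k / real m + lam k * (2 * (3 / a\<^sup>2) * Lam / (real m * \<beta> m)))) \<longlonglongrightarrow> 0 + 0"
      by (intro tendsto_add M err_tendsto_0[OF binf])
    then show "(\<lambda>m. E m (\<lambda>w. \<bar>1 - lam 1 / mass K m a w\<bar>) +
        (3 / a\<^sup>2 * lam k / real m + lam k * (2 * (3 / a\<^sup>2) * Lam / (real m * \<beta> m)))) \<longlonglongrightarrow> 0" by simp
    show "1 - lam k / lam 1 > 0" using lam_less[OF k] l0 by simp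
    show "(1 - lam k / lam 1) * E m (excess m a k) \<le> E m (\<lambda>w. \<bar>1 - lam 1 / mass K m a w\<bar>) +
        (3 / a\<^sup>2 * lam k / real m + lam k * (2 * (3 / a\<^sup>2) * Lam / (real m * \<beta> m)))" if "m \<ge> 1" for m
      by (rule stationary_reward.expectation_excess_low[OF equilibrium[OF that] k1 l0 lam_le[OF k1]])
  qed
  show ?thesis
  proof (rule active_tendstoI[OF k1])
    have "(\<lambda>m. E m (excess m a k) + a / lam 1 * E m (\<lambda>w. \<bar>1 - lam 1 / mass K m a w\<bar>)) \<longlonglongrightarrow> 0 + a / lam 1 * 0"
      by (intro tendsto_intros ex M)
    then show "(\<lambda>m. E m (excess m a k) + a / lam 1 * E m (\<lambda>w. \<bar>1 - lam 1 / mass K m a w\<bar>)) \<longlonglongrightarrow> 0" by simp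
    show "\<bar>E m (share K m a k) - a / lam 1\<bar> \<le>
        E m (excess m a k) + a / lam 1 * E m (\<lambda>w. \<bar>1 - lam 1 / mass K m a w\<bar>)" if "m \<ge> 1" for m
      by (rule stationary_reward.share_near_ratio[OF equilibrium[OF that] k1 l0])
  qed
qed

text \<open>
  The first action takes what the others leave.
\<close>

lemma low_threshold_limit_first:
  assumes binf: "filterlim (\<lambda>m. real m * \<beta> m) at_top sequentially"
    and l: "lam 1 \<ge> real K * a" and lam_less: "\<And>k. k \<in> {2..K} \<Longrightarrow> lam k < lam 1"
  shows "(\<lambda>m. E m (active 1)) \<longlonglongrightarrow> 1 - (real K - 1) * (a / lam 1)"
proof (rule Lim_transform_eventually)
  have "(\<lambda>m. 1 - (\<Sum>k\<in>{2..K}. E m (active k))) \<longlonglongrightarrow> 1 - (\<Sum>k\<in>{2..K}. a / lam 1)"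
    by (intro tendsto_intros low_threshold_limit assms)
  also have "(\<Sum>k\<in>{2..K}. a / lam 1) = (real K - 1) * (a / lam 1)" using K by (simp add: of_nat_diff)
  finally show "(\<lambda>m. 1 - (\<Sum>k\<in>{2..K}. E m (active k))) \<longlonglongrightarrow> 1 - (real K - 1) * (a / lam 1)" .
  show "\<forall>\<^sub>F m in sequentially. 1 - (\<Sum>k\<in>{2..K}. E m (active k)) = E m (active 1)"
    using eventually_ge_at_top[of 1]
  proof eventually_elim
    case (elim m)
    have "{1..K} = insert 1 {2..K}" using K by auto
    then have "(\<Sum>k\<in>{1..K}. E m (active k)) = E m (active 1) + (\<Sum>k\<in>{2..K}. E m (active k))" by simp
    then show ?case using stationary_reward.sum_mean_active[OF equilibrium[OF elim]] by simp
  qed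
qed

end

theorem theorem2p2:
  fixes K :: nat and lam \<beta> :: "nat \<Rightarrow> real" and \<alpha>\<^sub>0 :: real
    and P :: "nat \<Rightarrow> state \<Rightarrow> 'w measure" and W :: "nat \<Rightarrow> real \<Rightarrow> 'w \<Rightarrow> state"
  assumes "K \<ge> 1"
    and "\<And>k. k \<in> {1..K} \<Longrightarrow> lam k > 0"
    and "\<And>k. k \<in> {2..K} \<Longrightarrow> lam k < lam 1"
    and "\<And>i j. 2 \<le> i \<Longrightarrow> i \<le> j \<Longrightarrow> j \<le> K \<Longrightarrow> lam j \<le> lam i"
    and "\<alpha>\<^sub>0 > 0"
    and "\<And>m. m \<ge> 1 \<Longrightarrow> \<beta> m > 0"
    and "\<And>m. m \<ge> 1 \<Longrightarrow>
      markov_jump_process (states K) (reward_rate K lam (\<beta> m) (\<alpha>\<^sub>0 * real m) m) (P m) (W m)"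
    and "filterlim (\<lambda>m. real m * \<beta> m) at_top sequentially \<or> (\<lambda>m. real m * \<beta> m) \<longlonglongrightarrow> 0"
  shows "(\<forall>m\<ge>1. (\<exists>!\<pi>. stationary_distribution (states K) (P m) (W m) \<pi>) \<and>
                (\<exists>!\<mu>. steady_state_distribution K m (P m) (W m) \<mu>)) \<and>
    (\<forall>m\<ge>1. \<forall>k\<in>{1..K}.
        integrable (measure_pmf (steady_state_law K m (P m) (W m))) (\<lambda>x. x k)) \<and>
    (\<exists>q :: nat \<Rightarrow> real.
      (\<forall>k\<in>{1..K}.
        (\<lambda>m. measure_pmf.expectation (steady_state_law K m (P m) (W m)) (\<lambda>x. x k)) \<longlonglongrightarrow> q k) \<and>
      (filterlim (\<lambda>m. real m * \<beta> m) at_top sequentially \<longrightarrow>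
        (\<alpha>\<^sub>0 \<le> lam 1 / real K \<longrightarrow>
          q 1 = lam 1 - (real K - 1) * \<alpha>\<^sub>0 \<and> (\<forall>k\<in>{2..K}. q k = lam k / lam 1 * \<alpha>\<^sub>0)) \<and>
        (\<alpha>\<^sub>0 > lam 1 / real K \<longrightarrow> (\<forall>k\<in>{1..K}. q k = lam k / real K))) \<and>
      ((\<lambda>m. real m * \<beta> m) \<longlonglongrightarrow> 0 \<longrightarrow>
        (\<forall>k\<in>{1..K}. q k = lam k * (max (lam k) \<alpha>\<^sub>0 + (real K - 1) * \<alpha>\<^sub>0) /
           (\<Sum>i\<in>{1..K}. max (lam i) \<alpha>\<^sub>0 + (real K - 1) * \<alpha>\<^sub>0))))"
proof -
  have "\<exists>\<pi>. (\<forall>\<sigma>. stationary_distribution (states K) (P m) (W m) \<sigma> \<longleftrightarrow> \<sigma> = \<pi>) \<and>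
      (\<forall>\<mu>. steady_state_distribution K m (P m) (W m) \<mu> \<longleftrightarrow> \<mu> = map_pmf (\<lambda>w k. scaled m k w) \<pi>) \<and>
      stationary_reward K m lam (\<beta> m) \<alpha>\<^sub>0 \<pi>" if m: "m \<ge> 1" for m
  proof -
    interpret reward_process K m lam "\<beta> m" "\<alpha>\<^sub>0 * real m" "P m" "W m"
      by unfold_locales (use assms m in auto)
    show ?thesis using stationary_summary by blast
  qed
  then obtain \<pi> where stat: "\<And>m \<sigma>. m \<ge> 1 \<Longrightarrow> stationary_distribution (states K) (P m) (W m) \<sigma> \<longleftrightarrow> \<sigma> = \<pi> m"
    and steady: "\<And>m \<mu>. m \<ge> 1 \<Longrightarrow>
      steady_state_distribution K m (P m) (W m) \<mu> \<longleftrightarrow> \<mu> = map_pmf (\<lambda>w k. scaled m k w) (\<pi> m)"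
    and equ: "\<And>m. m \<ge> 1 \<Longrightarrow> stationary_reward K m lam (\<beta> m) \<alpha>\<^sub>0 (\<pi> m)"
    by metis
  interpret reward_limit K lam \<beta> \<alpha>\<^sub>0 \<pi> by (rule reward_limit.intro, rule equ)
  have law: "steady_state_law K m (P m) (W m) = map_pmf (\<lambda>w k. scaled m k w) (\<pi> m)" if "m \<ge> 1" for m
    unfolding steady_state_law_def by (rule the_equality) (simp_all add: steady[OF that])
  have integ: "integrable (measure_pmf (steady_state_law K m (P m) (W m))) (\<lambda>x. x k)"
    if "m \<ge> 1" "k \<in> {1..K}" for m k
    unfolding law[OF that(1)] using stationary_reward.integrable_x[OF equ[OF that(1)] that(2)] by simp
  have lim: "(\<lambda>m. measure_pmf.expectation (steady_state_law K m (P m) (W m)) (\<lambda>x. x k)) \<longlonglongrightarrow> lam k * c"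
    if "(\<lambda>m. E m (active k)) \<longlonglongrightarrow> c" "k \<in> {1..K}" for k c
  proof (rule Lim_transform_eventually[OF mean_scaled_tendsto[OF that]])
    show "\<forall>\<^sub>F m in sequentially. E m (scaled m k) =
        measure_pmf.expectation (steady_state_law K m (P m) (W m)) (\<lambda>x. x k)"
      using eventually_ge_at_top[of 1] by eventually_elim (simp add: law)
  qed
  have first: "1 \<in> {1..K}" using assms(1) by simp
  have l1: "lam 1 > 0" by (rule assms(2)[OF first])
  have not_both: False
    if "filterlim (\<lambda>m. real m * \<beta> m) at_top sequentially" "(\<lambda>m. real m * \<beta> m) \<longlonglongrightarrow> 0"
    using that not_tendsto_and_filterlim_at_infinity[OF _ that(2) filterlim_at_top_imp_at_infinity[OF that(1)]]
    by simp
  have "\<exists>q :: nat \<Rightarrow> real.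
      (\<forall>k\<in>{1..K}.
        (\<lambda>m. measure_pmf.expectation (steady_state_law K m (P m) (W m)) (\<lambda>x. x k)) \<longlonglongrightarrow> q k) \<and>
      (filterlim (\<lambda>m. real m * \<beta> m) at_top sequentially \<longrightarrow>
        (\<alpha>\<^sub>0 \<le> lam 1 / real K \<longrightarrow>
          q 1 = lam 1 - (real K - 1) * \<alpha>\<^sub>0 \<and> (\<forall>k\<in>{2..K}. q k = lam k / lam 1 * \<alpha>\<^sub>0)) \<and>
        (\<alpha>\<^sub>0 > lam 1 / real K \<longrightarrow> (\<forall>k\<in>{1..K}. q k = lam k / real K))) \<and>
      ((\<lambda>m. real m * \<beta> m) \<longlonglongrightarrow> 0 \<longrightarrow>
        (\<forall>k\<in>{1..K}. q k = lam k * (max (lam k) \<alpha>\<^sub>0 + (real K - 1) * \<alpha>\<^sub>0) /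
           (\<Sum>i\<in>{1..K}. max (lam i) \<alpha>\<^sub>0 + (real K - 1) * \<alpha>\<^sub>0)))" (is "\<exists>q. ?Q q")
    using assms(8)
  proof
    assume b0: "(\<lambda>m. real m * \<beta> m) \<longlonglongrightarrow> 0"
    show ?thesis
    proof (rule exI[of _ "\<lambda>k. lam k * (inert_weight K lam \<alpha>\<^sub>0 k / (\<Sum>i\<in>{1..K}. inert_weight K lam \<alpha>\<^sub>0 i))"], intro conjI ballI impI)
      show "(\<lambda>m. measure_pmf.expectation (steady_state_law K m (P m) (W m)) (\<lambda>x. x k)) \<longlonglongrightarrow>
          lam k * (inert_weight K lam \<alpha>\<^sub>0 k / (\<Sum>i\<in>{1..K}. inert_weight K lam \<alpha>\<^sub>0 i))" if "k \<in> {1..K}" for k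
        by (rule lim[OF deficient_limit[OF b0 that] that])
    qed (use not_both[OF _ b0] in \<open>simp_all add: inert_weight_def\<close>)
  next
    assume binf: "filterlim (\<lambda>m. real m * \<beta> m) at_top sequentially"
    show ?thesis
    proof (cases "\<alpha>\<^sub>0 \<le> lam 1 / real K")
      case True
      then have le: "lam 1 \<ge> real K * \<alpha>\<^sub>0" using assms(1) by (simp add: pos_le_divide_eq mult.commute)
      define q where "q k = (if k = 1 then lam 1 - (real K - 1) * \<alpha>\<^sub>0 else lam k / lam 1 * \<alpha>\<^sub>0)" for k
      have "(\<lambda>m. measure_pmf.expectation (steady_state_law K m (P m) (W m)) (\<lambda>x. x k)) \<longlonglongrightarrow> q k"
        if k: "k \<in> {1..K}" for k
      proof (cases "k = 1")
        case True
        have "lam 1 * (1 - (real K - 1) * (\<alpha>\<^sub>0 / lam 1)) = q 1" using l1 by (simp add: q_def field_simps)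
        then show ?thesis
          using lim[OF low_threshold_limit_first[OF binf le assms(3)] first] True by (simp del: One_nat_def)
      next
        case False
        then have k2: "k \<in> {2..K}" using k by auto
        have "lam k * (\<alpha>\<^sub>0 / lam 1) = q k" using False by (simp add: q_def)
        then show ?thesis using lim[OF low_threshold_limit[OF binf le assms(3) k2] k] by simp
      qed
      then have "?Q q" using True not_both[OF binf] by (auto simp: q_def simp del: One_nat_def)
      then show ?thesis by (rule exI[where P = ?Q])
    next
      case False
      then have high: "lam k < real K * \<alpha>\<^sub>0" if "k \<in> {1..K}" for k
      proof -
        have "lam k \<le> lam 1" using assms(3)[of k] that by (cases "k = 1") (auto simp: less_imp_le)
        then show ?thesis using False assms(1) by (simp add: pos_divide_less_eq mult.commute not_le)
      qed
      have "(\<lambda>m. measure_pmf.expectation (steady_state_law K m (P m) (W m)) (\<lambda>x. x k)) \<longlonglongrightarrow> lam k / real K"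
        if k: "k \<in> {1..K}" for k
        using lim[OF high_threshold_limit[OF binf high k] k] by simp
      then have "?Q (\<lambda>k. lam k / real K)" using False not_both[OF binf] by (auto simp del: One_nat_def)
      then show ?thesis by (rule exI[where P = ?Q])
    qed
  qed
  moreover have "(\<exists>!\<pi>. stationary_distribution (states K) (P m) (W m) \<pi>) \<and>
      (\<exists>!\<mu>. steady_state_distribution K m (P m) (W m) \<mu>)" if "m \<ge> 1" for m
    by (simp add: stat[OF that] steady[OF that])
  ultimately show ?thesis using integ by blast
qed

end
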